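(* Exact Bayesian Network Structure Learning, parameterized by the treewidth of the super-structure $S_f$, is W[1]-hard (under fpt-reductions).
   Context: A dag is a directed acyclic graph; $\mathrm{P}_D(v)$ denotes the set of parents (in-neighbors) of $v$ in a digraph $D$. A local score function $f$ on a finite set $N$ of nodes assigns to each $v\in N$ and each $P\subseteq N\setminus\{v\}$ a non-negative real number $f(v,P)$. The score of a dag $D$ on node set $N$ is $f(D)=\sum_{v\in N} f(v,\mathrm{P}_D(v))$. Exact Bayesian Network Structure Learning is the decision problem: given a local score function $f$ on a set $N$ of nodes and a real number $s>0$, is there a dag $D$ on $N$ with $f(D)\ge s$? The function $f$ is given in the non-zero representation, i.e., as a list of all tuples $(v,P,f(v,P))$ with $f(v,P)>0$. Let $\mathcal{P}_f(v)=\{P\subseteq N: f(v,P)>0\}\cup\{\emptyset\}$. The directed super-structure of $f$ is the digraph on $N$ containing an arc $(u,v)$ if and only if $u\in P$ for some $P\in\mathcal{P}_f(v)$; the super-structure $S_f$ is its skeleton (the underlying undirected graph). An fpt-reduction from a parameterized problem $L$ to a parameterized problem $L'$ maps instances $(I,k)$ of $L$ to instances $(I',k')$ of $L'$ such that $(I,k)$ is a yes-instance if and only if $(I',k')$ is, $k'\le g(k)$ for a computable function $g$, and the map is computable in time $O(h(k)n^c)$ for a computable function $h$ and a constant $c$, where $n$ is the size of $(I,k)$. W[1] is the standard parameterized complexity class; for example, deciding whether a graph contains a clique on $k$ nodes, parameterized by $k$, is W[1]-complete under fpt-reductions. *)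

theory Defs
  imports Complex_Main
begin

text \<open>
  The machine model is Jones's WHILE language: finite programs over finitely many variables
  that hold binary trees.  An expression is charged, at each of its nodes, one plus the size
  of the tree obtained there.  Hence a run of cost \<open>t\<close> cannot build trees of total size more
  than \<open>t\<close> (no free sharing of subtrees), and the model and multi-tape Turing machines simulate
  each other with polynomial overhead.
\<close>

datatype tree = Tip | Node tree tree

datatype expr = Var nat | TipE | NodeE expr expr | LeftE expr | RightE expr

type_synonym store = "nat \<Rightarrow> tree"

fun left :: "tree \<Rightarrow> tree" where
  "left Tip = Tip"
| "left (Node l r) = l"

fun right :: "tree \<Rightarrow> tree" where
  "right Tip = Tip"
| "right (Node l r) = r"

fun val :: "expr \<Rightarrow> store \<Rightarrow> tree" where
  "val (Var x) \<sigma> = \<sigma> x"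
| "val TipE \<sigma> = Tip"
| "val (NodeE a b) \<sigma> = Node (val a \<sigma>) (val b \<sigma>)"
| "val (LeftE a) \<sigma> = left (val a \<sigma>)"
| "val (RightE a) \<sigma> = right (val a \<sigma>)"

text \<open>The function \<open>size\<close> counts the inner nodes of a tree.\<close>

fun cost :: "expr \<Rightarrow> store \<Rightarrow> nat" where
  "cost (Var x) \<sigma> = 1 + size (\<sigma> x)"
| "cost TipE \<sigma> = 1"
| "cost (NodeE a b) \<sigma> = 1 + size (val (NodeE a b) \<sigma>) + cost a \<sigma> + cost b \<sigma>"
| "cost (LeftE a) \<sigma> = 1 + size (val (LeftE a) \<sigma>) + cost a \<sigma>"
| "cost (RightE a) \<sigma> = 1 + size (val (RightE a) \<sigma>) + cost a \<sigma>"

datatype prog =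
    Assign nat expr
  | Seq prog prog
  | If expr prog prog
  | While expr prog

text \<open>\<open>exec p \<sigma> t \<tau>\<close>: started in \<open>\<sigma>\<close>, program \<open>p\<close> halts in \<open>\<tau>\<close> after time \<open>t\<close>;
  \<^const>\<open>Tip\<close> counts as false in tests.\<close>

inductive exec :: "prog \<Rightarrow> store \<Rightarrow> nat \<Rightarrow> store \<Rightarrow> bool" where
  Assign: "exec (Assign x e) \<sigma> (cost e \<sigma>) (\<sigma>(x := val e \<sigma>))"
| Seq: "exec p \<sigma> t \<tau> \<Longrightarrow> exec q \<tau> u \<rho> \<Longrightarrow> exec (Seq p q) \<sigma> (t + u) \<rho>"
| IfTrue: "val e \<sigma> \<noteq> Tip \<Longrightarrow> exec p \<sigma> t \<tau> \<Longrightarrow> exec (If e p q) \<sigma> (cost e \<sigma> + t) \<tau>"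
| IfFalse: "val e \<sigma> = Tip \<Longrightarrow> exec q \<sigma> t \<tau> \<Longrightarrow> exec (If e p q) \<sigma> (cost e \<sigma> + t) \<tau>"
| WhileTrue: "val e \<sigma> \<noteq> Tip \<Longrightarrow> exec p \<sigma> t \<tau> \<Longrightarrow> exec (While e p) \<tau> u \<rho>
    \<Longrightarrow> exec (While e p) \<sigma> (cost e \<sigma> + t + u) \<rho>"
| WhileFalse: "val e \<sigma> = Tip \<Longrightarrow> exec (While e p) \<sigma> (cost e \<sigma>) \<sigma>"

text \<open>Input and output are passed in variable 0.\<close>

definition computes_in :: "prog \<Rightarrow> tree \<Rightarrow> tree \<Rightarrow> nat \<Rightarrow> bool" where
  "computes_in p x y t \<longleftrightarrow> (\<exists>\<tau>. exec p ((\<lambda>_. Tip)(0 := x)) t \<tau> \<and> \<tau> 0 = y)"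

text \<open>Binary representation, least significant bit first.\<close>

fun enc_nat :: "nat \<Rightarrow> tree" where
  "enc_nat n =
    (if n = 0 then Tip else Node (if odd n then Node Tip Tip else Tip) (enc_nat (n div 2)))"

declare enc_nat.simps [simp del]

fun enc_list :: "('a \<Rightarrow> tree) \<Rightarrow> 'a list \<Rightarrow> tree" where
  "enc_list enc [] = Tip"
| "enc_list enc (x # xs) = Node (enc x) (enc_list enc xs)"

text \<open>Used only for positive rationals: numerator and denominator in lowest terms.\<close>

definition enc_rat :: "rat \<Rightarrow> tree" where
  "enc_rat q = Node (enc_nat (nat (fst (quotient_of q)))) (enc_nat (nat (snd (quotient_of q))))"

text \<open>Instances are pairs \<open>(I, k)\<close> of a main part \<open>I\<close> and the parameter \<open>k\<close>.\<close>

record param_problem =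
  instances :: "(tree \<times> nat) set"
  yes_instances :: "(tree \<times> nat) set"

definition param_problem :: "param_problem \<Rightarrow> bool" where
  "param_problem L \<longleftrightarrow> yes_instances L \<subseteq> instances L"

fun enc_instance :: "tree \<times> nat \<Rightarrow> tree" where
  "enc_instance (x, k) = Node x (enc_nat k)"

definition computable :: "(nat \<Rightarrow> nat) \<Rightarrow> bool" where
  "computable g \<longleftrightarrow> (\<exists>p. \<forall>n. \<exists>t. computes_in p (enc_nat n) (enc_nat (g n)) t)"

text \<open>The constant hidden in \<open>O(h(k) n\<^sup>c)\<close> is absorbed by \<open>h\<close>; note that
  \<open>size (enc_instance _) \<ge> 1\<close>.\<close>

definition fpt_reduction ::
  "param_problem \<Rightarrow> param_problem \<Rightarrow> (tree \<times> nat \<Rightarrow> tree \<times> nat) \<Rightarrow> bool" where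
  "fpt_reduction L L' R \<longleftrightarrow>
    (\<forall>a \<in> instances L. R a \<in> instances L' \<and> (a \<in> yes_instances L \<longleftrightarrow> R a \<in> yes_instances L')) \<and>
    (\<exists>g. computable g \<and> (\<forall>a \<in> instances L. snd (R a) \<le> g (snd a))) \<and>
    (\<exists>p h c. computable h \<and>
      (\<forall>a \<in> instances L. \<exists>t. computes_in p (enc_instance a) (enc_instance (R a)) t \<and>
         t \<le> h (snd a) * size (enc_instance a) ^ c))"

definition fpt_reducible :: "param_problem \<Rightarrow> param_problem \<Rightarrow> bool" where
  "fpt_reducible L L' \<longleftrightarrow> (\<exists>R. fpt_reduction L L' R)"

text \<open>Undirected graphs are given by a set of vertices and a set of two-element edges.\<close>

definition simple_graph :: "'a set \<Rightarrow> 'a set set \<Rightarrow> bool" where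
  "simple_graph V E \<longleftrightarrow> finite V \<and> (\<forall>e\<in>E. \<exists>u\<in>V. \<exists>v\<in>V. u \<noteq> v \<and> e = {u, v})"

definition has_clique :: "'a set \<Rightarrow> 'a set set \<Rightarrow> nat \<Rightarrow> bool" where
  "has_clique V E k \<longleftrightarrow>
    (\<exists>C\<subseteq>V. finite C \<and> card C = k \<and> (\<forall>u\<in>C. \<forall>v\<in>C. u \<noteq> v \<longrightarrow> {u, v} \<in> E))"

definition encodes_graph :: "nat set \<Rightarrow> nat set set \<Rightarrow> tree \<Rightarrow> bool" where
  "encodes_graph V E x \<longleftrightarrow> (\<exists>vs es.
     distinct vs \<and> set vs = V \<and>
     distinct (map (\<lambda>(u, v). {u, v}) es) \<and> set (map (\<lambda>(u, v). {u, v}) es) = E \<and>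
     x = Node (enc_list enc_nat vs) (enc_list (\<lambda>(u, v). Node (enc_nat u) (enc_nat v)) es))"

definition Clique :: param_problem where
  "Clique = \<lparr>
     instances = {(x, k). \<exists>V E. simple_graph V E \<and> encodes_graph V E x},
     yes_instances = {(x, k). \<exists>V E. simple_graph V E \<and> encodes_graph V E x \<and> has_clique V E k} \<rparr>"

text \<open>W[1] is the class of all parameterized problems that are fpt-reducible to the canonical
  problem Clique.  This is forced by Clique being W[1]-complete and W[1] being closed under
  fpt-reductions.\<close>

definition W1 :: "param_problem set" where
  "W1 = {L. param_problem L \<and> fpt_reducible L Clique}"

definition W1_hard :: "param_problem \<Rightarrow> bool" where
  "W1_hard L \<longleftrightarrow> (\<forall>L'\<in>W1. fpt_reducible L' L)"

definition connected_in :: "'a set set \<Rightarrow> 'a set \<Rightarrow> bool" where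
  "connected_in E A \<longleftrightarrow>
    (\<forall>u\<in>A. \<forall>v\<in>A. (u, v) \<in> {(a, b). a \<in> A \<and> b \<in> A \<and> {a, b} \<in> E}\<^sup>*)"

definition is_cycle :: "'a set set \<Rightarrow> 'a list \<Rightarrow> bool" where
  "is_cycle E xs \<longleftrightarrow> length xs \<ge> 3 \<and> distinct xs \<and>
    (\<forall>i<length xs. {xs ! i, xs ! (Suc i mod length xs)} \<in> E)"

definition tree_graph :: "'a set \<Rightarrow> 'a set set \<Rightarrow> bool" where
  "tree_graph V E \<longleftrightarrow>
    simple_graph V E \<and> V \<noteq> {} \<and> connected_in E V \<and> (\<nexists>xs. is_cycle E xs)"

definition tree_decomposition ::
  "'a set \<Rightarrow> 'a set set \<Rightarrow> nat set \<Rightarrow> nat set set \<Rightarrow> (nat \<Rightarrow> 'a set) \<Rightarrow> bool" where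
  "tree_decomposition V E I F bag \<longleftrightarrow>
    tree_graph I F \<and>
    (\<forall>i\<in>I. bag i \<subseteq> V) \<and>
    (\<forall>v\<in>V. \<exists>i\<in>I. v \<in> bag i) \<and>
    (\<forall>e\<in>E. \<exists>i\<in>I. e \<subseteq> bag i) \<and>
    (\<forall>v\<in>V. connected_in F {i \<in> I. v \<in> bag i})"

definition decomposition_width :: "nat set \<Rightarrow> (nat \<Rightarrow> 'a set) \<Rightarrow> nat" where
  "decomposition_width I bag = Max ((\<lambda>i. card (bag i)) ` I) - 1"

text \<open>For finite graphs only.  The empty graph gets treewidth 0 (not \<open>- 1\<close>).\<close>

definition treewidth :: "'a set \<Rightarrow> 'a set set \<Rightarrow> nat" where
  "treewidth V E =
    (LEAST w. \<exists>I F bag. tree_decomposition V E I F bag \<and> decomposition_width I bag = w)"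

text \<open>Digraphs on \<open>N\<close> are given by their sets of arcs.\<close>

definition dag :: "'a set \<Rightarrow> ('a \<times> 'a) set \<Rightarrow> bool" where
  "dag N D \<longleftrightarrow> D \<subseteq> N \<times> N \<and> acyclic D"

definition parents :: "('a \<times> 'a) set \<Rightarrow> 'a \<Rightarrow> 'a set" where
  "parents D v = {u. (u, v) \<in> D}"

definition local_score :: "'a set \<Rightarrow> ('a \<Rightarrow> 'a set \<Rightarrow> real) \<Rightarrow> bool" where
  "local_score N f \<longleftrightarrow> finite N \<and> (\<forall>v\<in>N. \<forall>P. P \<subseteq> N - {v} \<longrightarrow> 0 \<le> f v P)"

definition score :: "'a set \<Rightarrow> ('a \<Rightarrow> 'a set \<Rightarrow> real) \<Rightarrow> ('a \<times> 'a) set \<Rightarrow> real" where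
  "score N f D = (\<Sum>v\<in>N. f v (parents D v))"

definition exact_BNSL :: "'a set \<Rightarrow> ('a \<Rightarrow> 'a set \<Rightarrow> real) \<Rightarrow> real \<Rightarrow> bool" where
  "exact_BNSL N f s \<longleftrightarrow> (\<exists>D. dag N D \<and> score N f D \<ge> s)"

text \<open>A local score function is only meaningful at \<open>v \<in> N\<close> and \<open>P \<subseteq> N - {v}\<close>, so potential
  parent sets are restricted accordingly.\<close>

definition parent_sets :: "'a set \<Rightarrow> ('a \<Rightarrow> 'a set \<Rightarrow> real) \<Rightarrow> 'a \<Rightarrow> 'a set set" where
  "parent_sets N f v = {P. P \<subseteq> N - {v} \<and> f v P > 0} \<union> {{}}"

definition directed_super_structure ::
  "'a set \<Rightarrow> ('a \<Rightarrow> 'a set \<Rightarrow> real) \<Rightarrow> ('a \<times> 'a) set" where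
  "directed_super_structure N f = {(u, v). u \<in> N \<and> v \<in> N \<and> (\<exists>P\<in>parent_sets N f v. u \<in> P)}"

definition skeleton :: "('a \<times> 'a) set \<Rightarrow> 'a set set" where
  "skeleton D = {{u, v} | u v. (u, v) \<in> D}"

definition super_structure :: "'a set \<Rightarrow> ('a \<Rightarrow> 'a set \<Rightarrow> real) \<Rightarrow> 'a set set" where
  "super_structure N f = skeleton (directed_super_structure N f)"

text \<open>A finite encoding forces the positive scores to be rational.\<close>

definition nonzero_representation ::
  "'a set \<Rightarrow> ('a \<Rightarrow> 'a set \<Rightarrow> real) \<Rightarrow> ('a \<times> 'a list \<times> rat) list \<Rightarrow> bool" where
  "nonzero_representation N f T \<longleftrightarrow>
    distinct (map (\<lambda>(v, P, q). (v, set P)) T) \<and>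
    (\<forall>(v, P, q)\<in>set T. distinct P) \<and>
    set (map (\<lambda>(v, P, q). (v, set P, real_of_rat q)) T) =
      {(v, P, f v P) | v P. v \<in> N \<and> P \<subseteq> N - {v} \<and> f v P > 0}"

definition encodes_BNSL :: "nat set \<Rightarrow> (nat \<Rightarrow> nat set \<Rightarrow> real) \<Rightarrow> real \<Rightarrow> tree \<Rightarrow> bool" where
  "encodes_BNSL N f s x \<longleftrightarrow> (\<exists>ns T q.
     distinct ns \<and> set ns = N \<and> nonzero_representation N f T \<and> s = real_of_rat q \<and>
     x = Node (enc_list enc_nat ns)
          (Node (enc_list (\<lambda>(v, P, r). Node (enc_nat v) (Node (enc_list enc_nat P) (enc_rat r))) T)
            (enc_rat q)))"

definition BNSL_treewidth :: param_problem where
  "BNSL_treewidth = \<lparr>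
     instances = {(x, k). \<exists>N f s. local_score N f \<and> s > 0 \<and> encodes_BNSL N f s x \<and>
       k = treewidth N (super_structure N f)},
     yes_instances = {(x, k). \<exists>N f s. local_score N f \<and> s > 0 \<and> encodes_BNSL N f s x \<and>
       k = treewidth N (super_structure N f) \<and> exact_BNSL N f s} \<rparr>"

end

theory Submission
  imports Defs
begin

text \<open>
  It suffices to reduce Clique to the learning problem in polynomial time.  Given a graph on
  \<open>V\<close> and \<open>k\<close> colours, there is a vertex node \<open>x i w\<close> for each colour \<open>i\<close> and \<open>w \<in> V\<close>, a hub
  \<open>h i i\<close> for each colour and a hub \<open>h i j\<close> for each pair of distinct colours.  The hub \<open>h i i\<close>
  scores 2 for a parent set \<open>{x i u}\<close>, and \<open>h i j\<close> scores 1 for \<open>{x i u, x j v}\<close> with \<open>{u, v}\<close> an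
  edge: hubs select vertices and edges.  A vertex node scores 1 if its parents are all the hubs,
  which acyclicity forbids for a node selected by some hub.  So every colour loses at least 1,
  and nothing more is lost iff all hubs agree on one vertex per colour, that is, iff there is a
  clique of size \<open>k\<close>.

  Deleting the hubs leaves isolated vertex nodes, so the treewidth is at most the number \<open>m\<close> of
  hubs.  As the reduction must output the exact treewidth, a disjoint clique on \<open>m + 1\<close> nodes is
  added whose full score is always attainable; it forces the treewidth to be \<open>m\<close>.
\<close>

text \<open>The weights make the threshold equal to the number of nodes. If \<open>h i i\<close>
  scored only 1, selecting a vertex would gain exactly what the selected vertex node loses, and a
  colour without a selection would do as well. The score 2 makes selection strictly better, so each
  \<open>h i i\<close> together with the vertex nodes of its colour contributes at most
  \<open>card V + 1\<close>. These bounds, with 1 for each remaining node, add up to the threshold,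
  so a dag that reaches it attains all of them.

  The parameter \<open>k\<close> is given in binary and may be exponential in the input length,
  hence only a bounded number of colours can be written down.

  Running time is a statement about concrete programs. To keep programming small, polynomial time is
  obtained from closure under composition, case distinction and folds whose accumulator grows
  moderately, and nodes are numbers whose binary digits list operations can produce.

  Yes-instances are defined through some decoding of the tree, so correctness also needs that the
  encoding determines the score function at all meaningful arguments.\<close>

section \<open>Pairing of natural numbers and suffixes of lists\<close>

text \<open>Interleaving the bits of \<open>a\<close> with ones makes them self-delimiting; the extra one before
  \<open>b\<close> keeps the result in normal form when \<open>b = 0\<close>.\<close>

fun pair :: "nat \<Rightarrow> nat \<Rightarrow> nat" where
  "pair a b = (if a = 0 then 4 * b + 2 else 4 * pair (a div 2) b + 2 * (a mod 2) + 1)"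

declare pair.simps [simp del]

lemma pair_0: "pair 0 b = 4 * b + 2"
  by (subst pair.simps) simp

lemma pair_rec: "a \<noteq> 0 \<Longrightarrow> pair a b = 4 * pair (a div 2) b + 2 * (a mod 2) + 1"
  by (subst pair.simps) simp

lemma even_pair: "even (pair a b) \<longleftrightarrow> a = 0"
proof (cases "a = 0")
  case False
  then show ?thesis unfolding pair_rec[OF False] by simp
qed (simp add: pair_0)

lemma pair_inject: "pair a b = pair c d \<longleftrightarrow> a = c \<and> b = d"
proof (induction a arbitrary: c rule: less_induct)
  case (less a)
  show ?case
  proof (cases "a = 0 \<or> c = 0")
    case True
    show ?thesis
    proof
      assume eq: "pair a b = pair c d"
      then have "a = 0 \<longleftrightarrow> c = 0" using even_pair[of a b] even_pair[of c d] by simp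
      then have "a = 0" "c = 0" using True by simp_all
      then show "a = c \<and> b = d" using eq pair_0[of b] pair_0[of d] by simp
    qed simp
  next
    case False
    \<comment> \<open>The lowest base-4 digit of \<open>pair a b\<close> is 1 or 3 and carries one
      bit of \<open>a\<close>; comparing it splits off that bit.\<close>
    have digits: "p = q \<and> x = y"
      if "4 * p + 2 * x + 1 = 4 * q + 2 * y + 1" "x < 2" "y < 2" for p q x y :: nat
      using that by arith
    show ?thesis
    proof
      assume "pair a b = pair c d"
      then have "4 * pair (a div 2) b + 2 * (a mod 2) + 1 = 4 * pair (c div 2) d + 2 * (c mod 2) + 1"
        using False by (simp only: pair_rec[of a] pair_rec[of c] de_Morgan_disj not_False_eq_True)
      from digits[OF this] have "pair (a div 2) b = pair (c div 2) d" "a mod 2 = c mod 2"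
        by simp_all
      with less[of "a div 2" "c div 2"] False have "a div 2 = c div 2" "b = d" by auto
      with \<open>a mod 2 = c mod 2\<close> show "a = c \<and> b = d" by (metis div_mult_mod_eq)
    qed simp
  qed
qed

text \<open>The product \<open>(a + 1) * (b + 1)\<close> exceeds both \<open>a + b\<close> and
  \<open>a * b\<close>, so this bound lets pairing replace addition and multiplication wherever a
  computable upper bound is enough.\<close>

lemma pair_ge: "(a + 1) * (b + 1) \<le> pair a b"
proof (induction a rule: less_induct)
  case (less a)
  show ?case
  proof (cases "a = 0")
    case False
    then have "(a div 2 + 1) * (b + 1) \<le> pair (a div 2) b" using less by simp
    moreover have "(a + 1) * (b + 1) \<le> (4 * (a div 2 + 1)) * (b + 1)" by (intro mult_right_mono) auto
    moreover have "4 * pair (a div 2) b \<le> pair a b" using pair_rec[OF False, of b] by simp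
    ultimately show ?thesis unfolding mult.assoc by linarith
  qed (simp add: pair_0)
qed

lemma pair_pos: "0 < pair a b"
  using pair_ge[of a b] by (cases "pair a b") auto

text \<open>A suffix displays an element together with everything after it. It is used for the
  unordered pairs of colours and for the transitive tournament on the nodes of the added
  clique.\<close>

fun suffixes :: "'a list \<Rightarrow> 'a list list" where
  "suffixes [] = []"
| "suffixes (x # xs) = (x # xs) # suffixes xs"

section \<open>Composable WHILE programs\<close>

lemma size_val: "size (val e \<sigma>) \<le> cost e \<sigma>"
  by (cases e) auto

text \<open>Every stored tree has been paid for by the expression that built it. Time bounds
  therefore bound output sizes, which is what makes polynomial time closed under
  composition.\<close>

lemma exec_size: "exec p \<sigma> t \<tau> \<Longrightarrow> size (\<tau> x) \<le> size (\<sigma> x) + t"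
proof (induction rule: exec.induct)
  case (Assign y e \<sigma>)
  then show ?case using size_val[of e \<sigma>] by auto
qed auto

lemma exec_Assign:
  "c = cost e \<sigma> \<Longrightarrow> \<tau> = \<sigma>(x := val e \<sigma>) \<Longrightarrow> exec (Assign x e) \<sigma> c \<tau>"
  using exec.Assign by simp

section \<open>Relocating programs to higher variables\<close>

fun shift_expr :: "nat \<Rightarrow> expr \<Rightarrow> expr" where
  "shift_expr b (Var x) = Var (x + b)"
| "shift_expr b TipE = TipE"
| "shift_expr b (NodeE e f) = NodeE (shift_expr b e) (shift_expr b f)"
| "shift_expr b (LeftE e) = LeftE (shift_expr b e)"
| "shift_expr b (RightE e) = RightE (shift_expr b e)"

fun shift :: "nat \<Rightarrow> prog \<Rightarrow> prog" where
  "shift b (Assign x e) = Assign (x + b) (shift_expr b e)"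
| "shift b (Seq p q) = Seq (shift b p) (shift b q)"
| "shift b (If e p q) = If (shift_expr b e) (shift b p) (shift b q)"
| "shift b (While e p) = While (shift_expr b e) (shift b p)"

fun expr_bound :: "expr \<Rightarrow> nat" where
  "expr_bound (Var x) = Suc x"
| "expr_bound TipE = 0"
| "expr_bound (NodeE e f) = max (expr_bound e) (expr_bound f)"
| "expr_bound (LeftE e) = expr_bound e"
| "expr_bound (RightE e) = expr_bound e"

fun prog_bound :: "prog \<Rightarrow> nat" where
  "prog_bound (Assign x e) = max (Suc x) (expr_bound e)"
| "prog_bound (Seq p q) = max (prog_bound p) (prog_bound q)"
| "prog_bound (If e p q) = max (expr_bound e) (max (prog_bound p) (prog_bound q))"
| "prog_bound (While e p) = max (expr_bound e) (prog_bound p)"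

lemma val_cost_shift:
  assumes "expr_bound e \<le> m" "\<And>x. x < m \<Longrightarrow> \<sigma>' (x + b) = \<sigma> x"
  shows "val (shift_expr b e) \<sigma>' = val e \<sigma> \<and> cost (shift_expr b e) \<sigma>' = cost e \<sigma>"
  using assms by (induction e) auto

text \<open>A program sees only variables below its bound, so agreement with the original store on
  that range is an invariant of the run. The time does not change, because all expressions read the
  same trees.\<close>

lemma exec_shift:
  assumes "exec p \<sigma> t \<tau>" "prog_bound p \<le> m" "\<And>x. x < m \<Longrightarrow> \<sigma>' (x + b) = \<sigma> x"
  shows "\<exists>\<tau>'. exec (shift b p) \<sigma>' t \<tau>' \<and> (\<forall>x<m. \<tau>' (x + b) = \<tau> x) \<and> (\<forall>y<b. \<tau>' y = \<sigma>' y)"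
  using assms
proof (induction arbitrary: \<sigma>' rule: exec.induct)
  case (Assign x e \<sigma>)
  have "val (shift_expr b e) \<sigma>' = val e \<sigma>" "cost (shift_expr b e) \<sigma>' = cost e \<sigma>"
    using val_cost_shift[of e m \<sigma>' b \<sigma>] Assign by auto
  then have "exec (shift b (Assign x e)) \<sigma>' (cost e \<sigma>) (\<sigma>'(x + b := val e \<sigma>))"
    by (simp add: exec_Assign)
  moreover have "\<forall>y<m. (\<sigma>'(x + b := val e \<sigma>)) (y + b) = (\<sigma>(x := val e \<sigma>)) y"
    using Assign by auto
  ultimately show ?case by fastforce
next
  case (Seq p \<sigma> t \<tau> q u \<rho>)
  then obtain \<tau>' where 1: "exec (shift b p) \<sigma>' t \<tau>'" "\<forall>x<m. \<tau>' (x + b) = \<tau> x" "\<forall>y<b. \<tau>' y = \<sigma>' y"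
    by (metis max.bounded_iff prog_bound.simps(2))
  with Seq obtain \<rho>' where "exec (shift b q) \<tau>' u \<rho>'" "\<forall>x<m. \<rho>' (x + b) = \<rho> x" "\<forall>y<b. \<rho>' y = \<tau>' y"
    by (metis max.bounded_iff prog_bound.simps(2))
  with 1 show ?case by (auto intro!: exI[of _ \<rho>'] exec.Seq)
next
  case (IfTrue e \<sigma> p t \<tau> q)
  have e: "val (shift_expr b e) \<sigma>' = val e \<sigma>" "cost (shift_expr b e) \<sigma>' = cost e \<sigma>"
    using val_cost_shift[of e m \<sigma>' b \<sigma>] IfTrue by auto
  from IfTrue obtain \<tau>' where 1: "exec (shift b p) \<sigma>' t \<tau>'" "\<forall>x<m. \<tau>' (x + b) = \<tau> x" "\<forall>y<b. \<tau>' y = \<sigma>' y"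
    by (metis max.bounded_iff prog_bound.simps(3))
  with e IfTrue exec.IfTrue[of "shift_expr b e" \<sigma>' "shift b p" t \<tau>' "shift b q"] show ?case
    by (auto intro!: exI[of _ \<tau>'])
next
  case (IfFalse e \<sigma> q t \<tau> p)
  have e: "val (shift_expr b e) \<sigma>' = val e \<sigma>" "cost (shift_expr b e) \<sigma>' = cost e \<sigma>"
    using val_cost_shift[of e m \<sigma>' b \<sigma>] IfFalse by auto
  from IfFalse obtain \<tau>' where 1: "exec (shift b q) \<sigma>' t \<tau>'" "\<forall>x<m. \<tau>' (x + b) = \<tau> x" "\<forall>y<b. \<tau>' y = \<sigma>' y"
    by (metis max.bounded_iff prog_bound.simps(3))
  with e IfFalse exec.IfFalse[of "shift_expr b e" \<sigma>' "shift b q" t \<tau>' "shift b p"] show ?case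
    by (auto intro!: exI[of _ \<tau>'])
next
  case (WhileTrue e \<sigma> p t \<tau> u \<rho>)
  have e: "val (shift_expr b e) \<sigma>' = val e \<sigma>" "cost (shift_expr b e) \<sigma>' = cost e \<sigma>"
    using val_cost_shift[of e m \<sigma>' b \<sigma>] WhileTrue by auto
  from WhileTrue obtain \<tau>' where 1: "exec (shift b p) \<sigma>' t \<tau>'" "\<forall>x<m. \<tau>' (x + b) = \<tau> x" "\<forall>y<b. \<tau>' y = \<sigma>' y"
    by (metis max.bounded_iff prog_bound.simps(4))
  with WhileTrue.IH(2)[of \<tau>'] WhileTrue.prems obtain \<rho>' where
    2: "exec (shift b (While e p)) \<tau>' u \<rho>'" "\<forall>x<m. \<rho>' (x + b) = \<rho> x" "\<forall>y<b. \<rho>' y = \<tau>' y"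
    by blast
  with 1 e WhileTrue exec.WhileTrue[of "shift_expr b e" \<sigma>' "shift b p" t \<tau>' u \<rho>'] show ?case
    by (auto intro!: exI[of _ \<rho>'])
next
  case (WhileFalse e \<sigma> p)
  have "val (shift_expr b e) \<sigma>' = val e \<sigma>" "cost (shift_expr b e) \<sigma>' = cost e \<sigma>"
    using val_cost_shift[of e m \<sigma>' b \<sigma>] WhileFalse by auto
  with exec.WhileFalse[of "shift_expr b e" \<sigma>'] WhileFalse show ?case
    by (auto intro!: exI[of _ \<sigma>'])
qed

text \<open>A program in the sense of \<open>computes_in\<close> expects \<open>Tip\<close> in all
  variables but the input, while a relocated one finds arbitrary contents. There is no skip command;
  assigning \<open>b\<close> to itself serves as one.\<close>

fun clear :: "nat \<Rightarrow> nat \<Rightarrow> prog" where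
  "clear b 0 = Assign b (Var b)"
| "clear b (Suc m) = Seq (clear b m) (Assign (Suc m + b) TipE)"

lemma exec_clear:
  "exec (clear b m) \<sigma> (1 + size (\<sigma> b) + m) (\<lambda>y. if b < y \<and> y \<le> m + b then Tip else \<sigma> y)"
proof (induction m)
  case 0
  have "(\<lambda>y. if b < y \<and> y \<le> 0 + b then Tip else \<sigma> y) = \<sigma>(b := val (Var b) \<sigma>)" by (rule ext) auto
  then show ?case using exec.Assign[of b "Var b" \<sigma>] by (simp only:) simp
next
  case (Suc m)
  let ?\<tau> = "\<lambda>y. if b < y \<and> y \<le> m + b then Tip else \<sigma> y"
  have "(\<lambda>y. if b < y \<and> y \<le> Suc m + b then Tip else \<sigma> y) = ?\<tau>(Suc m + b := val TipE ?\<tau>)" by auto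
  then show ?case using exec.Seq[OF Suc exec.Assign[of "Suc m + b" TipE ?\<tau>]] by (simp only:) simp
qed

text \<open>Quantifying over the base variable \<open>b\<close> makes programs composable: variables below
  \<open>b\<close> survive, those above it are scratch space with arbitrary initial contents.\<close>

definition computes_on :: "tree set \<Rightarrow> (tree \<Rightarrow> tree) \<Rightarrow> (tree \<Rightarrow> nat) \<Rightarrow> bool" where
  "computes_on X f T \<longleftrightarrow> (\<forall>b. \<exists>p. \<forall>\<sigma>. \<sigma> b \<in> X \<longrightarrow>
     (\<exists>t \<tau>. exec p \<sigma> t \<tau> \<and> t \<le> T (\<sigma> b) \<and> \<tau> b = f (\<sigma> b) \<and> (\<forall>y<b. \<tau> y = \<sigma> y)))"

lemma computes_onE:
  assumes "computes_on X f T"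
  obtains p where "\<And>\<sigma>. \<sigma> b \<in> X \<Longrightarrow>
    \<exists>t \<tau>. exec p \<sigma> t \<tau> \<and> t \<le> T (\<sigma> b) \<and> \<tau> b = f (\<sigma> b) \<and> (\<forall>y<b. \<tau> y = \<sigma> y)"
  using assms unfolding computes_on_def by blast

lemma computes_on_of_computes_in:
  assumes "\<And>x. x \<in> X \<Longrightarrow> \<exists>t\<le>T x. computes_in p x (f x) t"
  shows "\<exists>m. computes_on X f (\<lambda>x. size x + m + T x)"
proof -
  let ?m = "prog_bound p"
  have "computes_on X f (\<lambda>x. size x + Suc ?m + T x)"
    unfolding computes_on_def
  proof (intro allI exI[of _ "Seq (clear b ?m) (shift b p)" for b] impI)
    fix b :: nat and \<sigma> :: store assume "\<sigma> b \<in> X"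
    let ?\<tau> = "\<lambda>y. if b < y \<and> y \<le> ?m + b then Tip else \<sigma> y"
    obtain t \<tau> where t: "t \<le> T (\<sigma> b)" "exec p ((\<lambda>_. Tip)(0 := \<sigma> b)) t \<tau>" "\<tau> 0 = f (\<sigma> b)"
      using assms[OF \<open>\<sigma> b \<in> X\<close>] unfolding computes_in_def by blast
    \<comment> \<open>With the bound \<open>Suc ?m\<close> the range of agreement certainly contains
      the output variable 0, and it is exactly the input variable and those just cleared.\<close>
    obtain \<tau>' where \<tau>': "exec (shift b p) ?\<tau> t \<tau>'" "\<forall>x<Suc ?m. \<tau>' (x + b) = \<tau> x" "\<forall>y<b. \<tau>' y = ?\<tau> y"
      using exec_shift[OF t(2), of "Suc ?m" ?\<tau> b] by (fastforce split: if_splits)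
    show "\<exists>t' \<tau>'. exec (Seq (clear b ?m) (shift b p)) \<sigma> t' \<tau>' \<and> t' \<le> size (\<sigma> b) + Suc ?m + T (\<sigma> b) \<and>
         \<tau>' b = f (\<sigma> b) \<and> (\<forall>y<b. \<tau>' y = \<sigma> y)"
      using exec.Seq[OF exec_clear \<tau>'(1)] \<tau>' t
      by (intro exI[of _ "1 + size (\<sigma> b) + ?m + t"] exI[of _ \<tau>']) auto
  qed
  then show ?thesis by blast
qed

lemma computes_in_of_computes_on:
  assumes "computes_on X f T"
  obtains p where "\<And>x. x \<in> X \<Longrightarrow> \<exists>t\<le>T x. computes_in p x (f x) t"
proof -
  obtain p where p: "\<And>\<sigma>. \<sigma> 0 \<in> X \<Longrightarrow> \<exists>t \<tau>. exec p \<sigma> t \<tau> \<and> t \<le> T (\<sigma> 0) \<and> \<tau> 0 = f (\<sigma> 0)"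
    using computes_onE[OF assms, of 0] by metis
  show thesis
  proof (rule that[of p])
    fix x assume "x \<in> X"
    then show "\<exists>t\<le>T x. computes_in p x (f x) t"
      using p[of "(\<lambda>_. Tip)(0 := x)"] unfolding computes_in_def by (simp, blast)
  qed
qed

lemma computes_on_size:
  assumes "computes_on X f T" "x \<in> X"
  shows "size (f x) \<le> size x + T x"
proof -
  obtain p where "\<And>x. x \<in> X \<Longrightarrow> \<exists>t\<le>T x. computes_in p x (f x) t"
    using computes_in_of_computes_on[OF assms(1)] by blast
  then obtain t \<tau> where "t \<le> T x" "exec p ((\<lambda>_. Tip)(0 := x)) t \<tau>" "\<tau> 0 = f x"
    using assms(2) unfolding computes_in_def by blast
  then show ?thesis using exec_size[of p _ t \<tau> 0] by fastforce
qed

lemma computes_on_cong: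
  assumes "computes_on X f T" "Y \<subseteq> X" "\<And>x. x \<in> Y \<Longrightarrow> f x = g x" "\<And>x. x \<in> Y \<Longrightarrow> T x \<le> U x"
  shows "computes_on Y g U"
  unfolding computes_on_def
proof
  fix b
  obtain p where "\<And>\<sigma>. \<sigma> b \<in> X \<Longrightarrow>
    \<exists>t \<tau>. exec p \<sigma> t \<tau> \<and> t \<le> T (\<sigma> b) \<and> \<tau> b = f (\<sigma> b) \<and> (\<forall>y<b. \<tau> y = \<sigma> y)"
    using computes_onE[OF assms(1)] by blast
  then have "\<forall>\<sigma>. \<sigma> b \<in> Y \<longrightarrow> (\<exists>t \<tau>. exec p \<sigma> t \<tau> \<and> t \<le> U (\<sigma> b) \<and> \<tau> b = g (\<sigma> b) \<and> (\<forall>y<b. \<tau> y = \<sigma> y))"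
    using assms(2-4) by (metis le_trans subsetD)
  then show "\<exists>p. \<forall>\<sigma>. \<sigma> b \<in> Y \<longrightarrow> (\<exists>t \<tau>. exec p \<sigma> t \<tau> \<and> t \<le> U (\<sigma> b) \<and> \<tau> b = g (\<sigma> b) \<and> (\<forall>y<b. \<tau> y = \<sigma> y))"
    by blast
qed

lemma computes_on_comp:
  assumes "computes_on X f T" "computes_on Y g U" "f ` X \<subseteq> Y"
  shows "computes_on X (\<lambda>x. g (f x)) (\<lambda>x. T x + U (f x))"
  unfolding computes_on_def
proof
  fix b
  obtain p where p: "\<And>\<sigma>. \<sigma> b \<in> X \<Longrightarrow>
    \<exists>t \<tau>. exec p \<sigma> t \<tau> \<and> t \<le> T (\<sigma> b) \<and> \<tau> b = f (\<sigma> b) \<and> (\<forall>y<b. \<tau> y = \<sigma> y)"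
    using computes_onE[OF assms(1)] by blast
  obtain q where q: "\<And>\<sigma>. \<sigma> b \<in> Y \<Longrightarrow>
    \<exists>t \<tau>. exec q \<sigma> t \<tau> \<and> t \<le> U (\<sigma> b) \<and> \<tau> b = g (\<sigma> b) \<and> (\<forall>y<b. \<tau> y = \<sigma> y)"
    using computes_onE[OF assms(2)] by blast
  show "\<exists>r. \<forall>\<sigma>. \<sigma> b \<in> X \<longrightarrow> (\<exists>t \<tau>. exec r \<sigma> t \<tau> \<and> t \<le> T (\<sigma> b) + U (f (\<sigma> b)) \<and>
      \<tau> b = g (f (\<sigma> b)) \<and> (\<forall>y<b. \<tau> y = \<sigma> y))"
  proof (intro exI[of _ "Seq p q"] allI impI)
    fix \<sigma> assume "\<sigma> b \<in> X"
    then obtain t \<tau> where 1: "exec p \<sigma> t \<tau>" "t \<le> T (\<sigma> b)" "\<tau> b = f (\<sigma> b)" "\<forall>y<b. \<tau> y = \<sigma> y"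
      using p by blast
    moreover have "\<tau> b \<in> Y" using 1 \<open>\<sigma> b \<in> X\<close> assms(3) by auto
    ultimately obtain u \<rho> where "exec q \<tau> u \<rho>" "u \<le> U (\<tau> b)" "\<rho> b = g (\<tau> b)" "\<forall>y<b. \<rho> y = \<tau> y"
      using q by blast
    with 1 exec.Seq[of p \<sigma> t \<tau> q u \<rho>]
    show "\<exists>t \<tau>. exec (Seq p q) \<sigma> t \<tau> \<and> t \<le> T (\<sigma> b) + U (f (\<sigma> b)) \<and>
      \<tau> b = g (f (\<sigma> b)) \<and> (\<forall>y<b. \<tau> y = \<sigma> y)"
      by (intro exI[of _ "t + u"] exI[of _ \<rho>]) auto
  qed
qed

text \<open>Both programs need the input and overwrite it, so each gets a copy at a base variable
  above the original; the second base lies above the first result and leaves it intact.\<close>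

lemma computes_on_pair:
  assumes "computes_on X f T" "computes_on X g U"
  shows "computes_on X (\<lambda>x. Node (f x) (g x))
    (\<lambda>x. 2 * size x + 2 * (size (f x) + size (g x)) + T x + U x + 10)"
  unfolding computes_on_def
proof
  fix b
  obtain p where p: "\<And>\<sigma>. \<sigma> (b+1) \<in> X \<Longrightarrow>
    \<exists>t \<tau>. exec p \<sigma> t \<tau> \<and> t \<le> T (\<sigma> (b+1)) \<and> \<tau> (b+1) = f (\<sigma> (b+1)) \<and> (\<forall>y<b+1. \<tau> y = \<sigma> y)"
    using computes_onE[OF assms(1)] by blast
  obtain q where q: "\<And>\<sigma>. \<sigma> (b+2) \<in> X \<Longrightarrow>
    \<exists>t \<tau>. exec q \<sigma> t \<tau> \<and> t \<le> U (\<sigma> (b+2)) \<and> \<tau> (b+2) = g (\<sigma> (b+2)) \<and> (\<forall>y<b+2. \<tau> y = \<sigma> y)"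
    using computes_onE[OF assms(2)] by blast
  let ?r = "Seq (Assign (b+1) (Var b)) (Seq p (Seq (Assign (b+2) (Var b)) (Seq q
      (Assign b (NodeE (Var (b+1)) (Var (b+2)))))))"
  show "\<exists>r. \<forall>\<sigma>. \<sigma> b \<in> X \<longrightarrow> (\<exists>t \<tau>. exec r \<sigma> t \<tau> \<and>
      t \<le> 2 * size (\<sigma> b) + 2 * (size (f (\<sigma> b)) + size (g (\<sigma> b))) + T (\<sigma> b) + U (\<sigma> b) + 10 \<and>
      \<tau> b = Node (f (\<sigma> b)) (g (\<sigma> b)) \<and> (\<forall>y<b. \<tau> y = \<sigma> y))"
  proof (intro exI[of _ ?r] allI impI)
    fix \<sigma> assume "\<sigma> b \<in> X"
    let ?x = "\<sigma> b"
    let ?\<sigma>1 = "\<sigma>(b+1 := ?x)"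
    obtain t1 \<tau>1 where 1: "exec p ?\<sigma>1 t1 \<tau>1" "t1 \<le> T ?x" "\<tau>1 (b+1) = f ?x" "\<forall>y<b+1. \<tau>1 y = ?\<sigma>1 y"
      using p[of ?\<sigma>1] \<open>\<sigma> b \<in> X\<close> by auto
    let ?\<sigma>2 = "\<tau>1(b+2 := ?x)"
    obtain t2 \<tau>2 where 2: "exec q ?\<sigma>2 t2 \<tau>2" "t2 \<le> U ?x" "\<tau>2 (b+2) = g ?x" "\<forall>y<b+2. \<tau>2 y = ?\<sigma>2 y"
      using q[of ?\<sigma>2] \<open>\<sigma> b \<in> X\<close> by auto
    let ?\<sigma>3 = "\<tau>2(b := Node (f ?x) (g ?x))"
    let ?t = "(1 + size ?x) + (t1 + ((1 + size ?x) + (t2 + (4 + 2 * (size (f ?x) + size (g ?x))))))"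
    have v: "\<tau>2 (Suc b) = f ?x" "\<tau>2 (Suc (Suc b)) = g ?x" using 1 2 by auto
    have "exec ?r \<sigma> ?t ?\<sigma>3"
      apply (rule exec.Seq[of _ _ _ ?\<sigma>1])
       apply (rule exec_Assign; simp)
      apply (rule exec.Seq[OF 1(1)])
      apply (rule exec.Seq[of _ _ _ ?\<sigma>2])
       apply (rule exec_Assign; simp add: 1)
      apply (rule exec.Seq[OF 2(1)])
      apply (rule exec_Assign; simp add: v)
      done
    then show "\<exists>t \<tau>. exec ?r \<sigma> t \<tau> \<and>
      t \<le> 2 * size (\<sigma> b) + 2 * (size (f (\<sigma> b)) + size (g (\<sigma> b))) + T (\<sigma> b) + U (\<sigma> b) + 10 \<and>
      \<tau> b = Node (f (\<sigma> b)) (g (\<sigma> b)) \<and> (\<forall>y<b. \<tau> y = \<sigma> y)"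
      using 1 2 by (intro exI[of _ ?t] exI[of _ ?\<sigma>3] conjI) simp_all
  qed
qed

lemma computes_on_if:
  assumes "computes_on X c S" "computes_on X f T" "computes_on X g U"
  shows "computes_on X (\<lambda>x. if c x = Tip then f x else g x)
    (\<lambda>x. size x + size (c x) + S x + T x + U x + 10)"
  unfolding computes_on_def
proof
  fix b
  obtain p where p: "\<And>\<sigma>. \<sigma> (b+1) \<in> X \<Longrightarrow>
    \<exists>t \<tau>. exec p \<sigma> t \<tau> \<and> t \<le> S (\<sigma> (b+1)) \<and> \<tau> (b+1) = c (\<sigma> (b+1)) \<and> (\<forall>y<b+1. \<tau> y = \<sigma> y)"
    using computes_onE[OF assms(1)] by blast
  obtain q where q: "\<And>\<sigma>. \<sigma> b \<in> X \<Longrightarrow>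
    \<exists>t \<tau>. exec q \<sigma> t \<tau> \<and> t \<le> T (\<sigma> b) \<and> \<tau> b = f (\<sigma> b) \<and> (\<forall>y<b. \<tau> y = \<sigma> y)"
    using computes_onE[OF assms(2)] by blast
  obtain r where r: "\<And>\<sigma>. \<sigma> b \<in> X \<Longrightarrow>
    \<exists>t \<tau>. exec r \<sigma> t \<tau> \<and> t \<le> U (\<sigma> b) \<and> \<tau> b = g (\<sigma> b) \<and> (\<forall>y<b. \<tau> y = \<sigma> y)"
    using computes_onE[OF assms(3)] by blast
  let ?s = "Seq (Assign (b+1) (Var b)) (Seq p (If (Var (b+1)) r q))"
  show "\<exists>s. \<forall>\<sigma>. \<sigma> b \<in> X \<longrightarrow> (\<exists>t \<tau>. exec s \<sigma> t \<tau> \<and>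
      t \<le> size (\<sigma> b) + size (c (\<sigma> b)) + S (\<sigma> b) + T (\<sigma> b) + U (\<sigma> b) + 10 \<and>
      \<tau> b = (if c (\<sigma> b) = Tip then f (\<sigma> b) else g (\<sigma> b)) \<and> (\<forall>y<b. \<tau> y = \<sigma> y))"
  proof (intro exI[of _ ?s] allI impI)
    fix \<sigma> assume "\<sigma> b \<in> X"
    let ?x = "\<sigma> b"
    let ?\<sigma>1 = "\<sigma>(b+1 := ?x)"
    obtain t1 \<tau>1 where 1: "exec p ?\<sigma>1 t1 \<tau>1" "t1 \<le> S ?x" "\<tau>1 (b+1) = c ?x" "\<forall>y<b+1. \<tau>1 y = ?\<sigma>1 y"
      using p[of ?\<sigma>1] \<open>\<sigma> b \<in> X\<close> by auto
    then have x: "\<tau>1 b = ?x" by simp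
    obtain t2 \<tau>2 where 2: "exec q \<tau>1 t2 \<tau>2" "t2 \<le> T ?x" "\<tau>2 b = f ?x" "\<forall>y<b. \<tau>2 y = \<tau>1 y"
      using q[of \<tau>1] \<open>\<sigma> b \<in> X\<close> x by auto
    obtain t3 \<tau>3 where 3: "exec r \<tau>1 t3 \<tau>3" "t3 \<le> U ?x" "\<tau>3 b = g ?x" "\<forall>y<b. \<tau>3 y = \<tau>1 y"
      using r[of \<tau>1] \<open>\<sigma> b \<in> X\<close> x by auto
    have A: "exec (Assign (b+1) (Var b)) \<sigma> (1 + size ?x) ?\<sigma>1" by (rule exec_Assign; simp)
    show "\<exists>t \<tau>. exec ?s \<sigma> t \<tau> \<and>
      t \<le> size (\<sigma> b) + size (c (\<sigma> b)) + S (\<sigma> b) + T (\<sigma> b) + U (\<sigma> b) + 10 \<and>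
      \<tau> b = (if c (\<sigma> b) = Tip then f (\<sigma> b) else g (\<sigma> b)) \<and> (\<forall>y<b. \<tau> y = \<sigma> y)"
    proof (cases "c ?x = Tip")
      case True
      have "exec ?s \<sigma> ((1 + size ?x) + (t1 + (cost (Var (b+1)) \<tau>1 + t2))) \<tau>2"
        using exec.Seq[OF A exec.Seq[OF 1(1) exec.IfFalse[OF _ 2(1), of "Var (b+1)" r]]] True 1 by simp
      then show ?thesis using True 1 2 by (auto simp del: fun_upd_apply intro!: exI) auto
    next
      case False
      have "exec ?s \<sigma> ((1 + size ?x) + (t1 + (cost (Var (b+1)) \<tau>1 + t3))) \<tau>3"
        using exec.Seq[OF A exec.Seq[OF 1(1) exec.IfTrue[OF _ 3(1), of "Var (b+1)" q]]] False 1 by simp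
      then show ?thesis using False 1 3 by (auto simp del: fun_upd_apply intro!: exI) auto
    qed
  qed
qed

text \<open>A tree is read as the list of left subtrees along its right spine. Folds of this kind
  are the only loops in the programs constructed below.\<close>

fun tfold :: "(tree \<Rightarrow> tree \<Rightarrow> tree) \<Rightarrow> tree \<Rightarrow> tree \<Rightarrow> tree" where
  "tfold g Tip acc = acc"
| "tfold g (Node a l) acc = tfold g l (g a acc)"

text \<open>Variable \<open>b\<close> holds the parameter, \<open>b+1\<close> the accumulator,
  \<open>b+2\<close> the rest of the list, and the body runs at \<open>b+3\<close> on the triple of
  parameter, entry and accumulator. The quantity \<open>size acc + size l * q\<close> is a budget:
  the accumulator may still grow by \<open>q\<close> for each remaining entry, and
  \<open>size l\<close> bounds their number. \<open>Inv\<close> restricts the growth condition to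
  accumulators that can occur.\<close>

lemma fold_loop:
  fixes G :: "tree \<Rightarrow> tree \<Rightarrow> tree \<Rightarrow> tree"
  assumes G: "\<And>\<sigma>. \<exists>t \<tau>. exec p \<sigma> t \<tau> \<and> t \<le> T (\<sigma> (b+3)) \<and>
      \<tau> (b+3) = G (left (\<sigma> (b+3))) (left (right (\<sigma> (b+3)))) (right (right (\<sigma> (b+3)))) \<and>
      (\<forall>y<b+3. \<tau> y = \<sigma> y)"
    and Inv: "\<And>a acc. Inv acc \<Longrightarrow> Inv (G x a acc)"
    and grow: "\<And>a acc. Inv acc \<Longrightarrow> size a \<le> A \<Longrightarrow> size (G x a acc) \<le> size acc + q"
    and T: "\<And>a acc. size a \<le> A \<Longrightarrow> size acc \<le> S \<Longrightarrow> T (Node x (Node a acc)) \<le> K"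
  shows "\<lbrakk>\<sigma> b = x; \<sigma> (b+2) = l; \<sigma> (b+1) = acc; Inv acc; size l \<le> A; size acc + size l * q \<le> S\<rbrakk>
    \<Longrightarrow> \<exists>t \<tau>. exec (While (Var (b+2))
        (Seq (Assign (b+3) (NodeE (Var b) (NodeE (LeftE (Var (b+2))) (Var (b+1)))))
        (Seq p (Seq (Assign (b+1) (Var (b+3))) (Assign (b+2) (RightE (Var (b+2)))))))) \<sigma> t \<tau> \<and>
      t \<le> (size l + 1) * (K + 2 * size x + 10 * A + 4 * S + 20) \<and>
      \<tau> (b+1) = tfold (G x) l acc \<and> (\<forall>y\<le>b. \<tau> y = \<sigma> y)"
proof (induction l arbitrary: \<sigma> acc)
  case Tip
  show ?case
    using exec.WhileFalse[of "Var (b+2)" \<sigma>] Tip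
    by (intro exI[of _ "cost (Var (b+2)) \<sigma>"] exI[of _ \<sigma>]) auto
next
  case (Node a l)
  let ?e = "NodeE (Var b) (NodeE (LeftE (Var (b+2))) (Var (b+1)))"
  let ?\<sigma>1 = "\<sigma>(b+3 := Node x (Node a acc))"
  have 1: "exec (Assign (b+3) ?e) \<sigma> (cost ?e \<sigma>) ?\<sigma>1" using Node.prems by (intro exec_Assign) simp_all
  obtain t2 \<sigma>2 where 2: "exec p ?\<sigma>1 t2 \<sigma>2" "t2 \<le> T (Node x (Node a acc))" "\<sigma>2 (b+3) = G x a acc"
    "\<forall>y<b+3. \<sigma>2 y = ?\<sigma>1 y"
    using G[of ?\<sigma>1] by auto
  have b2: "\<sigma>2 b = x" using 2(4) Node.prems(1) by simp
  have l2: "\<sigma>2 (b+2) = Node a l" using 2(4) Node.prems(2) by simp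
  note h2 = b2 l2
  have sz: "size acc + size (Node a l) * q \<le> S" using Node.prems(6) .
  have szA: "size (Node a l) \<le> A" using Node.prems(5) .
  note sz = sz szA
  have acc: "size (G x a acc) \<le> size acc + q" using grow[of acc a] Node.prems by simp
  have le: "q \<le> size (Node a l) * q" by simp
  have t2: "t2 \<le> K" using 2(2) T[of a acc] sz by simp
  let ?\<sigma>3 = "\<sigma>2(b+1 := G x a acc)"
  have 3: "exec (Assign (b+1) (Var (b+3))) \<sigma>2 (1 + size (G x a acc)) ?\<sigma>3" using 2 by (intro exec_Assign) auto
  let ?\<sigma>4 = "?\<sigma>3(b+2 := l)"
  have 4: "exec (Assign (b+2) (RightE (Var (b+2)))) ?\<sigma>3 (cost (RightE (Var (b+2))) ?\<sigma>3) ?\<sigma>4"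
    using h2 by (intro exec_Assign) auto
  have "size l * q + q \<le> size (Node a l) * q" by (simp add: algebra_simps)
  then have "size (G x a acc) + size l * q \<le> S" using acc sz(1) by linarith
  moreover have "Inv (G x a acc)" using Inv Node.prems by blast
  ultimately have "\<exists>t \<tau>. exec (While (Var (b+2))
        (Seq (Assign (b+3) ?e) (Seq p (Seq (Assign (b+1) (Var (b+3))) (Assign (b+2) (RightE (Var (b+2)))))))) ?\<sigma>4 t \<tau> \<and>
      t \<le> (size l + 1) * (K + 2 * size x + 10 * A + 4 * S + 20) \<and>
      \<tau> (b+1) = tfold (G x) l (G x a acc) \<and> (\<forall>y\<le>b. \<tau> y = ?\<sigma>4 y)"
    using h2 sz(2) by (intro Node.IH(2)) simp_all
  then obtain t5 \<tau> where 5: "exec (While (Var (b+2))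
        (Seq (Assign (b+3) ?e) (Seq p (Seq (Assign (b+1) (Var (b+3))) (Assign (b+2) (RightE (Var (b+2)))))))) ?\<sigma>4 t5 \<tau>"
      "t5 \<le> (size l + 1) * (K + 2 * size x + 10 * A + 4 * S + 20)"
      "\<tau> (b+1) = tfold (G x) l (G x a acc)" "\<forall>y\<le>b. \<tau> y = ?\<sigma>4 y" by blast
  have c: "cost (Var (b+2)) \<sigma> + (cost ?e \<sigma> + (t2 + ((1 + size (G x a acc)) + cost (RightE (Var (b+2))) ?\<sigma>3)))
     \<le> K + 2 * size x + 10 * A + 4 * S + 20"
    using Node.prems h2 t2 acc sz le by simp
  have nT: "val (Var (b+2)) \<sigma> \<noteq> Tip" using Node.prems(2) by simp
  \<comment> \<open>Dropping an entry lowers the size of the list by at least 1, which pays for one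
    pass of cost \<open>W\<close>.\<close>
  have "(size (Node a l) + 1) * W \<ge> W + (size l + 1) * W" for W by (simp add: algebra_simps)
  note c' = order_trans[OF add_mono[OF c 5(2)] this]
  have fr: "\<forall>y\<le>b. \<tau> y = \<sigma> y" using 5(4) 2(4) by simp
  show ?case
    unfolding tfold.simps
    by (intro exI conjI, rule exec.WhileTrue[OF nT exec.Seq[OF 1 exec.Seq[OF 2(1) exec.Seq[OF 3 4]]] 5(1)],
        rule c', rule 5(3), rule fr)
qed

section \<open>Polynomial time\<close>

text \<open>A single power replaces polynomials with coefficients: the base is at least 2 even for
  \<open>Tip\<close>, so constants and sums are absorbed by a larger exponent.\<close>

definition pbounded :: "(tree \<Rightarrow> nat) \<Rightarrow> bool" where
  "pbounded T \<longleftrightarrow> (\<exists>c. \<forall>x. T x \<le> (size x + 2) ^ c)"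

lemma pbounded_mono: "pbounded T \<Longrightarrow> (\<And>x. U x \<le> T x) \<Longrightarrow> pbounded U"
  unfolding pbounded_def by (meson le_trans)

lemma pbounded_const: "pbounded (\<lambda>_. n)"
proof -
  have "n \<le> (size x + 2) ^ n" for x :: tree
    using less_exp[of n] power_mono[of 2 "size x + 2" n] by linarith
  then show ?thesis unfolding pbounded_def by blast
qed

lemma pbounded_size: "pbounded size"
  unfolding pbounded_def by (intro exI[of _ 1]) simp

lemma pbounded_mult: "pbounded T \<Longrightarrow> pbounded U \<Longrightarrow> pbounded (\<lambda>x. T x * U x)"
  unfolding pbounded_def
proof (elim exE)
  fix c d assume "\<forall>x. T x \<le> (size x + 2) ^ c" "\<forall>x. U x \<le> (size x + 2) ^ d"
  then show "\<exists>c. \<forall>x. T x * U x \<le> (size x + 2) ^ c"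
    by (intro exI[of _ "c + d"]) (simp add: power_add mult_le_mono)
qed

text \<open>Since \<open>T + U \<le> (T + 1) * (U + 1)\<close>, sums reduce to products; the summand
  1 costs one more factor of the base, which is at least 2.\<close>

lemma pbounded_add: "pbounded T \<Longrightarrow> pbounded U \<Longrightarrow> pbounded (\<lambda>x. T x + U x)"
proof -
  assume "pbounded T" "pbounded U"
  then have "pbounded (\<lambda>x. (T x + 1) * (U x + 1))" if "pbounded (\<lambda>x. T x + 1)" "pbounded (\<lambda>x. U x + 1)"
    using that by (rule_tac pbounded_mult)
  moreover have Suc: "pbounded (\<lambda>x. W x + 1)" if "pbounded W" for W
  proof -
    from that obtain c where c: "W x \<le> (size x + 2) ^ c" for x unfolding pbounded_def by blast
    have "W x + 1 \<le> (size x + 2) ^ (Suc c)" for x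
    proof -
      have "1 \<le> (size x + 2) ^ c" by simp
      then have "W x + 1 \<le> 2 * (size x + 2) ^ c" using c[of x] by linarith
      also have "\<dots> \<le> (size x + 2) ^ (Suc c)" by simp
      finally show ?thesis .
    qed
    then show ?thesis unfolding pbounded_def by blast
  qed
  ultimately have "pbounded (\<lambda>x. (T x + 1) * (U x + 1))" using \<open>pbounded T\<close> \<open>pbounded U\<close> by blast
  then show ?thesis by (rule pbounded_mono) simp
qed

lemma pbounded_power: "pbounded T \<Longrightarrow> pbounded (\<lambda>x. T x ^ n)"
  by (induction n) (auto intro: pbounded_mult pbounded_const)

lemmas pbounded_intros = pbounded_add pbounded_mult pbounded_power pbounded_const pbounded_size

lemma pbounded_comp:
  assumes "pbounded T" "pbounded (\<lambda>x. size (f x))"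
  shows "pbounded (\<lambda>x. T (f x))"
proof -
  from assms obtain c where c: "T x \<le> (size x + 2) ^ c" for x unfolding pbounded_def by blast
  have "pbounded (\<lambda>x. (size (f x) + 2) ^ c)" by (intro pbounded_intros assms)
  then show ?thesis by (rule pbounded_mono) (rule c)
qed

lemma computes_on_UNIV_E:
  assumes "computes_on UNIV f T"
  obtains p where "\<And>\<sigma>. \<exists>t \<tau>. exec p \<sigma> t \<tau> \<and> t \<le> T (\<sigma> b) \<and> \<tau> b = f (\<sigma> b) \<and> (\<forall>y<b. \<tau> y = \<sigma> y)"
proof -
  obtain p where p: "\<And>\<sigma>. \<sigma> b \<in> UNIV \<Longrightarrow>
    \<exists>t \<tau>. exec p \<sigma> t \<tau> \<and> t \<le> T (\<sigma> b) \<and> \<tau> b = f (\<sigma> b) \<and> (\<forall>y<b. \<tau> y = \<sigma> y)"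
    using computes_onE[OF assms] by blast
  show thesis by (rule that[of p], rule p, rule UNIV_I)
qed

text \<open>The bound is required on all trees, malformed inputs included, so that the closure rules
  need no side conditions on the shape of intermediate results.\<close>

definition ptime :: "(tree \<Rightarrow> tree) \<Rightarrow> bool" where
  "ptime f \<longleftrightarrow> (\<exists>T. pbounded T \<and> computes_on UNIV f T)"

lemma ptimeI: "computes_on UNIV f T \<Longrightarrow> pbounded T \<Longrightarrow> ptime f"
  unfolding ptime_def by blast

lemma ptimeE:
  assumes "ptime f"
  obtains T where "computes_on UNIV f T" "pbounded T"
  using assms unfolding ptime_def by blast

lemma ptime_size: 
  assumes "ptime f" shows "pbounded (\<lambda>x. size (f x))"
proof -
  obtain T where T: "computes_on UNIV f T" "pbounded T" using assms by (rule ptimeE)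
  have "pbounded (\<lambda>x. size x + T x)" by (intro pbounded_intros T)
  then show ?thesis by (rule pbounded_mono) (use computes_on_size[OF T(1)] in auto)
qed

lemma ptime_expr:
  assumes "\<And>b \<sigma>. val (e b) \<sigma> = f (\<sigma> b)" "\<And>b \<sigma>. cost (e b) \<sigma> \<le> T (\<sigma> b)" "pbounded T"
  shows "ptime f"
proof (rule ptimeI[OF _ assms(3)], unfold computes_on_def, intro allI)
  fix b
  show "\<exists>p. \<forall>\<sigma>. \<sigma> b \<in> UNIV \<longrightarrow> (\<exists>t \<tau>. exec p \<sigma> t \<tau> \<and> t \<le> T (\<sigma> b) \<and> \<tau> b = f (\<sigma> b) \<and> (\<forall>y<b. \<tau> y = \<sigma> y))"
  proof (intro exI[of _ "Assign b (e b)"] allI impI)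
    fix \<sigma> :: store
    show "\<exists>t \<tau>. exec (Assign b (e b)) \<sigma> t \<tau> \<and> t \<le> T (\<sigma> b) \<and> \<tau> b = f (\<sigma> b) \<and> (\<forall>y<b. \<tau> y = \<sigma> y)"
      by (intro exI conjI, rule exec.Assign, rule assms) (simp_all add: assms)
  qed
qed

lemma ptime_id: "ptime (\<lambda>x. x)"
  by (rule ptime_expr[of Var _ "\<lambda>x. 1 + size x"]) (simp, simp, intro pbounded_intros)

lemma size_left_right: "size (left x) \<le> size x" "size (right x) \<le> size x"
  by (cases x; simp)+

lemma ptime_left_right: "ptime left" "ptime right"
proof -
  have "pbounded (\<lambda>x. 2 + 2 * size x)" by (intro pbounded_intros)
  then show "ptime left" "ptime right"
    by (auto intro!: ptime_expr[of "\<lambda>b. LeftE (Var b)" left "\<lambda>x. 2 + 2 * size x"] 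
       ptime_expr[of "\<lambda>b. RightE (Var b)" right "\<lambda>x. 2 + 2 * size x"]
       size_left_right[THEN order_trans] simp: mult_2)
qed

lemma ptime_comp: 
  assumes "ptime f" "ptime g" 
  shows "ptime (\<lambda>x. g (f x))"
proof -
  obtain T where T: "computes_on UNIV f T" "pbounded T" using assms by (auto elim: ptimeE)
  obtain U where U: "computes_on UNIV g U" "pbounded U" using assms by (auto elim: ptimeE)
  show ?thesis
    by (rule ptimeI[OF computes_on_comp[OF T(1) U(1)]])
      (auto intro!: pbounded_intros T pbounded_comp[OF U(2)] ptime_size assms)
qed

lemma ptime_left: "ptime f \<Longrightarrow> ptime (\<lambda>x. left (f x))"
  by (rule ptime_comp[OF _ ptime_left_right(1)])

lemma ptime_right: "ptime f \<Longrightarrow> ptime (\<lambda>x. right (f x))"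
  by (rule ptime_comp[OF _ ptime_left_right(2)])

lemma ptime_Node: 
  assumes "ptime f" "ptime g" 
  shows "ptime (\<lambda>x. Node (f x) (g x))"
proof -
  obtain T where T: "computes_on UNIV f T" "pbounded T" using assms by (auto elim: ptimeE)
  obtain U where U: "computes_on UNIV g U" "pbounded U" using assms by (auto elim: ptimeE)
  show ?thesis
    by (rule ptimeI[OF computes_on_pair[OF T(1) U(1)]])
      (intro pbounded_intros T U ptime_size assms)
qed

lemma ptime_if: 
  assumes "ptime c" "ptime f" "ptime g" 
  shows "ptime (\<lambda>x. if c x = Tip then f x else g x)"
proof -
  obtain S where S: "computes_on UNIV c S" "pbounded S" using assms by (auto elim: ptimeE)
  obtain T where T: "computes_on UNIV f T" "pbounded T" using assms by (auto elim: ptimeE)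
  obtain U where U: "computes_on UNIV g U" "pbounded U" using assms by (auto elim: ptimeE)
  show ?thesis
    by (rule ptimeI[OF computes_on_if[OF S(1) T(1) U(1)]])
      (intro pbounded_intros S T U ptime_size assms)
qed

lemma ptime_Tip: "ptime (\<lambda>x. Tip)"
  by (rule ptime_expr[of "\<lambda>_. TipE" _ "\<lambda>x. 1"]) (auto intro!: pbounded_intros)

lemma ptime_const: "ptime (\<lambda>x. c)"
  by (induction c) (auto intro: ptime_Tip ptime_Node)

lemma ptime_comp2:
  assumes "ptime (\<lambda>y. h (left y) (right y))" "ptime f" "ptime g"
  shows "ptime (\<lambda>x. h (f x) (g x))"
  using ptime_comp[OF ptime_Node[OF assms(2,3)] assms(1)] by simp

text \<open>The growth of the accumulator in one step may depend on the parameter and the entry, but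
  not on the accumulator: repeated doubling would be exponential. With additive growth, the total is
  at most the list size times the growth per step.\<close>

lemma ptime_fold_inv:
  assumes G: "ptime (\<lambda>y. G (left y) (left (right y)) (right (right y)))"
    and l: "ptime l" and i: "ptime i"
    and Inv: "\<And>x. Inv x (i x)" "\<And>x a acc. Inv x acc \<Longrightarrow> Inv x (G x a acc)"
    and grow: "\<And>x a acc. Inv x acc \<Longrightarrow> size (G x a acc) \<le> size acc + (size x + size a + 2) ^ d"
  shows "ptime (\<lambda>x. tfold (G x) (l x) (i x))"
proof -
  obtain TG where TG: "computes_on UNIV (\<lambda>y. G (left y) (left (right y)) (right (right y))) TG" "pbounded TG"
    using G by (rule ptimeE)
  then obtain c where c: "TG x \<le> (size x + 2) ^ c" for x unfolding pbounded_def by blast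
  obtain Tl where Tl: "computes_on UNIV l Tl" "pbounded Tl" using l by (rule ptimeE)
  obtain Ti where Ti: "computes_on UNIV i Ti" "pbounded Ti" using i by (rule ptimeE)
  define q where "q x = (size x + size (l x) + 2) ^ d" for x
  define S where "S x = size (i x) + size (l x) * q x" for x
  \<comment> \<open>The body receives \<open>Node x (Node a acc)\<close>, whose two inner nodes
    together with the 2 in the base of the time bound give the 4.\<close>
  define K where "K x = (size x + size (l x) + S x + 4) ^ c" for x
  let ?T = "\<lambda>x. 2 * size x + Ti x + Tl x + (size (l x) + 1) * (K x + 2 * size x + 10 * size (l x) + 4 * S x + 20) +
     (size (i x) + size (l x) * q x) + 10"
  have pb: "pbounded ?T"
    unfolding q_def S_def K_def
    by (intro pbounded_intros Tl Ti ptime_size assms)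
  have fold_size: "Inv x acc \<Longrightarrow> size ys \<le> size (l x) \<Longrightarrow> size (tfold (G x) ys acc) \<le> size acc + size ys * q x" for x ys acc
  proof (induction ys arbitrary: acc)
    case (Node a ys)
    have "size (tfold (G x) ys (G x a acc)) \<le> size (G x a acc) + size ys * q x" using Node Inv by simp
    moreover have "size (G x a acc) \<le> size acc + q x"
      using grow[OF Node.prems(1), of a] Node.prems(2)
      by (auto simp: q_def elim!: order_trans intro!: power_mono)
    moreover have "size ys * q x + q x \<le> size (Node a ys) * q x" by (simp add: algebra_simps)
    ultimately show ?case unfolding tfold.simps by linarith
  qed simp
  show ?thesis
  proof (rule ptimeI[OF _ pb], unfold computes_on_def, intro allI)
    fix b
    obtain p where p: "\<And>\<sigma>. \<exists>t \<tau>. exec p \<sigma> t \<tau> \<and> t \<le> TG (\<sigma> (b+3)) \<and>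
      \<tau> (b+3) = G (left (\<sigma> (b+3))) (left (right (\<sigma> (b+3)))) (right (right (\<sigma> (b+3)))) \<and> (\<forall>y<b+3. \<tau> y = \<sigma> y)"
      using computes_on_UNIV_E[OF TG(1), of "b+3" thesis] by blast
    obtain pi where pi: "\<And>\<sigma>. \<exists>t \<tau>. exec pi \<sigma> t \<tau> \<and> t \<le> Ti (\<sigma> (b+1)) \<and>
      \<tau> (b+1) = i (\<sigma> (b+1)) \<and> (\<forall>y<b+1. \<tau> y = \<sigma> y)"
      using computes_on_UNIV_E[OF Ti(1), of "b+1" thesis] by blast
    obtain pl where pl: "\<And>\<sigma>. \<exists>t \<tau>. exec pl \<sigma> t \<tau> \<and> t \<le> Tl (\<sigma> (b+2)) \<and>
      \<tau> (b+2) = l (\<sigma> (b+2)) \<and> (\<forall>y<b+2. \<tau> y = \<sigma> y)"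
      using computes_on_UNIV_E[OF Tl(1), of "b+2" thesis] by blast
    let ?w = "While (Var (b+2))
        (Seq (Assign (b+3) (NodeE (Var b) (NodeE (LeftE (Var (b+2))) (Var (b+1)))))
        (Seq p (Seq (Assign (b+1) (Var (b+3))) (Assign (b+2) (RightE (Var (b+2)))))))"
    let ?r = "Seq (Assign (b+1) (Var b)) (Seq pi (Seq (Assign (b+2) (Var b)) (Seq pl (Seq ?w (Assign b (Var (b+1)))))))"
    show "\<exists>r. \<forall>\<sigma>. \<sigma> b \<in> UNIV \<longrightarrow> (\<exists>t \<tau>. exec r \<sigma> t \<tau> \<and> t \<le> ?T (\<sigma> b) \<and>
      \<tau> b = tfold (G (\<sigma> b)) (l (\<sigma> b)) (i (\<sigma> b)) \<and> (\<forall>y<b. \<tau> y = \<sigma> y))"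
    proof (intro exI[of _ ?r] allI impI)
      fix \<sigma> :: store
      let ?x = "\<sigma> b"
      let ?\<sigma>1 = "\<sigma>(b+1 := ?x)"
      obtain t1 \<tau>1 where 1: "exec pi ?\<sigma>1 t1 \<tau>1" "t1 \<le> Ti ?x" "\<tau>1 (b+1) = i ?x" "\<forall>y<b+1. \<tau>1 y = ?\<sigma>1 y"
        using pi[of ?\<sigma>1] by auto
      let ?\<sigma>2 = "\<tau>1(b+2 := ?x)"
      obtain t2 \<tau>2 where 2: "exec pl ?\<sigma>2 t2 \<tau>2" "t2 \<le> Tl ?x" "\<tau>2 (b+2) = l ?x" "\<forall>y<b+2. \<tau>2 y = ?\<sigma>2 y"
        using pl[of ?\<sigma>2] by auto
      have "\<exists>t \<tau>. exec ?w \<tau>2 t \<tau> \<and>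
        t \<le> (size (l ?x) + 1) * (K ?x + 2 * size ?x + 10 * size (l ?x) + 4 * S ?x + 20) \<and>
        \<tau> (b+1) = tfold (G ?x) (l ?x) (i ?x) \<and> (\<forall>y\<le>b. \<tau> y = \<tau>2 y)"
      proof (rule fold_loop[OF p, where Inv = "Inv ?x" and q = "q ?x"])
        fix a acc :: tree assume "size a \<le> size (l ?x)" "size acc \<le> S ?x"
        then show "TG (Node ?x (Node a acc)) \<le> K ?x" unfolding K_def
          by (intro c[THEN order_trans] power_mono) auto
      next
        fix a acc :: tree assume "Inv ?x acc" "size a \<le> size (l ?x)"
        then show "size (G ?x a acc) \<le> size acc + q ?x"
          using grow[of ?x acc a] by (auto simp: q_def elim!: order_trans intro!: power_mono)
      qed (use 1 2 Inv in \<open>auto simp: S_def\<close>)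
      then obtain t3 \<tau>3 where 3: "exec ?w \<tau>2 t3 \<tau>3" 
        "t3 \<le> (size (l ?x) + 1) * (K ?x + 2 * size ?x + 10 * size (l ?x) + 4 * S ?x + 20)"
        "\<tau>3 (b+1) = tfold (G ?x) (l ?x) (i ?x)" "\<forall>y\<le>b. \<tau>3 y = \<tau>2 y" by blast
      let ?\<tau> = "\<tau>3(b := tfold (G ?x) (l ?x) (i ?x))"
      let ?t = "(1 + size ?x) + (t1 + ((1 + size ?x) + (t2 + (t3 + (1 + size (tfold (G ?x) (l ?x) (i ?x)))))))"
      have "exec ?r \<sigma> ?t ?\<tau>"
        apply (rule exec.Seq[of _ _ _ ?\<sigma>1])
         apply (rule exec_Assign; simp)
        apply (rule exec.Seq[OF 1(1)])
        apply (rule exec.Seq[of _ _ _ ?\<sigma>2])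
         apply (rule exec_Assign; simp add: 1)
        apply (rule exec.Seq[OF 2(1)])
        apply (rule exec.Seq[OF 3(1)])
        using 3(3) apply (intro exec_Assign; simp)
        done
      moreover have "size (tfold (G ?x) (l ?x) (i ?x)) \<le> size (i ?x) + size (l ?x) * q ?x"
        using fold_size Inv by simp
      ultimately show "\<exists>t \<tau>. exec ?r \<sigma> t \<tau> \<and> t \<le> ?T (\<sigma> b) \<and>
        \<tau> b = tfold (G (\<sigma> b)) (l (\<sigma> b)) (i (\<sigma> b)) \<and> (\<forall>y<b. \<tau> y = \<sigma> y)"
        using 1 2 3 by (intro exI[of _ ?t] exI[of _ ?\<tau>] conjI) simp_all
    qed
  qed
qed

lemma ptime_fold:
  assumes "ptime (\<lambda>y. G (left y) (left (right y)) (right (right y)))" "ptime l" "ptime i"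
    and "\<And>x a acc. size (G x a acc) \<le> size acc + (size x + size a + 2) ^ d"
  shows "ptime (\<lambda>x. tfold (G x) (l x) (i x))"
  by (rule ptime_fold_inv[where Inv = "\<lambda>_ _. True"]) (use assms in auto)

section \<open>Polynomial-time list functions\<close>

abbreviation one :: tree where "one \<equiv> Node Tip Tip"

lemma enc_list_map: "enc_list e (map f xs) = enc_list (\<lambda>x. e (f x)) xs"
  by (induction xs) auto

definition trev :: "tree \<Rightarrow> tree" where "trev l = tfold Node l Tip"

lemma tfold_Node_enc_list: "tfold Node (enc_list e xs) (enc_list e ys) = enc_list e (rev xs @ ys)"
proof (induction xs arbitrary: ys)
  case (Cons x xs)
  show ?case using Cons[of "x # ys"] by simp
qed simp

lemma trev_enc_list: "trev (enc_list e xs) = enc_list e (rev xs)"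
  using tfold_Node_enc_list[of e xs "[]"] by (simp add: trev_def)

lemma size_tfold_Node: "size (tfold Node l m) = size l + size m"
  by (induction l arbitrary: m) auto

lemma tfold_tfold_Node: "tfold g (tfold Node l m) acc = tfold g m (tfold g (trev l) acc)"
proof (induction l arbitrary: m)
  case (Node a l)
  show ?case by (simp add: Node.IH(2)[of "Node a m"] trev_def Node.IH(2)[of "Node a Tip", unfolded trev_def])
qed (simp add: trev_def)

text \<open>The loop consumes lists from the front, so a right fold, which keeps the order of
  entries when it builds a list, is a left fold over the reversal.\<close>

definition tfoldr :: "(tree \<Rightarrow> tree \<Rightarrow> tree) \<Rightarrow> tree \<Rightarrow> tree \<Rightarrow> tree" where
  "tfoldr g l acc = tfold g (trev l) acc"

lemma tfoldr_simps [simp]: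
  "tfoldr g Tip acc = acc"
  "tfoldr g (Node a l) acc = g a (tfoldr g l acc)"
proof -
  have "trev (Node a l) = tfold Node l (Node a Tip)" by (simp add: trev_def)
  then show "tfoldr g (Node a l) acc = g a (tfoldr g l acc)" by (simp add: tfoldr_def tfold_tfold_Node)
qed (simp add: tfoldr_def trev_def)

lemma ptime_trev:
  assumes "ptime f" shows "ptime (\<lambda>x. trev (f x))"
proof -
  have "ptime (\<lambda>x. tfold Node x Tip)"
    by (rule ptime_fold[where G = "\<lambda>_. Node" and d = 1])
      (auto intro!: ptime_Node ptime_left ptime_right ptime_id ptime_const)
  from ptime_comp[OF assms this] show ?thesis by (simp add: trev_def)
qed

lemma ptime_foldr:
  assumes "ptime (\<lambda>y. G (left y) (left (right y)) (right (right y)))" "ptime l" "ptime i"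
    and "\<And>x a acc. size (G x a acc) \<le> size acc + (size x + size a + 2) ^ d"
  shows "ptime (\<lambda>x. tfoldr (G x) (l x) (i x))"
  unfolding tfoldr_def by (rule ptime_fold assms ptime_trev)+

definition tapp :: "tree \<Rightarrow> tree \<Rightarrow> tree" where "tapp l m = tfoldr Node l m"

lemma tapp_enc_list: "tapp (enc_list e xs) (enc_list e ys) = enc_list e (xs @ ys)"
  by (induction xs) (auto simp: tapp_def)

lemma size_tapp: "size (tapp l m) = size l + size m"
  by (induction l) (auto simp: tapp_def)

lemma ptime_tapp: "ptime f \<Longrightarrow> ptime g \<Longrightarrow> ptime (\<lambda>x. tapp (f x) (g x))"
  unfolding tapp_def
  by (rule ptime_foldr[where G = "\<lambda>_. Node" and d = 1])
    (auto intro!: ptime_Node ptime_left ptime_right ptime_id)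

definition tmap :: "(tree \<Rightarrow> tree) \<Rightarrow> tree \<Rightarrow> tree" where
  "tmap g l = tfoldr (\<lambda>a. Node (g a)) l Tip"

lemma tmap_enc_list:
  "(\<And>x. x \<in> set xs \<Longrightarrow> g (d x) = e (h x)) \<Longrightarrow> tmap g (enc_list d xs) = enc_list e (map h xs)"
  by (induction xs) (auto simp: tmap_def)

lemma ptime_tmap:
  assumes "ptime (\<lambda>y. G (left y) (right y))" "ptime l"
  shows "ptime (\<lambda>x. tmap (G x) (l x))"
proof -
  obtain c where c: "size (G (left y) (right y)) \<le> (size y + 2) ^ c" for y
    using ptime_size[OF assms(1)] unfolding pbounded_def by blast
  have "ptime (\<lambda>y. G (left y) (left (right y)))"
    using ptime_comp[OF ptime_Node[OF ptime_left[OF ptime_id] ptime_left[OF ptime_right[OF ptime_id]]] assms(1)]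
    by simp
  \<comment> \<open>With \<open>n = size x + size a + 2\<close> the new entry has size at most
    \<open>(n + 1) ^ c\<close>, and \<open>n + 1 \<le> n ^ 2\<close> gives the exponent
    \<open>2 * c\<close>; the last factor pays for the list constructor.\<close>
  moreover have "size (Node (G x a) acc) \<le> size acc + (size x + size a + 2) ^ (2 * c + 1)" for x a acc
  proof -
    let ?n = "size x + size a + 2"
    have "?n + 1 \<le> ?n ^ 2" by (simp add: power2_eq_square)
    then have "(?n + 1) ^ c \<le> (?n ^ 2) ^ c" by (rule power_mono) simp
    then have "(?n + 1) ^ c \<le> ?n ^ (2 * c)" unfolding power_mult .
    moreover have "size (G x a) \<le> (?n + 1) ^ c" using c[of "Node x a"] by (simp add: algebra_simps)
    moreover have "?n ^ (2 * c) + 1 \<le> ?n ^ (2 * c + 1)"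
    proof -
      have "1 \<le> ?n ^ (2 * c)" by simp
      then have "?n ^ (2 * c) + 1 \<le> 2 * ?n ^ (2 * c)" by linarith
      also have "\<dots> \<le> ?n ^ (2 * c + 1)" by simp
      finally show ?thesis .
    qed
    ultimately show ?thesis by simp
  qed
  ultimately show ?thesis unfolding tmap_def
    by (intro ptime_foldr[where G = "\<lambda>x a. Node (G x a)" and d = "2 * c + 1"] assms ptime_const
        ptime_Node ptime_right ptime_id)
qed

definition tconcat :: "tree \<Rightarrow> tree" where "tconcat l = tfoldr tapp l Tip"

lemma tconcat_enc_list: "tconcat (enc_list (enc_list e) xss) = enc_list e (concat xss)"
proof -
  have "tfoldr tapp (enc_list (enc_list e) xss) Tip = enc_list e (concat xss)"
    by (induction xss) (auto simp: tapp_enc_list)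
  then show ?thesis by (simp add: tconcat_def)
qed

lemma ptime_tconcat: "ptime f \<Longrightarrow> ptime (\<lambda>x. tconcat (f x))"
  unfolding tconcat_def
  by (rule ptime_foldr[where G = "\<lambda>_. tapp" and d = 1])
    (auto intro!: ptime_tapp ptime_left ptime_right ptime_id ptime_const simp: size_tapp)

section \<open>Binary numbers\<close>

definition inc_step :: "tree \<Rightarrow> tree \<Rightarrow> tree" where
  "inc_step b s = (if left s = Tip then Node Tip (Node b (right s))
     else if b = Tip then Node Tip (Node one (right s)) else Node one (Node Tip (right s)))"

lemma inc_step_Node:
  "inc_step b (Node c r) = (if c = Tip then Node Tip (Node b r)
     else if b = Tip then Node Tip (Node one r) else Node one (Node Tip r))"
  by (simp add: inc_step_def)

text \<open>Ripple-carry increment: the state consists of the carry and the digits written so far,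
  latest first. At the end a remaining carry becomes the most significant digit, and the digits are
  reversed onto it.\<close>

definition inc_final :: "tree \<Rightarrow> tree" where
  "inc_final s = tfold Node (right s) (if left s = Tip then Tip else Node one Tip)"

definition tinc :: "tree \<Rightarrow> tree" where
  "tinc n = inc_final (tfold inc_step n (Node one Tip))"

lemma inc_final_fold:
  "inc_final (tfold inc_step (enc_nat n) (Node c r)) =
   tfold Node r (enc_nat (if c = Tip then n else Suc n))"
proof (induction n arbitrary: c r rule: less_induct)
  case (less n)
  note enc = enc_nat.simps[of n] enc_nat.simps[of "Suc n"]
  show ?case
  proof (cases "n = 0")
    case True
    then show ?thesis using enc by (simp add: inc_final_def enc_nat.simps[of 0])
  next
    case False
    then have IH: "inc_final (tfold inc_step (enc_nat (n div 2)) (Node c r)) =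
      tfold Node r (enc_nat (if c = Tip then n div 2 else Suc (n div 2)))" for c r
      using less by simp
    show ?thesis
      using False enc by (cases "c = Tip"; cases "odd n") (simp_all add: inc_step_Node IH)
  qed
qed

lemma tinc_enc_nat: "tinc (enc_nat n) = enc_nat (Suc n)"
  by (simp add: tinc_def inc_final_fold)

lemma size_inc_fold:
  "c \<in> {Tip, one} \<Longrightarrow>
   \<exists>c' r'. tfold inc_step n (Node c r) = Node c' r' \<and> c' \<in> {Tip, one} \<and> size c' + size r' \<le> size c + size r + size n"
proof (induction n arbitrary: c r)
  case (Node b n)
  obtain c' r' where step: "inc_step b (Node c r) = Node c' r'" "c' \<in> {Tip, one}"
    "size c' + size r' \<le> size c + size r + size b + 1"
    using Node.prems by (cases b) (auto simp: inc_step_Node)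
  then show ?case using Node.IH(2)[OF step(2), of r'] by auto
qed auto

text \<open>Constant additive growth makes counting by repeated increments an admissible
  fold.\<close>

lemma size_tinc: "size (tinc n) \<le> size n + 2"
  using size_inc_fold[of one n Tip]
  by (auto simp: tinc_def inc_final_def size_tfold_Node)

lemmas ptime_basic = ptime_Node ptime_left ptime_right ptime_id ptime_const ptime_if

lemma ptime_fold_Node: "ptime f \<Longrightarrow> ptime g \<Longrightarrow> ptime (\<lambda>x. tfold Node (f x) (g x))"
  by (rule ptime_fold[where G = "\<lambda>_. Node" and d = 1]) (auto intro!: ptime_basic)

lemma ptime_tinc:
  assumes "ptime f" shows "ptime (\<lambda>x. tinc (f x))"
proof -
  have s: "ptime (\<lambda>x. tfold inc_step x (Node one Tip))"
  proof (rule ptime_fold[where G = "\<lambda>_. inc_step" and d = 2])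
    show "size (inc_step a acc) \<le> size acc + (size x + size a + 2)\<^sup>2" for x a acc
    proof -
      have "size (inc_step a acc) \<le> size acc + size a + 4" by (cases acc) (auto simp: inc_step_def)
      moreover have "size a + 4 \<le> (size x + size a + 2)\<^sup>2" by (simp add: power2_eq_square)
      ultimately show ?thesis by linarith
    qed
  qed (intro ptime_basic | unfold inc_step_def)+
  have "ptime inc_final" unfolding inc_final_def[abs_def]
    by (intro ptime_fold_Node ptime_basic)
  from ptime_comp[OF ptime_comp[OF assms s] this] show ?thesis by (simp add: tinc_def)
qed

definition tlen :: "tree \<Rightarrow> tree" where "tlen l = tfold (\<lambda>_. tinc) l Tip"

lemma tlen_enc_list: "tlen (enc_list e xs) = enc_nat (length xs)"
proof -
  have "tfold (\<lambda>_. tinc) (enc_list e xs) (enc_nat n) = enc_nat (n + length xs)" for n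
    by (induction xs arbitrary: n) (auto simp: tinc_enc_nat)
  from this[of 0] show ?thesis by (simp add: tlen_def enc_nat.simps[of 0])
qed

lemma ptime_tlen: "ptime f \<Longrightarrow> ptime (\<lambda>x. tlen (f x))"
  unfolding tlen_def
  by (rule ptime_fold[where G = "\<lambda>_ _. tinc" and d = 2])
    (auto intro!: ptime_basic ptime_tinc order_trans[OF size_tinc] simp: power2_eq_square)

text \<open>On digits, \<open>pair\<close> puts a marker 1 before each bit of \<open>a\<close>, ends
  with the marker 0 and the guard 1, and continues with \<open>b\<close>. Pairing is thus a
  rewriting of digit lists that needs no arithmetic.\<close>

definition tpair :: "tree \<Rightarrow> tree \<Rightarrow> tree" where
  "tpair a b = tfoldr (\<lambda>c acc. Node one (Node c acc)) a (Node Tip (Node one b))"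

lemma enc_nat_double: "0 < n \<Longrightarrow> enc_nat (2 * n) = Node Tip (enc_nat n)"
  by (subst enc_nat.simps) simp

lemma enc_nat_Suc_double: "enc_nat (2 * n + 1) = Node one (enc_nat n)"
  by (subst enc_nat.simps) simp

lemma tpair_enc_nat: "tpair (enc_nat a) (enc_nat b) = enc_nat (pair a b)"
proof (induction a rule: less_induct)
  case (less a)
  show ?case
  proof (cases "a = 0")
    case True
    have "pair 0 b = 2 * (2 * b + 1)" by (simp add: pair_0)
    then have "enc_nat (pair 0 b) = Node Tip (Node one (enc_nat b))"
      by (simp only: enc_nat_double enc_nat_Suc_double zero_less_Suc Suc_eq_plus1[symmetric])
        (simp only: Suc_eq_plus1 enc_nat_Suc_double)
    then show ?thesis using True by (simp add: enc_nat.simps[of 0] tpair_def)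
  next
    case False
    let ?p = "pair (a div 2) b"
    have IH: "enc_nat ?p = tpair (enc_nat (a div 2)) (enc_nat b)" using less False by simp
    have "enc_nat (pair a b) = enc_nat (2 * (2 * ?p + a mod 2) + 1)"
      unfolding pair_rec[OF False] by simp
    also have "\<dots> = Node one (enc_nat (2 * ?p + a mod 2))" by (rule enc_nat_Suc_double)
    also have "enc_nat (2 * ?p + a mod 2) = Node (if odd a then one else Tip) (enc_nat ?p)"
      using enc_nat_double[OF pair_pos] enc_nat_Suc_double[of ?p] by (cases "odd a") (simp_all add: odd_iff_mod_2_eq_one)
    finally show ?thesis using False enc_nat.simps[of a] by (simp add: IH tpair_def)
  qed
qed

lemma ptime_tpair: "ptime f \<Longrightarrow> ptime g \<Longrightarrow> ptime (\<lambda>x. tpair (f x) (g x))"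
  unfolding tpair_def
  by (rule ptime_foldr[where G = "\<lambda>_ c acc. Node one (Node c acc)" and d = 2])
    (auto intro!: ptime_basic simp: power2_eq_square)

section \<open>Prefixes whose length is given in binary\<close>

definition take_step :: "tree \<Rightarrow> tree \<Rightarrow> tree" where
  "take_step a s = (if left s = Tip then s else Node (right (left s)) (Node (left (left s)) (right s)))"

text \<open>The list \<open>u\<close> serves only as a unary counter. The state holds the rest of
  \<open>l\<close> and the prefix already taken, which comes out reversed.\<close>

definition trev_take :: "tree \<Rightarrow> tree \<Rightarrow> tree" where
  "trev_take u l = right (tfold take_step u (Node l Tip))"

lemma trev_take_enc_list:
  "trev_take (enc_list d us) (enc_list e xs) = enc_list e (rev (take (length us) xs))"
proof -
  have "tfold take_step (enc_list d us) (Node (enc_list e xs) (enc_list e ys)) =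
    Node (enc_list e (drop (length us) xs)) (enc_list e (rev (take (length us) xs) @ ys))" for ys
  proof (induction us arbitrary: xs ys)
    case (Cons u us)
    show ?case
    proof (cases xs)
      case Nil
      then show ?thesis using Cons[of "[]" ys] by (simp add: take_step_def)
    next
      case (Cons x xs')
      then show ?thesis using Cons.IH[of xs' "x # ys"] by (simp add: take_step_def)
    qed
  qed simp
  from this[of "[]"] show ?thesis by (simp add: trev_take_def)
qed

lemma size_take_step: "size (take_step a s) \<le> size s"
  by (cases s; cases "left s") (auto simp: take_step_def)

lemma size_trev_take: "size (trev_take u l) \<le> size l + 1"
proof -
  have "size (tfold take_step u s) \<le> size s" for s
  proof (induction u arbitrary: s)
    case (Node a u)
    show ?case using order_trans[OF Node.IH(2) size_take_step] by simp
  qed simp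
  from this[of "Node l Tip"] show ?thesis
    using size_left_right(2)[of "tfold take_step u (Node l Tip)"] by (simp add: trev_take_def)
qed

lemma ptime_trev_take:
  assumes "ptime f" "ptime g" shows "ptime (\<lambda>x. trev_take (f x) (g x))"
  unfolding trev_take_def
proof (intro ptime_right, rule ptime_fold[where G = "\<lambda>_. take_step" and d = 0])
  show "ptime (\<lambda>y. take_step (left (right y)) (right (right y)))"
    unfolding take_step_def by (intro ptime_basic)
  show "size (take_step a acc) \<le> size acc + (size x + size a + 2) ^ 0" for x a acc
    using size_take_step[of a acc] by simp
qed (intro ptime_basic assms)+

text \<open>The number of elements to take is given in binary.  It is turned into a list of that
  length by Horner's rule; cutting this list to the length of \<open>l\<close> in each step keeps the
  computation polynomial.  The encoding of a bit is itself a list whose length is that bit.\<close>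

definition ttake :: "tree \<Rightarrow> tree \<Rightarrow> tree" where
  "ttake n l = tfoldr (\<lambda>c u. trev_take (tapp u (tapp u c)) l) n Tip"

lemma ttake_enc: "ttake (enc_nat k) (enc_list e xs) = enc_list e (rev (take k xs))"
proof (induction k rule: less_induct)
  case (less k)
  show ?case
  proof (cases "k = 0")
    case True
    then show ?thesis by (simp add: ttake_def enc_nat.simps[of 0])
  next
    case False
    let ?ys = "map e (rev (take (k div 2) xs))"
    let ?c = "if odd k then [Tip] else []"
    have "enc_nat k = Node (enc_list id ?c) (enc_nat (k div 2))"
      using False by (subst enc_nat.simps) simp
    then have "ttake (enc_nat k) (enc_list e xs) =
      trev_take (tapp (enc_list id ?ys) (tapp (enc_list id ?ys) (enc_list id ?c))) (enc_list e xs)"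
      using less[of "k div 2"] False by (simp add: ttake_def enc_list_map)
    also have "\<dots> = enc_list e (rev (take (length (?ys @ ?ys @ ?c)) xs))"
      unfolding tapp_enc_list trev_take_enc_list ..
    \<comment> \<open>If \<open>k div 2\<close> is at most the length of \<open>xs\<close>, nothing
      has been cut and the counter has length \<open>k\<close>. Otherwise the counter is cut to the
      length of \<open>xs\<close>, and doubling it still takes the whole list.\<close>
    also have "take (length (?ys @ ?ys @ ?c)) xs = take k xs"
      by (cases "k div 2 \<le> length xs") (auto simp: min_def odd_two_times_div_two_succ mult_2[symmetric])
    finally show ?thesis .
  qed
qed

lemma ptime_ttake:
  assumes "ptime f" "ptime g" shows "ptime (\<lambda>x. ttake (f x) (g x))"
proof (rule ptime_comp2[OF _ assms])
  show "ptime (\<lambda>x. ttake (left x) (right x))"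
    unfolding ttake_def
  proof (rule ptime_foldr[where G = "\<lambda>x c u. trev_take (tapp u (tapp u c)) (right x)" and d = 1])
    show "size (trev_take (tapp u (tapp u c)) (right x)) \<le> size u + (size x + size c + 2) ^ 1" for x c u
      using size_trev_take[of "tapp u (tapp u c)" "right x"] size_left_right(2)[of x] by simp
  qed (intro ptime_basic ptime_trev_take ptime_tapp)+
qed

definition suffixes_step :: "tree \<Rightarrow> tree \<Rightarrow> tree" where
  "suffixes_step a s = Node (right (left s)) (Node (left s) (right s))"

definition tsuffixes :: "tree \<Rightarrow> tree" where
  "tsuffixes l = trev (right (tfold suffixes_step l (Node l Tip)))"

lemma tsuffixes_enc_list: "tsuffixes (enc_list e xs) = enc_list (enc_list e) (suffixes xs)"
proof -
  have "tfold suffixes_step (enc_list e xs) (Node (enc_list e xs) (enc_list (enc_list e) ys)) =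
    Node Tip (enc_list (enc_list e) (rev (suffixes xs) @ ys))" for ys
  proof (induction xs arbitrary: ys)
    case (Cons x xs)
    show ?case using Cons[of "(x # xs) # ys"] by (simp add: suffixes_step_def)
  qed simp
  from this[of "[]"] show ?thesis by (simp add: tsuffixes_def trev_enc_list)
qed

text \<open>Each step copies the current suffix into the output. This growth is bounded by the size
  of the input only if the accumulator really holds a list no larger than the input, hence the
  invariant.\<close>

lemma ptime_tsuffixes:
  assumes "ptime f" shows "ptime (\<lambda>x. tsuffixes (f x))"
proof -
  have "ptime tsuffixes" unfolding tsuffixes_def[abs_def]
  proof (intro ptime_trev ptime_right, rule ptime_fold_inv[where G = "\<lambda>_. suffixes_step" and d = 1 and
        Inv = "\<lambda>x acc. size (left acc) \<le> size x"])
    fix x a acc :: tree assume "size (left acc) \<le> size x"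
    moreover note size_left_right(2)[of "left acc"]
    ultimately show "size (left (suffixes_step a acc)) \<le> size x"
      "size (suffixes_step a acc) \<le> size acc + (size x + size a + 2) ^ 1"
      by (cases acc; simp add: suffixes_step_def)+
  qed (simp_all add: suffixes_step_def ptime_basic)
  from ptime_comp[OF assms this] show ?thesis .
qed

lemmas ptime_intros = ptime_basic ptime_trev ptime_tapp ptime_tmap ptime_tconcat ptime_tlen
  ptime_tpair ptime_ttake ptime_tsuffixes

section \<open>Treewidth\<close>

definition is_leaf :: "'a set set \<Rightarrow> 'a \<Rightarrow> 'a \<Rightarrow> bool" where
  "is_leaf F l p \<longleftrightarrow> l \<noteq> p \<and> (\<forall>x. {l, x} \<in> F \<longleftrightarrow> x = p)"

lemma edge_vertices:
  assumes "simple_graph V E" "{u, v} \<in> E"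
  shows "u \<in> V" "v \<in> V" "u \<noteq> v"
proof -
  obtain a b where "a \<in> V" "b \<in> V" "a \<noteq> b" "{u, v} = {a, b}"
    using assms unfolding simple_graph_def by blast
  then show "u \<in> V" "v \<in> V" "u \<noteq> v" by (auto simp: doubleton_eq_iff)
qed

text \<open>The end of a longest path is a leaf: another neighbour would either extend the path or,
  lying on it, close a cycle.\<close>

lemma tree_graph_leaf:
  assumes tree: "tree_graph I F" and ab: "a \<in> I" "b \<in> I" "a \<noteq> b"
  obtains l p where "l \<in> I" "p \<in> I" "is_leaf F l p"
proof -
  have simple: "simple_graph I F" and fin: "finite I" and conn: "connected_in F I"
    and acyc: "\<And>xs. \<not> is_cycle F xs"
    using tree by (auto simp: tree_graph_def simple_graph_def)
  define path where "path xs \<longleftrightarrow> 2 \<le> length xs \<and> distinct xs \<and> set xs \<subseteq> I \<and>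
    (\<forall>i. Suc i < length xs \<longrightarrow> {xs ! i, xs ! Suc i} \<in> F)" for xs
  have "(a, b) \<in> {(x, y). x \<in> I \<and> y \<in> I \<and> {x, y} \<in> F}\<^sup>*"
    using conn ab unfolding connected_in_def by blast
  then obtain c where "{a, c} \<in> F" using ab(3) by (auto elim: converse_rtranclE)
  then have "path [a, c]"
    using edge_vertices[OF simple] by (auto simp: path_def)
  moreover have "\<And>xs. path xs \<Longrightarrow> length xs \<le> card I"
    using fin by (auto simp: path_def) (metis card_mono distinct_card)
  ultimately obtain xs where xs: "path xs" and max: "\<And>ys. path ys \<Longrightarrow> length ys \<le> length xs"
    using ex_has_greatest_nat[of path "[a, c]" length "Suc (card I)"] by (auto simp: less_Suc_eq_le)
  from xs obtain l p zs where lp: "xs = l # p # zs"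
    by (cases xs; cases "tl xs") (auto simp: path_def)
  have "{l, p} \<in> F" using xs lp by (auto simp: path_def)
  moreover have "x = p" if x: "{l, x} \<in> F" for x
  proof (rule ccontr)
    assume "x \<noteq> p"
    have xI: "x \<in> I" "x \<noteq> l" using edge_vertices[OF simple x] by auto
    have "x \<in> set xs"
    proof (rule ccontr)
      assume "x \<notin> set xs"
      have "{(x # xs) ! i, (x # xs) ! Suc i} \<in> F" if "Suc i < length (x # xs)" for i
        using that xs x lp by (cases i) (auto simp: path_def insert_commute)
      then have "path (x # xs)" using xs xI \<open>x \<notin> set xs\<close> by (auto simp: path_def)
      then show False using max[of "x # xs"] by simp
    qed
    then obtain j where j: "j < length xs" "xs ! j = x" by (auto simp: in_set_conv_nth)
    have j2: "2 \<le> j"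
      using j lp xI \<open>x \<noteq> p\<close> by (cases j; cases "j - 1") auto
    \<comment> \<open>The neighbour \<open>x\<close> at position \<open>j\<close> closes the initial
      segment of the path; \<open>2 \<le> j\<close> provides the three vertices that a cycle must
      have.\<close>
    have "is_cycle F (take (Suc j) xs)"
      unfolding is_cycle_def
    proof (intro conjI allI impI)
      fix i assume i: "i < length (take (Suc j) xs)"
      have len: "length (take (Suc j) xs) = Suc j" using j by simp
      show "{take (Suc j) xs ! i, take (Suc j) xs ! (Suc i mod length (take (Suc j) xs))} \<in> F"
      proof (cases "i = j")
        case True
        have "take (Suc j) xs ! j = x" "take (Suc j) xs ! 0 = l" using j by simp (simp add: lp)
        then show ?thesis using True x len by (simp add: insert_commute)
      next
        case False
        then show ?thesis using i j xs len by (auto simp: path_def)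
      qed
    qed (use j2 j xs in \<open>auto simp: path_def\<close>)
    then show False using acyc by blast
  qed
  ultimately have "is_leaf F l p"
    using edge_vertices(3)[OF simple] unfolding is_leaf_def by blast
  then show thesis using that edge_vertices[OF simple \<open>{l, p} \<in> F\<close>] by blast
qed

text \<open>Sending \<open>l\<close> to its only neighbour \<open>p\<close> and fixing everything
  else turns a walk into one that avoids \<open>l\<close>; an arc at \<open>l\<close> collapses to a
  point.\<close>

lemma connected_in_remove_leaf:
  assumes "connected_in F A" "is_leaf F l p"
  shows "connected_in {e \<in> F. l \<notin> e} (A - {l})"
  unfolding connected_in_def
proof (intro ballI)
  fix u v assume u: "u \<in> A - {l}" and v: "v \<in> A - {l}"
  let ?R = "{(a, b). a \<in> A \<and> b \<in> A \<and> {a, b} \<in> F}"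
  let ?S = "{(a, b). a \<in> A - {l} \<and> b \<in> A - {l} \<and> {a, b} \<in> {e \<in> F. l \<notin> e}}"
  have leaf: "x = p" if "{l, x} \<in> F" for x using assms(2) that by (auto simp: is_leaf_def)
  have "l \<noteq> p" using assms(2) by (auto simp: is_leaf_def)
  have *: "(u, w) \<in> ?R\<^sup>* \<Longrightarrow> (u, if w = l then p else w) \<in> ?S\<^sup>*" for w
  proof (induction rule: rtrancl_induct)
    case base
    then show ?case using u by auto
  next
    case (step y z)
    show ?case
    proof (cases "y = l \<or> z = l")
      case True
      then have "(if y = l then p else y) = (if z = l then p else z)"
        using step(2) leaf by (auto simp: insert_commute)
      then show ?thesis using step(3) by simp
    next
      case False
      then have "(y, z) \<in> ?S" using step(2) by auto
      then show ?thesis using step(3) False by (simp add: rtrancl.rtrancl_into_rtrancl)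
    qed
  qed
  have "(u, v) \<in> ?R\<^sup>*" using assms(1) u v unfolding connected_in_def by blast
  from *[OF this] show "(u, v) \<in> ?S\<^sup>*" using v by simp
qed

lemma tree_graph_remove_leaf:
  assumes tree: "tree_graph I F" and leaf: "is_leaf F l p" and "p \<in> I"
  shows "tree_graph (I - {l}) {e \<in> F. l \<notin> e}"
proof -
  have "p \<in> I - {l}" using assms by (auto simp: is_leaf_def)
  moreover have "\<not> is_cycle {e \<in> F. l \<notin> e} xs" for xs
    using tree unfolding tree_graph_def is_cycle_def by blast
  moreover have "simple_graph (I - {l}) {e \<in> F. l \<notin> e}"
    using tree unfolding tree_graph_def simple_graph_def by fastforce
  moreover have "connected_in {e \<in> F. l \<notin> e} (I - {l})"
    using connected_in_remove_leaf[OF _ leaf] tree by (auto simp: tree_graph_def)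
  ultimately show ?thesis unfolding tree_graph_def by blast
qed

text \<open>The Helly property of subtrees, by removing leaves: if some \<open>v \<in> K\<close> in the bag of a leaf
  is missing in the bag next to it, then \<open>v\<close> lies in no other bag, so the leaf's bag contains \<open>K\<close>.\<close>

lemma clique_in_bag:
  assumes "tree_graph I F"
    and "\<And>u v. u \<in> K \<Longrightarrow> v \<in> K \<Longrightarrow> \<exists>i\<in>I. u \<in> bag i \<and> v \<in> bag i"
    and "\<And>v. v \<in> K \<Longrightarrow> connected_in F {i \<in> I. v \<in> bag i}"
  shows "\<exists>i\<in>I. K \<subseteq> bag i"
  using assms
proof (induction "card I" arbitrary: I F rule: less_induct)
  case less
  note tree = less.prems(1) and pairs = less.prems(2) and conn = less.prems(3)
  have "I \<noteq> {}" and fin: "finite I" using tree by (auto simp: tree_graph_def simple_graph_def)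
  then obtain a where a: "a \<in> I" by blast
  show ?case
  proof (cases "\<exists>b\<in>I. a \<noteq> b")
    case False
    have "u \<in> bag a" if "u \<in> K" for u
    proof -
      have "\<exists>i\<in>I. u \<in> bag i" using pairs[OF that that] by blast
      then obtain i where "i \<in> I" "u \<in> bag i" by blast
      moreover have "a = i" using False \<open>i \<in> I\<close> by blast
      ultimately show ?thesis by simp
    qed
    then show ?thesis using a by blast
  next
    case True
    then obtain l p where lp: "l \<in> I" "p \<in> I" "is_leaf F l p"
      using tree_graph_leaf[OF tree a] by blast
    then have neq: "l \<noteq> p" by (simp add: is_leaf_def)
    show ?thesis
    proof (cases "K \<inter> bag l \<subseteq> bag p")
      case True
      let ?I = "I - {l}" and ?F = "{e \<in> F. l \<notin> e}"
      have "\<exists>i\<in>?I. K \<subseteq> bag i"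
      proof (rule less.hyps)
        show "card ?I < card I" using fin lp by (meson card_Diff1_less)
        show "tree_graph ?I ?F" by (rule tree_graph_remove_leaf[OF tree lp(3,2)])
      next
        fix u v assume uv: "u \<in> K" "v \<in> K"
        then obtain i where i: "i \<in> I" "u \<in> bag i" "v \<in> bag i" using pairs by blast
        show "\<exists>i\<in>?I. u \<in> bag i \<and> v \<in> bag i"
        proof (cases "i = l")
          case True
          then show ?thesis using uv i \<open>K \<inter> bag l \<subseteq> bag p\<close> lp neq by blast
        qed (use i in blast)
      next
        fix v assume "v \<in> K"
        have "{i \<in> ?I. v \<in> bag i} = {i \<in> I. v \<in> bag i} - {l}" by blast
        then show "connected_in ?F {i \<in> ?I. v \<in> bag i}"
          using connected_in_remove_leaf[OF conn[OF \<open>v \<in> K\<close>] lp(3)] by simp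
      qed
      then show ?thesis by blast
    next
      case False
      then obtain v where v: "v \<in> K" "v \<in> bag l" "v \<notin> bag p" by blast
      let ?A = "{i \<in> I. v \<in> bag i}"
      have only: "w = l" if "w \<in> ?A" for w
      proof (rule ccontr)
        assume "w \<noteq> l"
        have "(l, w) \<in> {(a, b). a \<in> ?A \<and> b \<in> ?A \<and> {a, b} \<in> F}\<^sup>*"
          using conn[OF v(1)] that v lp unfolding connected_in_def by blast
        then obtain y where "y \<in> ?A" "{l, y} \<in> F"
          using \<open>w \<noteq> l\<close> by (auto elim: converse_rtranclE)
        then show False using lp(3) v by (auto simp: is_leaf_def)
      qed
      have "K \<subseteq> bag l"
      proof
        fix u assume "u \<in> K"
        then obtain i where "i \<in> I" "u \<in> bag i" "v \<in> bag i" using pairs v by blast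
        then show "u \<in> bag l" using only[of i] by simp
      qed
      then show ?thesis using lp by blast
    qed
  qed
qed

text \<open>The subtrees belonging to the vertices of a clique meet pairwise, because every edge
  lies in a bag; the Helly property then puts the whole clique into one bag.\<close>

lemma decomposition_width_ge:
  assumes dec: "tree_decomposition V E I F bag" and "finite V" "K \<subseteq> V"
    and "\<And>u v. u \<in> K \<Longrightarrow> v \<in> K \<Longrightarrow> u \<noteq> v \<Longrightarrow> {u, v} \<in> E"
  shows "card K - 1 \<le> decomposition_width I bag"
proof -
  have "\<exists>i\<in>I. K \<subseteq> bag i"
  proof (rule clique_in_bag)
    show "\<exists>i\<in>I. u \<in> bag i \<and> v \<in> bag i" if "u \<in> K" "v \<in> K" for u v
    proof (cases "u = v")
      case True
      then show ?thesis using that assms(3) dec unfolding tree_decomposition_def by blast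
    next
      case False
      then have "{u, v} \<in> E" using assms that by blast
      then have "\<exists>i\<in>I. {u, v} \<subseteq> bag i" using dec unfolding tree_decomposition_def by blast
      then show ?thesis by simp
    qed
  qed (use dec assms(3) in \<open>auto simp: tree_decomposition_def\<close>)
  then obtain i where i: "i \<in> I" "K \<subseteq> bag i" by blast
  have fin: "finite I" using dec by (auto simp: tree_decomposition_def tree_graph_def simple_graph_def)
  have "finite (bag i)" using dec i assms(2) by (auto simp: tree_decomposition_def intro: finite_subset)
  then have "card K \<le> card (bag i)" using i by (simp add: card_mono)
  also have "\<dots> \<le> Max ((\<lambda>i. card (bag i)) ` I)" using fin i by simp
  finally show ?thesis by (simp add: decomposition_width_def)
qed

lemma connected_in_star:
  assumes "A \<subseteq> {0} \<union> L" "0 \<in> A \<or> (\<exists>a. A = {a})"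
  shows "connected_in {{0::nat, y} | y. y \<in> L} A"
proof (cases "0 \<in> A")
  case True
  let ?R = "{(a, b). a \<in> A \<and> b \<in> A \<and> {a, b} \<in> {{0, y} | y. y \<in> L}}"
  have "(u, 0) \<in> ?R\<^sup>* \<and> (0, u) \<in> ?R\<^sup>*" if "u \<in> A" for u
  proof (cases "u = 0")
    case False
    then have "(u, 0) \<in> ?R \<and> (0, u) \<in> ?R" using that True assms(1) by (auto simp: doubleton_eq_iff)
    then show ?thesis by blast
  qed simp
  then show ?thesis unfolding connected_in_def by (blast intro: rtrancl_trans)
next
  case False
  then show ?thesis using assms(2) by (auto simp: connected_in_def)
qed

lemma tree_graph_star:
  assumes "finite L" "0 \<notin> L"
  shows "tree_graph ({0} \<union> L) {{0::nat, y} | y. y \<in> L}"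
  unfolding tree_graph_def
proof (intro conjI)
  show "simple_graph ({0} \<union> L) {{0, y} | y. y \<in> L}"
    using assms unfolding simple_graph_def by fastforce
  show "connected_in {{0, y} | y. y \<in> L} ({0} \<union> L)" by (rule connected_in_star) auto
  show "\<nexists>xs. is_cycle {{0, y} | y. y \<in> L} xs"
  proof
    assume "\<exists>xs. is_cycle {{0, y} | y. y \<in> L} xs"
    then obtain xs where cycle: "is_cycle {{0, y} | y. y \<in> L} xs" ..
    then have len: "3 \<le> length xs" and dist: "distinct xs"
      by (simp_all add: is_cycle_def)
    have edge: "0 \<in> {xs ! i, xs ! (Suc i mod length xs)}" if "i < length xs" for i
    proof -
      have "{xs ! i, xs ! (Suc i mod length xs)} \<in> {{0, y} | y. y \<in> L}"
        using cycle that unfolding is_cycle_def by blast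
      then obtain y where "{xs ! i, xs ! (Suc i mod length xs)} = {0, y}" by blast
      then show ?thesis by blast
    qed
    have zero: "i = j" if "xs ! i = 0" "xs ! j = 0" "i < length xs" "j < length xs" for i j
      using that dist by (metis nth_eq_iff_index_eq)
    \<comment> \<open>All edges contain the centre, but on a cycle it occupies one position and so
      lies on only two of at least three edges. With the centre at position 1, the edge leaving
      position 2 misses it, also when it wraps around in a triangle; otherwise the edges at 0 and 1
      put it at positions 0 and 2.\<close>
    show False
    proof (cases "xs ! 1 = 0")
      case True
      have "0 \<in> {xs ! 2, xs ! (3 mod length xs)}" using edge[of 2] len by simp
      moreover have "xs ! 2 \<noteq> 0" using zero[of 1 2] True len by auto
      moreover have "xs ! (3 mod length xs) \<noteq> 0"
        using zero[of 1 "3 mod length xs"] True len by (cases "length xs = 3") auto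
      ultimately show False by auto
    next
      case False
      have nonempty: "0 < length xs" using len by linarith
      then have "xs ! 0 = 0" using edge[of 0] len False by auto
      moreover have "xs ! 2 = 0" using edge[of 1] len False by (auto simp: numeral_2_eq_2)
      ultimately show False using zero[of 0 2] len nonempty by auto
    qed
  qed
qed auto

text \<open>The decomposition is a star: the centre carries \<open>H\<close>, a leaf for each
  \<open>x\<close> in \<open>X\<close> carries \<open>insert x H\<close>, and a further leaf carries
  \<open>G\<close>. All leaf bags have \<open>card H + 1\<close> elements, and the clique
  \<open>G\<close> shows that smaller bags do not suffice.\<close>

lemma treewidth_star:
  fixes H X G :: "nat set"
  assumes fin: "finite H" "finite X" "finite G"
    and disj: "H \<inter> X = {}" "H \<inter> G = {}" "X \<inter> G = {}"
    and edges: "\<And>e. e \<in> E \<Longrightarrow> (\<exists>x\<in>X. e \<subseteq> insert x H) \<or> e \<subseteq> G"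
    and clique: "\<And>u v. u \<in> G \<Longrightarrow> v \<in> G \<Longrightarrow> u \<noteq> v \<Longrightarrow> {u, v} \<in> E"
    and card: "card G = Suc (card H)"
  shows "treewidth (H \<union> X \<union> G) E = card H"
proof -
  \<comment> \<open>Tree nodes are natural numbers, so bags need numerical names: 0 for the centre,
    \<open>Suc x\<close> for the leaf of \<open>x\<close>, and \<open>Suc g\<close> for the leaf of
    \<open>G\<close>, where any \<open>g\<close> in \<open>G\<close> is a fresh name because
    \<open>G\<close> is disjoint from \<open>X\<close>.\<close>
  obtain g where g: "g \<in> G" using card by fastforce
  define L where "L = Suc ` insert g X"
  define I where "I = {0} \<union> L"
  let ?F = "{{0, y} | y. y \<in> L}"
  define bag where "bag i = (if i = 0 then H else if i - 1 \<in> X then insert (i - 1) H else G)" for i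
  have bag_simps: "bag 0 = H" "x \<in> X \<Longrightarrow> bag (Suc x) = insert x H" "bag (Suc g) = G" for x
    using disj g by (auto simp: bag_def)
  have sets: "{i \<in> I. v \<in> bag i} = (if v \<in> H then {0} \<union> Suc ` X else {Suc (if v \<in> X then v else g)})"
    if "v \<in> H \<union> X \<union> G" for v
    using that disj bag_simps by (auto simp: I_def L_def split: if_splits)
  have dec: "tree_decomposition (H \<union> X \<union> G) E I ?F bag"
    unfolding tree_decomposition_def
  proof (intro conjI ballI)
    show "tree_graph I ?F" unfolding I_def by (rule tree_graph_star) (use fin in \<open>auto simp: L_def\<close>)
    show "bag i \<subseteq> H \<union> X \<union> G" for i by (auto simp: bag_def)
    show "\<exists>i\<in>I. v \<in> bag i" if "v \<in> H \<union> X \<union> G" for v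
      using sets[OF that] by (auto split: if_splits)
    show "\<exists>i\<in>I. e \<subseteq> bag i" if "e \<in> E" for e
      using edges[OF that]
    proof
      assume "\<exists>x\<in>X. e \<subseteq> insert x H"
      then obtain x where "x \<in> X" "e \<subseteq> bag (Suc x)" using bag_simps by auto
      then show ?thesis by (intro bexI[of _ "Suc x"]) (auto simp: I_def L_def)
    next
      assume "e \<subseteq> G"
      then show ?thesis using bag_simps by (intro bexI[of _ "Suc g"]) (auto simp: I_def L_def)
    qed
    show "connected_in ?F {i \<in> I. v \<in> bag i}" if "v \<in> H \<union> X \<union> G" for v
      by (rule connected_in_star) (use sets[OF that] in \<open>auto simp: I_def split: if_splits\<close>)
  qed
  have "card (bag i) \<le> Suc (card H)" for i
    using fin card by (auto simp: bag_def card_insert_if)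
  moreover have "card (bag (Suc g)) = Suc (card H)" using bag_simps card by simp
  ultimately have "Max ((\<lambda>i. card (bag i)) ` I) = Suc (card H)"
    using fin by (intro Max_eqI) (auto simp: I_def L_def intro!: image_eqI[of _ _ "Suc g"])
  then have width: "decomposition_width I bag = card H" by (simp add: decomposition_width_def)
  show ?thesis unfolding treewidth_def
  proof (rule Least_equality)
    show "\<exists>I F bag. tree_decomposition (H \<union> X \<union> G) E I F bag \<and> decomposition_width I bag = card H"
      using dec width by blast
    fix w assume "\<exists>I F bag. tree_decomposition (H \<union> X \<union> G) E I F bag \<and> decomposition_width I bag = w"
    then obtain I F bag where "tree_decomposition (H \<union> X \<union> G) E I F bag" "decomposition_width I bag = w"
      by blast
    then show "card H \<le> w"
      using decomposition_width_ge[of "H \<union> X \<union> G" E I F bag G] clique card fin by auto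
  qed
qed

section \<open>The learning instance of a graph\<close>

lemma set_suffixes:
  assumes "s \<in> set (suffixes xs)"
  shows "s \<noteq> []" "hd s \<in> set xs" "set s \<subseteq> set xs" "distinct xs \<Longrightarrow> distinct s"
  using assms by (induction xs) auto

lemma suffixes_hd_inj:
  assumes "distinct xs" "s \<in> set (suffixes xs)" "t \<in> set (suffixes xs)" "hd s = hd t"
  shows "s = t"
  using assms by (induction xs) (auto dest: set_suffixes(2))

lemma distinct_suffixes_hd: "distinct xs \<Longrightarrow> distinct (map hd (suffixes xs))"
  by (induction xs) (auto dest: set_suffixes(2))

lemma suffixes_hd_surj: "x \<in> set xs \<Longrightarrow> \<exists>s\<in>set (suffixes xs). hd s = x"
  by (induction xs) auto

lemma suffixes_order:
  assumes "u \<in> set xs" "v \<in> set xs" "u \<noteq> v"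
  shows "\<exists>s\<in>set (suffixes xs). hd s = u \<and> v \<in> set (tl s) \<or> hd s = v \<and> u \<in> set (tl s)"
  using assms by (induction xs) auto

lemma suffixes_rank:
  assumes "distinct xs"
  shows "\<exists>r::'a \<Rightarrow> nat. \<forall>s\<in>set (suffixes xs). \<forall>b\<in>set (tl s). r b < r (hd s)"
  using assms
proof (induction xs)
  case (Cons x xs)
  then obtain r :: "'a \<Rightarrow> nat" where r: "\<forall>s\<in>set (suffixes xs). \<forall>b\<in>set (tl s). r b < r (hd s)" by auto
  \<comment> \<open>The new head has to outrank everything behind it; one more than the sum of all
    ranks is large enough.\<close>
  have "r b < Suc (sum r (set xs))" if "b \<in> set xs" for b
    using that by (simp add: less_Suc_eq_le member_le_sum)
  moreover have "hd s \<noteq> x" "b \<noteq> x" if "s \<in> set (suffixes xs)" "b \<in> set (tl s)" for s b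
    using Cons.prems set_suffixes(1-3)[OF that(1)] that(2) by (auto dest: list.set_sel(2))
  ultimately show ?case using r Cons.prems
    by (intro exI[of _ "r(x := Suc (sum r (set xs)))"]) auto
qed simp

text \<open>For a distinct list, this is one orientation of each unordered pair, chosen by position.
  It provides a single name for the hub of two colours.\<close>

definition pairs :: "'a list \<Rightarrow> ('a \<times> 'a) list" where
  "pairs xs = concat (map (\<lambda>s. map (\<lambda>b. (hd s, b)) (tl s)) (suffixes xs))"

lemma pairs_Nil: "pairs [] = []"
  by (simp add: pairs_def)

lemma pairs_Cons: "pairs (x # xs) = map (Pair x) xs @ pairs xs"
  by (simp add: pairs_def)

lemma pairs_subset: "set (pairs xs) \<subseteq> set xs \<times> set xs"
  by (induction xs) (auto simp: pairs_Nil pairs_Cons)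

lemma pairs_irrefl: "distinct xs \<Longrightarrow> (a, a) \<notin> set (pairs xs)"
  using pairs_subset by (induction xs) (fastforce simp: pairs_Nil pairs_Cons)+

lemma pairs_total: "a \<in> set xs \<Longrightarrow> b \<in> set xs \<Longrightarrow> a \<noteq> b \<Longrightarrow> (a, b) \<in> set (pairs xs) \<or> (b, a) \<in> set (pairs xs)"
  by (induction xs) (auto simp: pairs_Cons)

lemma distinct_pairs: "distinct xs \<Longrightarrow> distinct (pairs xs)"
proof (induction xs)
  case (Cons x xs)
  then show ?case using pairs_subset[of xs] by (auto simp: pairs_Cons distinct_map inj_on_def)
qed (simp add: pairs_Nil)

lemma length_pairs_le: "length (pairs xs) \<le> length xs * length xs"
  by (induction xs) (auto simp: pairs_Nil pairs_Cons)

text \<open>Over a product list, distinctness of nested maps reduces to injectivity.\<close>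

lemma concat_map_product:
  "concat (map (\<lambda>x. map (f x) ys) xs) = map (\<lambda>(x, y). f x y) (List.product xs ys)"
  by (induction xs) auto

section \<open>Nodes and score table of the instance\<close>

definition hub :: "nat \<times> nat \<Rightarrow> nat" where "hub p = 4 * pair (fst p) (snd p)"
definition vnode :: "nat \<Rightarrow> nat \<Rightarrow> nat" where "vnode i w = 4 * pair i w + 1"
definition gnode :: "nat \<times> nat \<Rightarrow> nat" where "gnode p = 4 * pair (fst p) (snd p) + 2"

lemma hub_inject [simp]: "hub p = hub q \<longleftrightarrow> p = q"
  by (simp add: hub_def pair_inject prod_eq_iff)

lemma gnode_inject [simp]: "gnode p = gnode q \<longleftrightarrow> p = q"
  by (simp add: gnode_def pair_inject prod_eq_iff)

lemma vnode_inject [simp]: "vnode i w = vnode j v \<longleftrightarrow> i = j \<and> w = v"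
  by (simp add: vnode_def pair_inject)

text \<open>The residue modulo 4 separates hubs, vertex nodes and clique nodes. The residue 3 is
  left for the single number 3, the clique node in excess of the number of hubs.\<close>

lemma nodes_disjoint [simp]:
  "hub p \<noteq> vnode i w" "hub p \<noteq> gnode q" "vnode i w \<noteq> gnode q"
  "vnode i w \<noteq> hub p" "gnode q \<noteq> hub p" "gnode q \<noteq> vnode i w"
  "hub p \<noteq> 3" "vnode i w \<noteq> 3" "gnode q \<noteq> 3" "3 \<noteq> hub p" "3 \<noteq> vnode i w" "3 \<noteq> gnode q"
proof -
  have "vnode i w mod 4 = 1 mod 4" "gnode q mod 4 = 2 mod 4"
    unfolding vnode_def gnode_def by (rule mod_mult_self4)+
  then have "hub p mod 4 = 0" "vnode i w mod 4 = 1" "gnode q mod 4 = 2" "3 mod 4 = (3 :: nat)"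
    by (simp_all add: hub_def)
  then show "hub p \<noteq> vnode i w" "hub p \<noteq> gnode q" "vnode i w \<noteq> gnode q"
    "vnode i w \<noteq> hub p" "gnode q \<noteq> hub p" "gnode q \<noteq> vnode i w"
    "hub p \<noteq> 3" "vnode i w \<noteq> 3" "gnode q \<noteq> 3" "3 \<noteq> hub p" "3 \<noteq> vnode i w" "3 \<noteq> gnode q"
    by force+
qed

text \<open>The colours are the first \<open>k\<close> elements of a list of length \<open>card V + 1\<close>: a graph has a
  clique of size \<open>k\<close> iff it has one of size \<open>min k (card V + 1)\<close>.\<close>

definition colours :: "nat list \<Rightarrow> nat \<Rightarrow> nat list" where
  "colours vs k = rev (take k (0 # map (\<lambda>v. 2 * v + 1) vs))"

definition hub_pairs :: "nat list \<Rightarrow> (nat \<times> nat) list" where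
  "hub_pairs C = map (\<lambda>i. (i, i)) C @ pairs C"

definition hubs :: "nat list \<Rightarrow> nat list" where "hubs C = map hub (hub_pairs C)"

definition vnodes :: "nat list \<Rightarrow> nat list \<Rightarrow> nat list" where
  "vnodes vs C = concat (map (\<lambda>i. map (vnode i) vs) C)"

definition gnodes :: "nat list \<Rightarrow> nat list" where "gnodes C = 3 # map gnode (hub_pairs C)"

definition nodes :: "nat list \<Rightarrow> nat list \<Rightarrow> nat list" where
  "nodes vs C = hubs C @ vnodes vs C @ gnodes C"

text \<open>A pair of colours is stored in one order only, whereas an edge may be used in either
  direction: each endpoint may receive the first colour.\<close>

definition orientations :: "('a \<times> 'a) list \<Rightarrow> ('a \<times> 'a) list" where
  "orientations es = es @ map (\<lambda>e. (snd e, fst e)) es"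

definition diag_entries :: "nat list \<Rightarrow> nat list \<Rightarrow> (nat \<times> nat list \<times> rat) list" where
  "diag_entries vs C = concat (map (\<lambda>i. map (\<lambda>u. (hub (i, i), [vnode i u], 2)) vs) C)"

definition pair_entries :: "(nat \<times> nat) list \<Rightarrow> nat list \<Rightarrow> (nat \<times> nat list \<times> rat) list" where
  "pair_entries es C = concat (map (\<lambda>p. map (\<lambda>e.
     (hub p, [vnode (fst p) (fst e), vnode (snd p) (snd e)], 1)) (orientations es)) (pairs C))"

definition vnode_entries :: "nat list \<Rightarrow> nat list \<Rightarrow> (nat \<times> nat list \<times> rat) list" where
  "vnode_entries vs C = map (\<lambda>x. (x, hubs C, 1)) (vnodes vs C)"

text \<open>A transitive tournament: each node wants exactly all later ones as parents. These parent
  sets are jointly acyclic, yet their arcs join any two nodes, so the full score and the full clique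
  coexist.\<close>

definition gnode_entries :: "nat list \<Rightarrow> (nat \<times> nat list \<times> rat) list" where
  "gnode_entries C = map (\<lambda>s. (hd s, tl s, 1)) (suffixes (gnodes C))"

definition entries :: "nat list \<Rightarrow> (nat \<times> nat) list \<Rightarrow> nat list \<Rightarrow> (nat \<times> nat list \<times> rat) list" where
  "entries vs es C = diag_entries vs C @ pair_entries es C @ vnode_entries vs C @ gnode_entries C"

section \<open>Score functions given by tables\<close>

abbreviation key :: "'a \<times> 'b list \<times> 'c \<Rightarrow> 'a \<times> 'b set" where
  "key \<equiv> \<lambda>(v, P, q). (v, set P)"

text \<open>Table lookup with default 0, written as a sum so that it is defined for every table;
  when keys are distinct, at most one summand is nonzero.\<close>

definition table_score :: "('a \<times> 'a list \<times> rat) list \<Rightarrow> 'a \<Rightarrow> 'a set \<Rightarrow> real" where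
  "table_score T v P = (\<Sum>(v', Q, q)\<leftarrow>T. if v' = v \<and> set Q = P then real_of_rat q else 0)"

lemma table_score_zero: "(v, P) \<notin> key ` set T \<Longrightarrow> table_score T v P = 0"
proof (induction T)
  case (Cons e T)
  obtain v' Q' q' where e: "e = (v', Q', q')" by (cases e)
  have "(v, P) \<noteq> (v', set Q')" "(v, P) \<notin> key ` set T" using Cons.prems e by auto
  then show ?case using Cons.IH by (auto simp: table_score_def e)
qed (simp add: table_score_def)

lemma table_score_entry:
  "distinct (map key T) \<Longrightarrow> (v, Q, q) \<in> set T \<Longrightarrow> table_score T v (set Q) = real_of_rat q"
proof (induction T)
  case (Cons e T)
  obtain v' Q' q' where e: "e = (v', Q', q')" by (cases e)
  show ?case
  proof (cases "e = (v, Q, q)")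
    case True
    then show ?thesis using Cons.prems table_score_zero[of v "set Q" T] by (auto simp: table_score_def)
  next
    case False
    then have mem: "(v, Q, q) \<in> set T" using Cons.prems by simp
    then have "(v, set Q) \<in> key ` set T" by force
    moreover have "(v', set Q') \<notin> key ` set T" using Cons.prems(1) e by simp
    ultimately have "(v', set Q') \<noteq> (v, set Q)" by metis
    then have "table_score (e # T) v (set Q) = table_score T v (set Q)"
      by (auto simp: table_score_def e)
    then show ?thesis using Cons mem by simp
  qed
qed simp

lemma table_score_nonneg:
  assumes "\<And>v Q q. (v, Q, q) \<in> set T \<Longrightarrow> 0 < q"
  shows "0 \<le> table_score T v P"
  using assms unfolding table_score_def by (intro sum_list_nonneg) (auto simp: less_imp_le)

lemma table_score_pos_cases:
  assumes "table_score T v P \<noteq> 0" "distinct (map key T)"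
  obtains Q q where "(v, Q, q) \<in> set T" "set Q = P" "table_score T v P = real_of_rat q"
proof -
  have "(v, P) \<in> key ` set T" using assms(1) table_score_zero[of v P T] by argo
  then obtain e where "e \<in> set T" "key e = (v, P)" by force
  moreover obtain v' Q q where "e = (v', Q, q)" by (cases e)
  ultimately have "(v, Q, q) \<in> set T" "set Q = P" by simp_all
  with table_score_entry[OF assms(2) this(1)] show thesis using that[of Q q] by simp
qed

lemma nonzero_representation_table_score:
  assumes "distinct (map key T)"
    and "\<And>v Q q. (v, Q, q) \<in> set T \<Longrightarrow> v \<in> N \<and> set Q \<subseteq> N - {v} \<and> distinct Q \<and> 0 < q"
  shows "nonzero_representation N (table_score T) T"
  unfolding nonzero_representation_def
proof (intro conjI)
  show "distinct (map key T)" by fact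
  show "\<forall>(v, P, q)\<in>set T. distinct P" using assms(2) by auto
  show "set (map (\<lambda>(v, P, q). (v, set P, real_of_rat q)) T) =
    {(v, P, table_score T v P) |v P. v \<in> N \<and> P \<subseteq> N - {v} \<and> 0 < table_score T v P}" (is "?L = ?R")
  proof (intro equalityI subsetI)
    fix x assume "x \<in> ?L"
    then obtain v Q q where e: "(v, Q, q) \<in> set T" "x = (v, set Q, real_of_rat q)" by auto
    then show "x \<in> ?R" using table_score_entry[OF assms(1) e(1)] assms(2)[OF e(1)] by auto
  next
    fix x assume "x \<in> ?R"
    then obtain v P where x: "x = (v, P, table_score T v P)" "0 < table_score T v P" by auto
    then obtain Q q where e: "(v, Q, q) \<in> set T" "set Q = P" "table_score T v P = real_of_rat q"
      using table_score_pos_cases[OF _ assms(1), of v P] by (metis less_irrefl)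
    then show "x \<in> ?L" using x by force
  qed
qed

text \<open>The table lists all positive values, and non-negativity leaves only 0 for the rest. At
  meaningless arguments the functions may differ, whence the restrictions on \<open>v\<close> and
  \<open>P\<close>.\<close>

lemma nonzero_representation_unique:
  assumes "nonzero_representation N f T" "nonzero_representation N g T"
    "local_score N f" "local_score N g" "v \<in> N" "P \<subseteq> N - {v}"
  shows "f v P = g v P"
proof -
  have *: "{(v, P, f v P) | v P. v \<in> N \<and> P \<subseteq> N - {v} \<and> f v P > 0} =
    {(v, P, g v P) | v P. v \<in> N \<and> P \<subseteq> N - {v} \<and> g v P > 0}"
    using assms unfolding nonzero_representation_def by simp
  have "0 \<le> f v P" "0 \<le> g v P" using assms by (auto simp: local_score_def)
  moreover have "f v P = g v P" if "f v P > 0"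
  proof -
    have "(v, P, f v P) \<in> {(v, P, g v P) | v P. v \<in> N \<and> P \<subseteq> N - {v} \<and> g v P > 0}"
      unfolding *[symmetric] using that assms by blast
    then show ?thesis by auto
  qed
  moreover have "f v P = g v P" if "g v P > 0"
  proof -
    have "(v, P, g v P) \<in> {(v, P, f v P) | v P. v \<in> N \<and> P \<subseteq> N - {v} \<and> f v P > 0}"
      unfolding * using that assms by blast
    then show ?thesis by auto
  qed
  ultimately show ?thesis by linarith
qed

lemma parents_dag:
  assumes "dag N D" shows "parents D v \<subseteq> N - {v}"
  using assms by (auto simp: dag_def parents_def acyclic_def)

text \<open>By acyclicity no node is its own parent, so a dag evaluates a score function only at
  meaningful arguments.\<close>

lemma exact_BNSL_cong:
  assumes "\<And>v P. v \<in> N \<Longrightarrow> P \<subseteq> N - {v} \<Longrightarrow> f v P = g v P"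
  shows "exact_BNSL N f s \<longleftrightarrow> exact_BNSL N g s"
proof -
  have "score N f D = score N g D" if "dag N D" for D
    unfolding score_def using assms parents_dag[OF that] by (intro sum.cong) auto
  then show ?thesis by (auto simp: exact_BNSL_def)
qed

section \<open>Injectivity of the encodings\<close>

lemma enc_nat_eq_iff: "enc_nat m = enc_nat n \<longleftrightarrow> m = n"
proof
  show "enc_nat m = enc_nat n \<Longrightarrow> m = n"
  proof (induction m arbitrary: n rule: less_induct)
    case (less m)
    show ?case
    proof (cases "m = 0 \<or> n = 0")
      case True
      then show ?thesis using less.prems enc_nat.simps[of m] enc_nat.simps[of n] by (auto split: if_splits)
    next
      case False
      then have "odd m \<longleftrightarrow> odd n" "enc_nat (m div 2) = enc_nat (n div 2)"
        using less.prems enc_nat.simps[of m] enc_nat.simps[of n] by (auto split: if_splits)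
      then have "m div 2 = n div 2" using less.IH False by simp
      with \<open>odd m \<longleftrightarrow> odd n\<close> show ?thesis by (metis odd_two_times_div_two_succ even_two_times_div_two)
    qed
  qed
qed simp

lemma enc_list_inj:
  assumes "enc_list e xs = enc_list e ys"
    and "\<And>x y. x \<in> set xs \<Longrightarrow> y \<in> set ys \<Longrightarrow> e x = e y \<Longrightarrow> x = y"
  shows "xs = ys"
  using assms
proof (induction xs arbitrary: ys)
  case Nil
  then show ?case by (cases ys) auto
next
  case (Cons x xs)
  then show ?case by (cases ys) auto
qed

text \<open>Positivity is essential: the encoding passes through \<open>nat\<close>, which sends all
  negative numerators to 0.\<close>

lemma enc_rat_inj:
  assumes "enc_rat p = enc_rat q" "0 < p" "0 < q"
  shows "p = q"
proof -
  obtain a b where p: "quotient_of p = (a, b)" by force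
  obtain c d where q: "quotient_of q = (c, d)" by force
  have "0 < b" "0 < d" using quotient_of_denom_pos p q by auto
  moreover have "0 < a" "0 < c"
    using assms(2,3) quotient_of_div[OF p] quotient_of_div[OF q] \<open>0 < b\<close> \<open>0 < d\<close>
    by (auto simp: zero_less_divide_iff)
  moreover have "nat a = nat c" "nat b = nat d"
    using assms(1) by (auto simp: enc_rat_def p q enc_nat_eq_iff)
  ultimately have "a = c" "b = d" by auto
  then show ?thesis using quotient_of_div[OF p] quotient_of_div[OF q] by simp
qed

definition enc_BNSL :: "nat list \<Rightarrow> (nat \<times> nat list \<times> rat) list \<Rightarrow> rat \<Rightarrow> tree" where
  "enc_BNSL ns T q = Node (enc_list enc_nat ns)
    (Node (enc_list (\<lambda>(v, P, r). Node (enc_nat v) (Node (enc_list enc_nat P) (enc_rat r))) T) (enc_rat q))"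

lemma enc_BNSL_inj:
  assumes "enc_BNSL ns T q = enc_BNSL ns' T' q'" "0 < q" "0 < q'"
    "\<And>v P r. (v, P, r) \<in> set T \<Longrightarrow> 0 < r" "\<And>v P r. (v, P, r) \<in> set T' \<Longrightarrow> 0 < r"
  shows "ns = ns'" "T = T'" "q = q'"
proof -
  have nats: "xs = ys" if "enc_list enc_nat xs = enc_list enc_nat ys" for xs ys
    using enc_list_inj[OF that] enc_nat_eq_iff by blast
  show "ns = ns'" using assms(1) nats by (simp add: enc_BNSL_def)
  show "q = q'" using assms enc_rat_inj by (simp add: enc_BNSL_def)
  have "enc_list (\<lambda>(v, P, r). Node (enc_nat v) (Node (enc_list enc_nat P) (enc_rat r))) T =
    enc_list (\<lambda>(v, P, r). Node (enc_nat v) (Node (enc_list enc_nat P) (enc_rat r))) T'"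
    using assms(1) by (simp add: enc_BNSL_def)
  then show "T = T'"
  proof (rule enc_list_inj)
    fix x y assume xy: "x \<in> set T" "y \<in> set T'"
      "(\<lambda>(v, P, r). Node (enc_nat v) (Node (enc_list enc_nat P) (enc_rat r))) x =
       (\<lambda>(v, P, r). Node (enc_nat v) (Node (enc_list enc_nat P) (enc_rat r))) y"
    moreover obtain v P r where x: "x = (v, P, r)" by (cases x)
    moreover obtain v' P' r' where y: "y = (v', P', r')" by (cases y)
    ultimately have "v = v'" "P = P'" "enc_rat r = enc_rat r'" by (auto simp: enc_nat_eq_iff dest: nats)
    moreover have "0 < r" "0 < r'" using assms(4,5) xy x y by blast+
    ultimately show "x = y" using x y enc_rat_inj by blast
  qed
qed

section \<open>Validity and treewidth of the instance\<close>

locale clique_reduction =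
  fixes vs :: "nat list" and es :: "(nat \<times> nat) list" and C :: "nat list"
  assumes distinct_vs: "distinct vs" and distinct_C: "distinct C"
    and es_vertices: "\<And>u v. (u, v) \<in> set es \<Longrightarrow> u \<in> set vs \<and> v \<in> set vs \<and> u \<noteq> v"
    and distinct_es: "distinct (map (\<lambda>(u, v). {u, v}) es)"
begin

definition edges :: "nat set set" where "edges = set (map (\<lambda>(u, v). {u, v}) es)"

lemma orientations_iff: "(u, v) \<in> set (orientations es) \<longleftrightarrow> {u, v} \<in> edges"
  by (auto simp: orientations_def edges_def doubleton_eq_iff image_iff split: prod.splits) force+

lemma orientations_vertices:
  "(u, v) \<in> set (orientations es) \<Longrightarrow> u \<in> set vs \<and> v \<in> set vs \<and> u \<noteq> v"
  using es_vertices by (fastforce simp: orientations_def)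

text \<open>An edge and its reversal give the same two-element set, so the list cannot contain both;
  and no edge is its own reversal.\<close>

lemma distinct_orientations: "distinct (orientations es)"
proof -
  have "distinct es" using distinct_es by (simp add: distinct_map)
  moreover have "inj_on (\<lambda>e. (snd e, fst e)) (set es)" by (auto simp: inj_on_def prod_eq_iff)
  moreover have False if "(u, v) \<in> set es" "(v, u) \<in> set es" for u v
  proof -
    have inj: "inj_on (\<lambda>(u, v). {u, v}) (set es)" using distinct_es by (simp add: distinct_map)
    have "(u, v) = (v, u)" by (rule inj_onD[OF inj]) (use that in auto)
    then show False using es_vertices[OF that(1)] by simp
  qed
  ultimately show ?thesis by (auto simp: orientations_def distinct_map)
qed

lemma distinct_hub_pairs: "distinct (hub_pairs C)"
  using distinct_C distinct_pairs[OF distinct_C] pairs_irrefl[OF distinct_C]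
  by (auto simp: hub_pairs_def distinct_map inj_on_def)

lemma distinct_hubs: "distinct (hubs C)"
  using distinct_hub_pairs by (simp add: hubs_def distinct_map inj_on_def)

lemma distinct_gnodes: "distinct (gnodes C)"
  using distinct_hub_pairs by (auto simp: gnodes_def distinct_map inj_on_def)

lemma distinct_vnodes: "distinct (vnodes vs C)"
  using distinct_vs distinct_C
  by (auto simp: vnodes_def concat_map_product distinct_map distinct_product inj_on_def)

lemma set_hubs: "set (hubs C) = (\<lambda>i. hub (i, i)) ` set C \<union> hub ` set (pairs C)"
  by (auto simp: hubs_def hub_pairs_def)

lemma set_vnodes: "set (vnodes vs C) = (\<lambda>(i, w). vnode i w) ` (set C \<times> set vs)"
  by (auto simp: vnodes_def)

lemma set_gnodes: "set (gnodes C) = insert 3 (gnode ` set (hub_pairs C))"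
  by (auto simp: gnodes_def)

lemma parts_disjoint:
  "set (hubs C) \<inter> set (vnodes vs C) = {}" "set (hubs C) \<inter> set (gnodes C) = {}"
  "set (vnodes vs C) \<inter> set (gnodes C) = {}"
  by (auto simp: set_hubs set_vnodes set_gnodes)

lemma distinct_nodes: "distinct (nodes vs C)"
  using distinct_hubs distinct_vnodes distinct_gnodes parts_disjoint by (auto simp: nodes_def)

lemma set_nodes: "set (nodes vs C) = set (hubs C) \<union> set (vnodes vs C) \<union> set (gnodes C)"
  by (auto simp: nodes_def)

lemma entry_cases:
  assumes "(v, Q, q) \<in> set (entries vs es C)"
  obtains (diag) i u where "i \<in> set C" "u \<in> set vs" "v = hub (i, i)" "Q = [vnode i u]" "q = 2"
    | (pair) i j a b where "(i, j) \<in> set (pairs C)" "(a, b) \<in> set (orientations es)"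
        "v = hub (i, j)" "Q = [vnode i a, vnode j b]" "q = 1"
    | (vnode) i w where "i \<in> set C" "w \<in> set vs" "v = vnode i w" "Q = hubs C" "q = 1"
    | (gnode) s where "s \<in> set (suffixes (gnodes C))" "v = hd s" "Q = tl s" "q = 1"
proof -
  consider "(v, Q, q) \<in> set (diag_entries vs C)" | "(v, Q, q) \<in> set (pair_entries es C)"
    | "(v, Q, q) \<in> set (vnode_entries vs C)" | "(v, Q, q) \<in> set (gnode_entries C)"
    using assms by (auto simp: entries_def)
  then show thesis
  proof cases
    case 1
    then show thesis using diag by (auto simp: diag_entries_def)
  next
    case 2
    then obtain p e where pe: "p \<in> set (pairs C)" "e \<in> set (orientations es)"
      "v = hub p" "Q = [vnode (fst p) (fst e), vnode (snd p) (snd e)]" "q = 1"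
      by (auto simp: pair_entries_def)
    then show thesis using pair[of "fst p" "snd p" "fst e" "snd e"] by simp
  next
    case 3
    then show thesis using vnode by (auto simp: vnode_entries_def set_vnodes)
  next
    case 4
    then show thesis using gnode by (auto simp: gnode_entries_def)
  qed
qed

lemma entry_mem:
  "i \<in> set C \<Longrightarrow> u \<in> set vs \<Longrightarrow> (hub (i, i), [vnode i u], 2) \<in> set (entries vs es C)"
  "(i, j) \<in> set (pairs C) \<Longrightarrow> (a, b) \<in> set (orientations es) \<Longrightarrow>
    (hub (i, j), [vnode i a, vnode j b], 1) \<in> set (entries vs es C)"
  "i \<in> set C \<Longrightarrow> w \<in> set vs \<Longrightarrow> (vnode i w, hubs C, 1) \<in> set (entries vs es C)"
  "s \<in> set (suffixes (gnodes C)) \<Longrightarrow> (hd s, tl s, 1) \<in> set (entries vs es C)"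
proof -
  show "(hub (i, j), [vnode i a, vnode j b], 1) \<in> set (entries vs es C)"
    if "(i, j) \<in> set (pairs C)" "(a, b) \<in> set (orientations es)"
    using that by (auto simp: entries_def pair_entries_def intro!: bexI[of _ "(i, j)"] image_eqI[of _ _ "(a, b)"])
qed (auto simp: entries_def diag_entries_def vnode_entries_def gnode_entries_def set_vnodes)

lemma pairs_C: "(i, j) \<in> set (pairs C) \<Longrightarrow> i \<in> set C \<and> j \<in> set C \<and> i \<noteq> j"
  using pairs_subset pairs_irrefl[OF distinct_C] by fastforce

lemma gnode_suffix:
  assumes "s \<in> set (suffixes (gnodes C))"
  shows "hd s \<in> set (gnodes C)" "set (tl s) \<subseteq> set (gnodes C) - {hd s}" "distinct (tl s)"
proof -
  note * = set_suffixes[OF assms] distinct_gnodes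
  show "hd s \<in> set (gnodes C)" using * by blast
  have "s = hd s # tl s" "distinct s" using * by auto
  then show "set (tl s) \<subseteq> set (gnodes C) - {hd s}" "distinct (tl s)"
    using *(3) by (metis Diff_empty distinct.simps(2) list.set_intros(2) subsetD subsetI subset_Diff_insert)+
qed

lemma entry_valid:
  assumes "(v, Q, q) \<in> set (entries vs es C)"
  shows "v \<in> set (nodes vs C) \<and> set Q \<subseteq> set (nodes vs C) - {v} \<and> distinct Q \<and> 0 < q"
  using assms
proof (cases rule: entry_cases)
  case (diag i u)
  then show ?thesis by (auto simp: set_nodes set_hubs set_vnodes)
next
  case (pair i j a b)
  then show ?thesis
    using pairs_C orientations_vertices by (fastforce simp: set_nodes set_hubs set_vnodes)
next
  case (vnode i w)
  then show ?thesis using distinct_hubs by (auto simp: set_nodes set_hubs set_vnodes)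
next
  case (gnode s)
  then show ?thesis using gnode_suffix[OF gnode(1)] by (auto simp: set_nodes)
qed

lemma distinct_keys: "distinct (map key (entries vs es C))"
proof -
  have "distinct (map key (diag_entries vs C))"
    using distinct_vs distinct_C
    by (auto simp: diag_entries_def concat_map_product distinct_map distinct_product inj_on_def o_def)
  moreover have "distinct (map key (pair_entries es C))"
  proof -
    \<comment> \<open>A parent set forgets the order of its two vertex nodes; it is recovered from
      their colours, which differ.\<close>
    have "inj_on (\<lambda>(p, e). (hub p, {vnode (fst p) (fst e), vnode (snd p) (snd e)}))
       (set (pairs C) \<times> set (orientations es))"
      using pairs_C by (fastforce simp: inj_on_def doubleton_eq_iff)
    then show ?thesis
      using distinct_pairs[OF distinct_C] distinct_orientations
      by (simp add: pair_entries_def concat_map_product distinct_map distinct_product o_def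
          case_prod_unfold)
  qed
  moreover have "distinct (map key (vnode_entries vs C))"
    using distinct_vnodes by (simp add: vnode_entries_def distinct_map inj_on_def o_def)
  moreover have "distinct (map key (gnode_entries C))"
    using distinct_suffixes_hd[OF distinct_gnodes]
    by (auto simp: gnode_entries_def distinct_map inj_on_def o_def)
  \<comment> \<open>The four tables score disjoint sets of nodes, so keys can clash only within one
    table.\<close>
  moreover have fsts: "fst ` key ` set (diag_entries vs C) \<subseteq> (\<lambda>i. hub (i, i)) ` set C"
    "fst ` key ` set (pair_entries es C) \<subseteq> hub ` set (pairs C)"
    "fst ` key ` set (vnode_entries vs C) \<subseteq> set (vnodes vs C)"
    "fst ` key ` set (gnode_entries C) \<subseteq> set (gnodes C)"
    using gnode_suffix(1)
    by (auto simp: diag_entries_def pair_entries_def vnode_entries_def gnode_entries_def)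
  have disj: "A \<inter> B = {}" if "fst ` A \<subseteq> S" "fst ` B \<subseteq> T" "S \<inter> T = {}"
    for A B :: "(nat \<times> nat set) set" and S T using that by fastforce
  have "(\<lambda>i. hub (i, i)) ` set C \<inter> hub ` set (pairs C) = {}" using pairs_C by auto
  moreover have "(\<lambda>i. hub (i, i)) ` set C \<inter> set (vnodes vs C) = {}" "hub ` set (pairs C) \<inter> set (vnodes vs C) = {}"
    "(\<lambda>i. hub (i, i)) ` set C \<inter> set (gnodes C) = {}" "hub ` set (pairs C) \<inter> set (gnodes C) = {}"
    using parts_disjoint unfolding set_hubs by blast+
  ultimately show ?thesis unfolding entries_def map_append distinct_append set_append set_map Int_Un_distrib
    by (intro conjI disj[OF fsts(1,2)] disj[OF fsts(1,3)] disj[OF fsts(1,4)] disj[OF fsts(2,3)]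
        disj[OF fsts(2,4)] disj[OF fsts(3,4)] parts_disjoint Un_empty[THEN iffD2])
qed

abbreviation f :: "nat \<Rightarrow> nat set \<Rightarrow> real" where "f \<equiv> table_score (entries vs es C)"
abbreviation N :: "nat set" where "N \<equiv> set (nodes vs C)"

lemma nonzero_representation_f: "nonzero_representation N f (entries vs es C)"
  by (rule nonzero_representation_table_score[OF distinct_keys entry_valid])

lemma local_score_f: "local_score N f"
proof -
  have "0 \<le> f v P" for v P by (rule table_score_nonneg) (simp add: entry_valid)
  then show ?thesis by (simp add: local_score_def)
qed

lemma f_entry: "(v, Q, q) \<in> set (entries vs es C) \<Longrightarrow> set Q = P \<Longrightarrow> f v P = real_of_rat q"
  using table_score_entry[OF distinct_keys] by blast

lemma f_cases:
  obtains "f v P = 0" | Q q where "(v, Q, q) \<in> set (entries vs es C)" "set Q = P" "f v P = real_of_rat q"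
  using table_score_pos_cases[OF _ distinct_keys, of v P] by blast

lemma super_structure_edge:
  assumes "e \<in> super_structure N f"
  shows "(\<exists>x\<in>set (vnodes vs C). e \<subseteq> insert x (set (hubs C))) \<or> e \<subseteq> set (gnodes C)"
proof -
  obtain u v P where e: "e = {u, v}" and P: "P \<in> parent_sets N f v" "u \<in> P"
    using assms by (auto simp: super_structure_def skeleton_def directed_super_structure_def)
  then have "f v P > 0" by (auto simp: parent_sets_def)
  then obtain Q q where entry: "(v, Q, q) \<in> set (entries vs es C)" and Q: "set Q = P"
    using f_cases[of v P] by (metis less_irrefl)
  from entry show ?thesis
  proof (cases rule: entry_cases)
    case (diag i a)
    then show ?thesis using e P(2) Q by (auto simp: set_hubs set_vnodes)
  next
    case (pair i j a b)
    then have "u \<in> set (vnodes vs C)" "v \<in> set (hubs C)"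
      using P(2) Q pairs_C orientations_vertices by (fastforce simp: set_hubs set_vnodes)+
    then show ?thesis using e by blast
  next
    case (vnode i w)
    then have "v \<in> set (vnodes vs C)" "u \<in> set (hubs C)" using P(2) Q by (auto simp: set_vnodes)
    then show ?thesis using e by blast
  next
    case (gnode s)
    then show ?thesis using e P(2) Q gnode_suffix[OF gnode(1)] by auto
  qed
qed

lemma super_structure_gnodes:
  assumes "u \<in> set (gnodes C)" "v \<in> set (gnodes C)" "u \<noteq> v"
  shows "{u, v} \<in> super_structure N f"
proof -
  have arc: "{hd s, b} \<in> super_structure N f" if s: "s \<in> set (suffixes (gnodes C))" and b: "b \<in> set (tl s)" for s b
  proof -
    have "f (hd s) (set (tl s)) = 1" using f_entry[OF entry_mem(4)[OF s]] by simp
    then have "set (tl s) \<in> parent_sets N f (hd s)"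
      using entry_valid[OF entry_mem(4)[OF s]] by (simp add: parent_sets_def)
    moreover have "hd s \<in> N" "b \<in> N" using entry_valid[OF entry_mem(4)[OF s]] b by auto
    ultimately have "(b, hd s) \<in> directed_super_structure N f"
      using b by (auto simp: directed_super_structure_def)
    then show ?thesis by (auto simp: super_structure_def skeleton_def insert_commute)
  qed
  from suffixes_order[OF assms] show ?thesis using arc by (auto simp: insert_commute)
qed

lemma treewidth_f: "treewidth N (super_structure N f) = length (hubs C)"
proof -
  have "treewidth N (super_structure N f) = card (set (hubs C))"
    unfolding set_nodes
  proof (rule treewidth_star)
    show "card (set (gnodes C)) = Suc (card (set (hubs C)))"
      unfolding distinct_card[OF distinct_gnodes] distinct_card[OF distinct_hubs]
      by (simp add: gnodes_def hubs_def)
  qed (use parts_disjoint super_structure_edge super_structure_gnodes in \<open>simp_all add: set_nodes\<close>)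
  then show ?thesis using distinct_hubs by (simp add: distinct_card)
qed

section \<open>Term-by-term comparison of score and threshold\<close>

lemma score_split:
  "score N f D = (\<Sum>i\<in>set C. f (hub (i, i)) (parents D (hub (i, i))) + (\<Sum>w\<in>set vs. f (vnode i w) (parents D (vnode i w))))
    + (\<Sum>p\<in>set (pairs C). f (hub p) (parents D (hub p))) + (\<Sum>v\<in>set (gnodes C). f v (parents D v))"
proof -
  let ?g = "\<lambda>v. f v (parents D v)"
  have "(\<Sum>v\<in>set (hubs C). ?g v) = (\<Sum>i\<in>set C. ?g (hub (i, i))) + (\<Sum>p\<in>set (pairs C). ?g (hub p))"
  proof -
    have "(\<lambda>i. hub (i, i)) ` set C \<inter> hub ` set (pairs C) = {}" using pairs_C by auto
    then show ?thesis unfolding set_hubs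
      by (subst sum.union_disjoint) (auto simp: sum.reindex inj_on_def o_def)
  qed
  moreover have "(\<Sum>v\<in>set (vnodes vs C). ?g v) = (\<Sum>i\<in>set C. \<Sum>w\<in>set vs. ?g (vnode i w))"
    unfolding set_vnodes sum.cartesian_product
    by (subst sum.reindex) (auto simp: inj_on_def o_def case_prod_unfold)
  ultimately show ?thesis
    unfolding score_def set_nodes using parts_disjoint
    by (subst sum.union_disjoint; (auto simp: sum.distrib)?)+
qed

text \<open>The threshold in the same grouping as the score. The hub of a colour is grouped with its
  vertex nodes because their separate maxima are incompatible: the sum for a colour is at most
  \<open>length vs + 1\<close>, although the maxima add up to \<open>length vs + 2\<close>.\<close>

lemma card_nodes:
  "real (length (nodes vs C)) = (\<Sum>i\<in>set C. real (length vs) + 1) + (\<Sum>p\<in>set (pairs C). 1) + (\<Sum>v\<in>set (gnodes C). 1)"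
proof -
  have "card (set C) = length C" "card (set (pairs C)) = length (pairs C)" "card (set (gnodes C)) = length (gnodes C)"
    using distinct_C distinct_pairs[OF distinct_C] distinct_gnodes distinct_card by blast+
  moreover have "length (nodes vs C) = length C + length (pairs C) + length C * length vs + length (gnodes C)"
    by (simp add: nodes_def hubs_def hub_pairs_def vnodes_def concat_map_product)
  ultimately show ?thesis by (simp add: algebra_simps)
qed

lemma f_diag_cases:
  obtains "f (hub (i, i)) P = 0" | u where "u \<in> set vs" "P = {vnode i u}" "f (hub (i, i)) P = 2"
proof (cases rule: f_cases[of "hub (i, i)" P])
  case (2 Q q)
  from 2(1) show thesis
  proof (cases rule: entry_cases)
    case (diag j u)
    then show thesis using 2 that(2)[of u] by simp
  next
    case (pair j l a b)
    then show thesis using pairs_C by auto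
  next
    case (gnode s)
    then show thesis using gnode_suffix(1)[OF gnode(1)] by (auto simp: set_gnodes)
  qed auto
qed (use that in blast)

lemma f_pair_cases:
  assumes "(i, j) \<in> set (pairs C)"
  obtains "f (hub (i, j)) P = 0"
    | a b where "(a, b) \<in> set (orientations es)" "P = {vnode i a, vnode j b}" "f (hub (i, j)) P = 1"
proof (cases rule: f_cases[of "hub (i, j)" P])
  case (2 Q q)
  from 2(1) show thesis
  proof (cases rule: entry_cases)
    case (diag j u)
    then show thesis using assms pairs_C by auto
  next
    case (pair j l a b)
    then show thesis using 2 that(2)[of a b] by auto
  next
    case (gnode s)
    then show thesis using gnode_suffix(1)[OF gnode(1)] by (auto simp: set_gnodes)
  qed auto
qed (use that in blast)

lemma f_vnode_cases:
  obtains "f (vnode i w) P = 0" | "P = set (hubs C)" "f (vnode i w) P = 1"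
proof (cases rule: f_cases[of "vnode i w" P])
  case (2 Q q)
  from 2(1) show thesis
  proof (cases rule: entry_cases)
    case (gnode s)
    then show thesis using gnode_suffix(1)[OF gnode(1)] by (auto simp: set_gnodes)
  qed (use 2 that in auto)
qed (use that in blast)

lemma f_gnode_le:
  assumes "v \<in> set (gnodes C)"
  shows "f v P \<le> 1"
proof (cases rule: f_cases[of v P])
  case (2 Q q)
  from 2(1) show ?thesis
    by (cases rule: entry_cases) (use 2 assms in \<open>auto simp: set_gnodes\<close>)
qed simp

lemma hub_in_hubs: "i \<in> set C \<Longrightarrow> hub (i, i) \<in> set (hubs C)" "p \<in> set (pairs C) \<Longrightarrow> hub p \<in> set (hubs C)"
  by (auto simp: set_hubs)

section \<open>From a clique to a dag\<close>

lemma exact_BNSL_of_clique: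
  assumes "has_clique (set vs) edges (length C)"
  shows "exact_BNSL N f (length (nodes vs C))"
proof -
  obtain Q where Q: "Q \<subseteq> set vs" "finite Q" "card Q = length C" 
    "\<And>u v. u \<in> Q \<Longrightarrow> v \<in> Q \<Longrightarrow> u \<noteq> v \<Longrightarrow> {u, v} \<in> edges"
    using assms unfolding has_clique_def by blast
  have "card (set C) = card Q" using Q distinct_C by (simp add: distinct_card)
  then obtain \<phi> where \<phi>: "bij_betw \<phi> (set C) Q"
    using Q(2) finite_same_card_bij by (metis List.finite_set)
  then have \<phi>Q: "\<phi> i \<in> Q" if "i \<in> set C" for i using that by (auto simp: bij_betw_def)
  have \<phi>vs: "\<phi> i \<in> set vs" if "i \<in> set C" for i using \<phi>Q[OF that] Q(1) by blast
  have \<phi>edge: "(\<phi> i, \<phi> j) \<in> set (orientations es)" if "(i, j) \<in> set (pairs C)" for i j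
  proof -
    have "i \<in> set C" "j \<in> set C" "i \<noteq> j" using pairs_C[OF that] by auto
    moreover from this have "\<phi> i \<noteq> \<phi> j" using \<phi> by (auto simp: bij_betw_def inj_on_def)
    ultimately show ?thesis using Q(4) \<phi>Q by (simp add: orientations_iff)
  qed
  obtain r :: "nat \<Rightarrow> nat" where r: "\<And>s b. s \<in> set (suffixes (gnodes C)) \<Longrightarrow> b \<in> set (tl s) \<Longrightarrow> r b < r (hd s)"
    using suffixes_rank[OF distinct_gnodes] by blast
  \<comment> \<open>Selected vertex nodes feed the hubs of their colour in \<open>D1\<close> and
    \<open>D2\<close>, all hubs feed each vertex node that is not selected in \<open>D3\<close>, and
    \<open>D4\<close> is the tournament on the added clique.\<close>
  define D1 where "D1 = {(vnode i (\<phi> i), hub (i, i)) | i. i \<in> set C}"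
  define D2 where "D2 = {(vnode l (\<phi> l), hub (i, j)) | i j l. (i, j) \<in> set (pairs C) \<and> l \<in> {i, j}}"
  define D3 where "D3 = {(h, vnode i w) | h i w. h \<in> set (hubs C) \<and> i \<in> set C \<and> w \<in> set vs \<and> w \<noteq> \<phi> i}"
  define D4 where "D4 = {(b, hd s) | b s. s \<in> set (suffixes (gnodes C)) \<and> b \<in> set (tl s)}"
  define D where "D = D1 \<union> D2 \<union> D3 \<union> D4"
  have D4: "u \<in> set (gnodes C)" "v \<in> set (gnodes C)" if "(u, v) \<in> D4" for u v
    using that gnode_suffix by (auto simp: D4_def)
  have parts: "D \<subseteq> N \<times> N"
    using D4 \<phi>vs pairs_C hub_in_hubs
    by (auto simp: D_def D1_def D2_def D3_def set_nodes set_vnodes)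
  \<comment> \<open>Arcs lead from selected vertex nodes to hubs and from there to the other vertex
    nodes. No arc joins the added clique to the rest, so its independent scale \<open>r\<close> does
    not interfere.\<close>
  define rank where "rank v = (if v \<in> set (gnodes C) then r v else if v \<in> set (hubs C) then 1
     else if \<exists>i\<in>set C. v = vnode i (\<phi> i) then 0 else (2 :: nat))" for v
  have "rank u < rank v" if "(u, v) \<in> D" for u v
  proof -
    have disj: "hub p \<notin> set (gnodes C)" "vnode i w \<notin> set (gnodes C)" "vnode i w \<notin> set (hubs C)" for p i w
      by (auto simp: set_gnodes hubs_def)
    have hubs: "h \<notin> set (gnodes C)" if "h \<in> set (hubs C)" for h using that parts_disjoint by blast
    consider "(u, v) \<in> D1" | "(u, v) \<in> D2" | "(u, v) \<in> D3" | "(u, v) \<in> D4" using \<open>(u, v) \<in> D\<close> by (auto simp: D_def)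
    then show ?thesis
    proof cases
      case 1
      then show ?thesis using disj hub_in_hubs by (auto simp: D1_def rank_def)
    next
      case 2
      then obtain i j l where "u = vnode l (\<phi> l)" "v = hub (i, j)" "(i, j) \<in> set (pairs C)" "l \<in> {i, j}"
        by (auto simp: D2_def)
      then show ?thesis using disj hub_in_hubs(2) pairs_C[of i j] by (auto simp: rank_def)
    next
      case 3
      then show ?thesis using disj hubs by (auto simp: D3_def rank_def)
    next
      case 4
      then show ?thesis using D4[OF 4] r by (auto simp: D4_def rank_def)
    qed
  qed
  then have "D \<subseteq> measure rank" by auto
  then have "acyclic D" by (meson wf_acyclic wf_measure wf_subset)
  with parts have "dag N D" by (simp add: dag_def)
  have D4_only: "(u, hub p) \<notin> D4" "(u, vnode i w) \<notin> D4" for u p i w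
    using D4(2)[of u "hub p"] D4(2)[of u "vnode i w"] by (auto simp: set_gnodes)
  have diag_val: "f (hub (i, i)) (parents D (hub (i, i))) = 2" if i: "i \<in> set C" for i
  proof -
    have "(u, hub (i, i)) \<in> D \<longleftrightarrow> u = vnode i (\<phi> i)" for u
      using i pairs_irrefl[OF distinct_C] D4_only by (auto simp: D_def D1_def D2_def D3_def)
    then have "parents D (hub (i, i)) = set [vnode i (\<phi> i)]" by (auto simp: parents_def)
    then show ?thesis using f_entry[OF entry_mem(1)[OF i \<phi>vs[OF i]]] by simp
  qed
  have pair_val: "f (hub p) (parents D (hub p)) = 1" if "p \<in> set (pairs C)" for p
  proof -
    obtain i j where p: "p = (i, j)" by force
    then have ij: "(i, j) \<in> set (pairs C)" using that by simp
    have "(u, hub (i, j)) \<in> D \<longleftrightarrow> u = vnode i (\<phi> i) \<or> u = vnode j (\<phi> j)" for u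
      using ij pairs_C[OF ij] D4_only by (auto simp: D_def D1_def D2_def D3_def)
    then have "parents D (hub p) = set [vnode i (\<phi> i), vnode j (\<phi> j)]" by (auto simp: parents_def p)
    then show ?thesis using f_entry[OF entry_mem(2)[OF ij \<phi>edge[OF ij]]] p by simp
  qed
  have vnode_val: "real (length vs) - 1 \<le> (\<Sum>w\<in>set vs. f (vnode i w) (parents D (vnode i w)))"
    if i: "i \<in> set C" for i
  proof -
    have "f (vnode i w) (parents D (vnode i w)) = 1" if w: "w \<in> set vs - {\<phi> i}" for w
    proof -
      have "(u, vnode i w) \<in> D \<longleftrightarrow> u \<in> set (hubs C)" for u
        using i w D4_only by (auto simp: D_def D1_def D2_def D3_def)
      then have "parents D (vnode i w) = set (hubs C)" by (auto simp: parents_def)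
      then show ?thesis using f_entry[OF entry_mem(3)[OF i, of w]] w by simp
    qed
    then have "(\<Sum>w\<in>set vs - {\<phi> i}. f (vnode i w) (parents D (vnode i w))) = real (card (set vs - {\<phi> i}))"
      by simp
    also have "\<dots> = real (length vs) - 1"
    proof -
      have "Suc (card (set vs - {\<phi> i})) = length vs"
        using card_Suc_Diff1[of "set vs" "\<phi> i"] \<phi>vs[OF i] distinct_card[OF distinct_vs] by simp
      then show ?thesis by linarith
    qed
    finally have "(\<Sum>w\<in>set vs - {\<phi> i}. f (vnode i w) (parents D (vnode i w))) = real (length vs) - 1" .
    moreover have "0 \<le> f v P" for v P by (rule table_score_nonneg) (simp add: entry_valid)
    ultimately show ?thesis
      using sum_mono2[of "set vs" "set vs - {\<phi> i}" "\<lambda>w. f (vnode i w) (parents D (vnode i w))"] by auto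
  qed
  have gnode_val: "f v (parents D v) = 1" if v: "v \<in> set (gnodes C)" for v
  proof -
    obtain s where s: "s \<in> set (suffixes (gnodes C))" "hd s = v" using suffixes_hd_surj[OF v] by blast
    have not: "v \<noteq> hub p" "v \<noteq> vnode i w" for p i w using v by (auto simp: set_gnodes)
    have "(u, v) \<in> D \<longleftrightarrow> (u, v) \<in> D4" for u
      using not by (auto simp: D_def D1_def D2_def D3_def)
    moreover have "(u, v) \<in> D4 \<longleftrightarrow> u \<in> set (tl s)" for u
    proof
      assume "(u, v) \<in> D4"
      then obtain t where "t \<in> set (suffixes (gnodes C))" "hd t = v" "u \<in> set (tl t)" by (auto simp: D4_def)
      then show "u \<in> set (tl s)" using suffixes_hd_inj[OF distinct_gnodes s(1), of t] s(2) by simp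
    qed (use s in \<open>auto simp: D4_def\<close>)
    ultimately have "parents D v = set (tl s)" by (auto simp: parents_def)
    then show ?thesis using f_entry[OF entry_mem(4)[OF s(1)]] s(2) by simp
  qed
  have "real (length vs) + 1 \<le>
    f (hub (i, i)) (parents D (hub (i, i))) + (\<Sum>w\<in>set vs. f (vnode i w) (parents D (vnode i w)))"
    if "i \<in> set C" for i
    using diag_val[OF that] vnode_val[OF that] by linarith
  then have "real (length (nodes vs C)) \<le> score N f D"
    unfolding score_split card_nodes
    by (intro add_mono[OF add_mono] sum_mono) (simp_all only: pair_val gnode_val order_refl)
  then show ?thesis using \<open>dag N D\<close> by (auto simp: exact_BNSL_def)
qed

section \<open>From a dag to a clique\<close>

lemma clique_of_exact_BNSL:
  assumes "exact_BNSL N f (length (nodes vs C))"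
  shows "has_clique (set vs) edges (length C)"
proof -
  obtain D where dag: "dag N D" and score: "real (length (nodes vs C)) \<le> score N f D"
    using assms by (auto simp: exact_BNSL_def)
  define g where "g v = f v (parents D v)" for v
  \<comment> \<open>The only cycles that have to be excluded here consist of a hub and a vertex node
    that are parents of each other.\<close>
  have no_2cycle: False if "(u, v) \<in> D" "(v, u) \<in> D" for u v
    using dag that unfolding dag_def acyclic_def by (meson trancl.intros)
  have lost: "g (vnode i u) = 0" if "h \<in> set (hubs C)" "vnode i u \<in> parents D h" for h i u
    using f_vnode_cases[of i u "parents D (vnode i u)"]
  proof cases
    case 2
    then have "(h, vnode i u) \<in> D" "(vnode i u, h) \<in> D" using that by (auto simp: parents_def)
    then show ?thesis using no_2cycle by blast
  qed (simp add: g_def)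
  have vnode_le: "g (vnode i w) \<le> 1" for i w
    using f_vnode_cases[of i w "parents D (vnode i w)"] by cases (simp_all add: g_def)
  have finite_sum: "(\<Sum>w\<in>set vs. g (vnode i w)) \<le> real (length vs)" for i
    using sum_mono[of "set vs" "\<lambda>w. g (vnode i w)" "\<lambda>_. 1"] vnode_le distinct_card[OF distinct_vs] by simp
  define a where "a i = g (hub (i, i)) + (\<Sum>w\<in>set vs. g (vnode i w))" for i
  have sum_remove: "(\<Sum>w\<in>set vs. g (vnode i w)) = (\<Sum>w\<in>set vs - {u}. g (vnode i w))"
    "real (card (set vs - {u})) = real (length vs) - 1"
    if "i \<in> set C" "parents D (hub (i, i)) = {vnode i u}" "u \<in> set vs" for i u
  proof -
    have "g (vnode i u) = 0" using lost[of "hub (i, i)" i u] that hub_in_hubs by auto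
    then show "(\<Sum>w\<in>set vs. g (vnode i w)) = (\<Sum>w\<in>set vs - {u}. g (vnode i w))"
      using that(3) by (simp add: sum.remove)
    have "Suc (card (set vs - {u})) = length vs"
      using card_Suc_Diff1[of "set vs" u] that(3) distinct_card[OF distinct_vs] by simp
    then show "real (card (set vs - {u})) = real (length vs) - 1" by linarith
  qed
  \<comment> \<open>Either the hub scores 0 and the vertex nodes at most 1 each, or it scores 2 and
    the selected vertex node scores nothing.\<close>
  have a_le: "a i \<le> real (length vs) + 1" if i: "i \<in> set C" for i
    using f_diag_cases[of i "parents D (hub (i, i))"]
  proof cases
    case 1
    then show ?thesis using finite_sum[of i] by (simp add: a_def g_def)
  next
    case (2 u)
    have "(\<Sum>w\<in>set vs - {u}. g (vnode i w)) \<le> real (length vs) - 1"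
      using sum_mono[of "set vs - {u}" "\<lambda>w. g (vnode i w)" "\<lambda>_. 1"] vnode_le sum_remove(2)[OF i 2(2,1)] by simp
    then show ?thesis using sum_remove(1)[OF i 2(2,1)] 2(3) by (simp add: a_def g_def)
  qed
  have pair_le: "g (hub p) \<le> 1" if "p \<in> set (pairs C)" for p
  proof -
    obtain i j where p: "p = (i, j)" by force
    then have ij: "(i, j) \<in> set (pairs C)" using that by simp
    from f_pair_cases[OF ij, of "parents D (hub (i, j))"] show ?thesis
      by cases (simp_all add: g_def p)
  qed
  have gnode_le: "g v \<le> 1" if "v \<in> set (gnodes C)" for v
    using f_gnode_le[OF that] by (simp add: g_def)
  have total: "(\<Sum>i\<in>set C. real (length vs) + 1) + (\<Sum>p\<in>set (pairs C). 1) + (\<Sum>v\<in>set (gnodes C). 1)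
    \<le> (\<Sum>i\<in>set C. a i) + (\<Sum>p\<in>set (pairs C). g (hub p)) + (\<Sum>v\<in>set (gnodes C). g v)"
    using score unfolding score_split card_nodes by (simp only: a_def g_def)
  have sums: "(\<Sum>i\<in>set C. a i) \<le> (\<Sum>i\<in>set C. real (length vs) + 1)"
    "(\<Sum>p\<in>set (pairs C). g (hub p)) \<le> (\<Sum>p\<in>set (pairs C). 1)"
    "(\<Sum>v\<in>set (gnodes C). g v) \<le> (\<Sum>v\<in>set (gnodes C). 1)"
    by (intro sum_mono a_le pair_le gnode_le; assumption)+
  \<comment> \<open>The threshold is the sum of all upper bounds, so each of them is
    attained.\<close>
  have a_eq: "a i = real (length vs) + 1" if i: "i \<in> set C" for i
    by (rule sum_mono_inv[of a "set C" "\<lambda>_. real (length vs) + 1"]) (use total sums a_le i in auto)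
  have pair_eq: "g (hub p) = 1" if p: "p \<in> set (pairs C)" for p
    by (rule sum_mono_inv[of "\<lambda>p. g (hub p)" "set (pairs C)" "\<lambda>_. 1"]) (use total sums pair_le p in auto)
  \<comment> \<open>A colour without a selection stays one below its bound. With the selection
    \<open>u\<close>, tightness leaves no other vertex node of that colour without its
    point.\<close>
  have "\<exists>u. u \<in> set vs \<and> (\<forall>w\<in>set vs. g (vnode i w) = 0 \<longrightarrow> w = u)" if i: "i \<in> set C" for i
    using f_diag_cases[of i "parents D (hub (i, i))"]
  proof cases
    case 1
    then show ?thesis using finite_sum[of i] a_eq[OF i] by (simp add: a_def g_def)
  next
    case (2 u)
    have "(\<Sum>w\<in>set vs - {u}. g (vnode i w)) = (\<Sum>w\<in>set vs - {u}. 1)"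
      using sum_remove[OF i 2(2,1)] a_eq[OF i] 2(3) by (simp add: a_def g_def)
    then have "g (vnode i w) = 1" if "w \<in> set vs - {u}" for w
      by (rule sum_mono_inv) (use vnode_le that in auto)
    then show ?thesis using 2(1) by (intro exI[of _ u]) force
  qed
  then obtain \<phi> where \<phi>: "\<And>i. i \<in> set C \<Longrightarrow> \<phi> i \<in> set vs"
    "\<And>i w. i \<in> set C \<Longrightarrow> w \<in> set vs \<Longrightarrow> g (vnode i w) = 0 \<Longrightarrow> w = \<phi> i" by metis
  have edge: "(\<phi> i, \<phi> j) \<in> set (orientations es)" if ij: "(i, j) \<in> set (pairs C)" for i j
    using f_pair_cases[OF ij, of "parents D (hub (i, j))"]
  proof cases
    case 1
    then show ?thesis using pair_eq[OF ij] by (simp add: g_def)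
  next
    case (2 u v)
    \<comment> \<open>Vertex nodes selected by a pair hub lose their point too. As each colour has
      at most one such node, pair hubs and diagonal hubs select the same vertices.\<close>
    have "g (vnode i u) = 0" "g (vnode j v) = 0"
      using lost[OF hub_in_hubs(2)[OF ij]] 2(2) by auto
    then have "u = \<phi> i" "v = \<phi> j"
      using \<phi>(2) pairs_C[OF ij] orientations_vertices[OF 2(1)] by auto
    then show ?thesis using 2(1) by simp
  qed
  have distinct_edge: "\<phi> i \<noteq> \<phi> j \<and> {\<phi> i, \<phi> j} \<in> edges" if "i \<in> set C" "j \<in> set C" "i \<noteq> j" for i j
    using pairs_total[OF that]
  proof
    assume "(i, j) \<in> set (pairs C)"
    from edge[OF this] show ?thesis using orientations_vertices orientations_iff by blast
  next
    assume "(j, i) \<in> set (pairs C)"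
    from edge[OF this] show ?thesis using orientations_vertices orientations_iff by (metis insert_commute)
  qed
  then have "inj_on \<phi> (set C)" by (auto simp: inj_on_def)
  then have "card (\<phi> ` set C) = length C" using distinct_card[OF distinct_C] by (simp add: card_image)
  then show ?thesis
    using \<phi>(1) distinct_edge unfolding has_clique_def by (intro exI[of _ "\<phi> ` set C"]) auto
qed

end

section \<open>Composition with a polynomial-time reduction\<close>

lemma inj_enc_nat: "inj enc_nat"
  by (simp add: inj_def enc_nat_eq_iff)

lemma inj_enc_instance: "inj enc_instance"
  by (auto simp: inj_def enc_nat_eq_iff)

lemma computable_of_computes_on:
  assumes "computes_on (range enc_nat) F T" "\<And>n. F (enc_nat n) = enc_nat (g n)"
  shows "computable g"
proof -
  obtain p where p: "\<And>x. x \<in> range enc_nat \<Longrightarrow> \<exists>t\<le>T x. computes_in p x (F x) t"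
    using computes_in_of_computes_on[OF assms(1)] by blast
  have "\<exists>t. computes_in p (enc_nat n) (enc_nat (g n)) t" for n
    using p[of "enc_nat n"] assms(2) by auto
  then show ?thesis unfolding computable_def by blast
qed

text \<open>Computability comes without a time bound; some actual running time, chosen for each
  input, serves as \<open>T\<close>.\<close>

lemma computes_on_of_computable:
  assumes "computable g"
  shows "\<exists>F T. computes_on (range enc_nat) F T \<and> (\<forall>n. F (enc_nat n) = enc_nat (g n))"
proof -
  obtain p where p: "\<And>n. \<exists>t. computes_in p (enc_nat n) (enc_nat (g n)) t"
    using assms unfolding computable_def by blast
  define F where "F x = enc_nat (g (inv enc_nat x))" for x
  define T where "T x = (SOME t. computes_in p x (F x) t)" for x
  have F: "F (enc_nat n) = enc_nat (g n)" for n by (simp add: F_def inj_enc_nat)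
  have "\<exists>t\<le>T x. computes_in p x (F x) t" if x: "x \<in> range enc_nat" for x
  proof -
    have "\<exists>t. computes_in p x (F x) t" using p F x by auto
    then have "computes_in p x (F x) (T x)" unfolding T_def by (rule someI_ex)
    then show ?thesis by blast
  qed
  from computes_on_of_computes_in[OF this] show ?thesis using F by blast
qed

lemma computable_const: "computable (\<lambda>_. c)"
proof -
  obtain T where "computes_on UNIV (\<lambda>_. enc_nat c) T" using ptime_const by (rule ptimeE)
  then have "computes_on (range enc_nat) (\<lambda>_. enc_nat c) T" by (rule computes_on_cong) auto
  then show ?thesis by (rule computable_of_computes_on) simp
qed

lemma computable_pair:
  assumes "computable g" "computable h"
  shows "computable (\<lambda>n. pair (g n) (h n))"
proof -
  obtain F T where F: "computes_on (range enc_nat) F T" "\<And>n. F (enc_nat n) = enc_nat (g n)"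
    using computes_on_of_computable[OF assms(1)] by blast
  obtain G U where G: "computes_on (range enc_nat) G U" "\<And>n. G (enc_nat n) = enc_nat (h n)"
    using computes_on_of_computable[OF assms(2)] by blast
  have "ptime (\<lambda>y. tpair (left y) (right y))" by (intro ptime_intros)
  then obtain S where S: "computes_on UNIV (\<lambda>y. tpair (left y) (right y)) S" by (rule ptimeE)
  show ?thesis
    by (rule computable_of_computes_on[OF computes_on_comp[OF computes_on_pair[OF F(1) G(1)] S]])
      (simp_all add: F G tpair_enc_nat)
qed

text \<open>The functions in an fpt-reduction act only as upper bounds, so closure under arithmetic
  is needed only up to a larger computable function.\<close>

definition dominated :: "(nat \<Rightarrow> nat) \<Rightarrow> bool" where
  "dominated \<phi> \<longleftrightarrow> (\<exists>g. computable g \<and> (\<forall>n. \<phi> n \<le> g n))"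

lemma dominated_computable: "computable g \<Longrightarrow> dominated g"
  by (auto simp: dominated_def)

lemma dominated_const: "dominated (\<lambda>_. c)"
  by (rule dominated_computable[OF computable_const])

text \<open>Computable bounds are combined by the pairing function, so that no arithmetic has to be
  programmed.\<close>

lemma dominated_add_mult:
  assumes "dominated \<phi>" "dominated \<psi>"
  shows "dominated (\<lambda>n. \<phi> n + \<psi> n)" "dominated (\<lambda>n. \<phi> n * \<psi> n)"
proof -
  obtain g h where gh: "computable g" "\<And>n. \<phi> n \<le> g n" "computable h" "\<And>n. \<psi> n \<le> h n"
    using assms unfolding dominated_def by blast
  have *: "(\<phi> n + 1) * (\<psi> n + 1) \<le> pair (g n) (h n)" for n
    using gh(2,4)[of n] pair_ge[of "g n" "h n"] by (meson add_le_mono1 le_trans mult_le_mono)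
  have "\<phi> n + \<psi> n \<le> pair (g n) (h n)" "\<phi> n * \<psi> n \<le> pair (g n) (h n)" for n
    using *[of n] by simp_all
  then show "dominated (\<lambda>n. \<phi> n + \<psi> n)" "dominated (\<lambda>n. \<phi> n * \<psi> n)"
    using computable_pair[OF gh(1,3)] unfolding dominated_def by blast+
qed

lemma dominated_power: "dominated \<phi> \<Longrightarrow> dominated (\<lambda>n. \<phi> n ^ d)"
  by (induction d) (auto intro: dominated_const dominated_add_mult)

lemmas dominated_intros = dominated_add_mult dominated_power dominated_const dominated_computable

text \<open>Here \<open>H\<close> stands for the value of the first reduction's bound at the
  parameter, \<open>U\<close> for the time of that stage including its setup, and
  \<open>n + U\<close> for the size of its output, on which the second stage takes time polynomial
  with exponent \<open>d\<close>.\<close>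

lemma fpt_time_composition:
  fixes n :: nat
  assumes n: "1 \<le> n" and U: "U = n + m + H * n ^ c" and t: "t \<le> U + (n + U + 2) ^ d"
  shows "t \<le> ((4 + m + H) + (4 + m + H) ^ d) * n ^ ((c + 1) * (d + 1))"
proof -
  \<comment> \<open>In \<open>n + U + 2 = 2 * n + 2 + m + H * n ^ c\<close> the first two terms are
    at most \<open>4 * ?M\<close>. The factor \<open>?A\<close> contains no \<open>n\<close>, so the
    dependence on the parameter separates.\<close>
  let ?A = "4 + m + H" and ?M = "n ^ (c + 1)"
  have M: "1 \<le> ?M" "n \<le> ?M" using n by simp_all
  have "H * n ^ c \<le> H * ?M" using n by simp
  moreover have "m \<le> m * ?M" "2 \<le> 2 * ?M" using M by simp_all
  ultimately have "n + U + 2 \<le> ?M + ?M + 2 * ?M + m * ?M + H * ?M" unfolding U using M(2) by linarith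
  then have le: "n + U + 2 \<le> ?A * ?M" by (simp add: algebra_simps)
  have "(?A * ?M) ^ d = ?A ^ d * n ^ ((c + 1) * d)" by (simp only: power_mult_distrib power_mult)
  also have "\<dots> \<le> ?A ^ d * n ^ ((c + 1) * (d + 1))" using n by (intro mult_left_mono power_increasing) auto
  finally have "(n + U + 2) ^ d \<le> ?A ^ d * n ^ ((c + 1) * (d + 1))"
    using power_mono[OF le, of d] by simp
  moreover have "?A * ?M \<le> ?A * n ^ ((c + 1) * (d + 1))"
    using n by (intro mult_left_mono power_increasing) auto
  ultimately show ?thesis using t le by (simp add: algebra_simps)
qed

text \<open>Composition of an arbitrary fpt-reduction with a polynomial-time one. The second is
  measured against the whole encoded instance, parameter included, and its parameter bound must be
  polynomial so that a computable bound for the composite follows.\<close>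

lemma fpt_reducible_trans_poly:
  assumes red: "fpt_reducible L L1"
    and F: "ptime F" "\<And>a. a \<in> instances L1 \<Longrightarrow> F (enc_instance a) = enc_instance (R a)"
    and R: "\<And>a. a \<in> instances L1 \<Longrightarrow> R a \<in> instances L2 \<and> (a \<in> yes_instances L1 \<longleftrightarrow> R a \<in> yes_instances L2)"
    and param: "\<And>a. a \<in> instances L1 \<Longrightarrow> snd (R a) \<le> (snd a + 2) ^ e"
  shows "fpt_reducible L L2"
proof -
  obtain Q g p h c where
    Q: "\<And>a. a \<in> instances L \<Longrightarrow> Q a \<in> instances L1 \<and> (a \<in> yes_instances L \<longleftrightarrow> Q a \<in> yes_instances L1)"
    and g: "computable g" "\<And>a. a \<in> instances L \<Longrightarrow> snd (Q a) \<le> g (snd a)"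
    and h: "computable h"
    and p: "\<And>a. a \<in> instances L \<Longrightarrow> \<exists>t. computes_in p (enc_instance a) (enc_instance (Q a)) t \<and>
         t \<le> h (snd a) * size (enc_instance a) ^ c"
    using red unfolding fpt_reducible_def fpt_reduction_def by metis
  define X where "X = enc_instance ` instances L"
  define G where "G x = enc_instance (Q (inv enc_instance x))" for x
  define T where "T x = h (snd (inv enc_instance x)) * size x ^ c" for x
  have inv: "inv enc_instance (enc_instance a) = a" for a by (simp add: inj_enc_instance)
  have "\<exists>t\<le>T x. computes_in p x (G x) t" if "x \<in> X" for x
    using that p unfolding X_def G_def T_def by (metis (no_types, lifting) image_iff inv)
  from computes_on_of_computes_in[OF this] obtain m where
    G: "computes_on X G (\<lambda>x. size x + m + T x)" by blast
  obtain T2 where T2: "computes_on UNIV F T2" "pbounded T2" using F(1) by (rule ptimeE)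
  then obtain d where d: "T2 x \<le> (size x + 2) ^ d" for x unfolding pbounded_def by blast
  have comp: "computes_on X (\<lambda>x. F (G x)) (\<lambda>x. (size x + m + T x) + T2 (G x))"
    by (rule computes_on_comp[OF G T2(1)]) simp
  obtain r where r: "\<And>x. x \<in> X \<Longrightarrow> \<exists>t\<le>(size x + m + T x) + T2 (G x). computes_in r x (F (G x)) t"
    using computes_in_of_computes_on[OF comp] by blast
  let ?A = "\<lambda>k. 4 + m + h k"
  have "dominated (\<lambda>k. ?A k + ?A k ^ d)" by (intro dominated_intros h)
  then obtain h' where h': "computable h'" "\<And>k. ?A k + ?A k ^ d \<le> h' k" unfolding dominated_def by blast
  have "dominated (\<lambda>k. (g k + 2) ^ e)" by (intro dominated_intros g)
  then obtain g' where g': "computable g'" "\<And>k. (g k + 2) ^ e \<le> g' k" unfolding dominated_def by blast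
  have time: "\<exists>t. computes_in r (enc_instance a) (enc_instance (R (Q a))) t \<and>
      t \<le> h' (snd a) * size (enc_instance a) ^ ((c + 1) * (d + 1))" if a: "a \<in> instances L" for a
  proof -
    let ?x = "enc_instance a"
    let ?U = "size ?x + m + h (snd a) * size ?x ^ c"
    have x: "?x \<in> X" using a by (auto simp: X_def)
    have U: "size ?x + m + T ?x = ?U" by (simp add: T_def inv)
    obtain t where t: "t \<le> ?U + T2 (G ?x)" "computes_in r ?x (F (G ?x)) t"
      using r[OF x] unfolding U by blast
    \<comment> \<open>The intermediate instance is bounded by the input and the time spent on it, so
      the second stage is polynomial in a quantity that is already fpt-bounded.\<close>
    have "size (G ?x) \<le> size ?x + ?U" using computes_on_size[OF G x] unfolding U .
    then have "T2 (G ?x) \<le> (size ?x + ?U + 2) ^ d"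
      using d[of "G ?x"] by (meson add_le_mono1 le_trans power_mono zero_le)
    then have "t \<le> ?U + (size ?x + ?U + 2) ^ d" using t(1) by linarith
    moreover have "1 \<le> size ?x" by (cases a) simp
    ultimately have "t \<le> (?A (snd a) + ?A (snd a) ^ d) * size ?x ^ ((c + 1) * (d + 1))"
      using fpt_time_composition by blast
    also have "\<dots> \<le> h' (snd a) * size ?x ^ ((c + 1) * (d + 1))" using h'(2) by (intro mult_right_mono) auto
    finally have "t \<le> h' (snd a) * size ?x ^ ((c + 1) * (d + 1))" .
    moreover have "F (G ?x) = enc_instance (R (Q a))" using F(2) Q[OF a] by (simp add: G_def inv)
    ultimately show ?thesis using t(2) by auto
  qed
  have "snd (R (Q a)) \<le> g' (snd a)" if a: "a \<in> instances L" for a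
  proof -
    have "snd (R (Q a)) \<le> (snd (Q a) + 2) ^ e" using param Q[OF a] by blast
    also have "\<dots> \<le> (g (snd a) + 2) ^ e" using g(2)[OF a] by (intro power_mono) auto
    also have "\<dots> \<le> g' (snd a)" by (rule g')
    finally show ?thesis .
  qed
  then have "fpt_reduction L L2 (\<lambda>a. R (Q a))"
    unfolding fpt_reduction_def using Q R g'(1) h'(1) time by blast
  then show ?thesis unfolding fpt_reducible_def by blast
qed

section \<open>The reduction as a polynomial-time function\<close>

text \<open>The factor 4 and the residue in a node name are its two lowest binary digits, put in
  front of the digits of the pair.\<close>

definition thub :: "tree \<Rightarrow> tree" where "thub p = Node Tip (Node Tip (tpair (left p) (right p)))"
definition tvnode :: "tree \<Rightarrow> tree \<Rightarrow> tree" where "tvnode i w = Node one (Node Tip (tpair i w))"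
definition tgnode :: "tree \<Rightarrow> tree" where "tgnode p = Node Tip (Node one (tpair (left p) (right p)))"

definition tcolours :: "tree \<Rightarrow> tree" where
  "tcolours x = ttake (right x) (Node Tip (tmap (\<lambda>v. Node one v) (left (left x))))"

definition tpairs :: "tree \<Rightarrow> tree" where
  "tpairs l = tconcat (tmap (\<lambda>s. tmap (\<lambda>b. Node (left s) b) (right s)) (tsuffixes l))"

definition thub_pairs :: "tree \<Rightarrow> tree" where
  "thub_pairs x = tapp (tmap (\<lambda>i. Node i i) (tcolours x)) (tpairs (tcolours x))"

definition thubs :: "tree \<Rightarrow> tree" where "thubs x = tmap thub (thub_pairs x)"

definition tvnodes :: "tree \<Rightarrow> tree" where
  "tvnodes x = tconcat (tmap (\<lambda>i. tmap (\<lambda>w. tvnode i w) (left (left x))) (tcolours x))"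

definition tgnodes :: "tree \<Rightarrow> tree" where
  "tgnodes x = Node (enc_nat 3) (tmap tgnode (thub_pairs x))"

definition tnodes :: "tree \<Rightarrow> tree" where
  "tnodes x = tapp (thubs x) (tapp (tvnodes x) (tgnodes x))"

definition torientations :: "tree \<Rightarrow> tree" where
  "torientations l = tapp l (tmap (\<lambda>e. Node (right e) (left e)) l)"

definition tdiag_entries :: "tree \<Rightarrow> tree" where
  "tdiag_entries x = tconcat (tmap (\<lambda>i. tmap (\<lambda>u.
     Node (thub (Node i i)) (Node (Node (tvnode i u) Tip) (enc_rat 2))) (left (left x))) (tcolours x))"

definition tpair_entries :: "tree \<Rightarrow> tree" where
  "tpair_entries x = tconcat (tmap (\<lambda>p. tmap (\<lambda>e. Node (thub p)
     (Node (Node (tvnode (left p) (left e)) (Node (tvnode (right p) (right e)) Tip)) (enc_rat 1)))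
     (torientations (right (left x)))) (tpairs (tcolours x)))"

definition tvnode_entries :: "tree \<Rightarrow> tree" where
  "tvnode_entries x = tmap (\<lambda>v. Node v (Node (thubs x) (enc_rat 1))) (tvnodes x)"

definition tgnode_entries :: "tree \<Rightarrow> tree" where
  "tgnode_entries x = tmap (\<lambda>s. Node (left s) (Node (right s) (enc_rat 1))) (tsuffixes (tgnodes x))"

definition tentries :: "tree \<Rightarrow> tree" where
  "tentries x = tapp (tdiag_entries x) (tapp (tpair_entries x) (tapp (tvnode_entries x) (tgnode_entries x)))"

text \<open>The threshold is the number of nodes, as a rational with denominator 1; the new
  parameter is the number of hubs, the exact treewidth.\<close>

definition treduction :: "tree \<Rightarrow> tree" where
  "treduction x = Node (Node (tnodes x) (Node (tentries x) (Node (tlen (tnodes x)) (enc_nat 1))))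
     (tlen (thubs x))"

section \<open>Running time of the reduction\<close>

lemma ptime_nodes_basic:
  assumes "ptime f" "ptime g"
  shows "ptime (\<lambda>x. thub (f x))" "ptime (\<lambda>x. tvnode (f x) (g x))" "ptime (\<lambda>x. tgnode (f x))"
  unfolding thub_def tvnode_def tgnode_def by (intro ptime_intros assms)+

lemma ptime_tcolours: "ptime f \<Longrightarrow> ptime (\<lambda>x. tcolours (f x))"
  by (rule ptime_comp, assumption) (unfold tcolours_def, intro ptime_intros)

lemma ptime_tpairs: "ptime f \<Longrightarrow> ptime (\<lambda>x. tpairs (f x))"
  by (rule ptime_comp, assumption) (unfold tpairs_def, intro ptime_intros)

lemma ptime_thub_pairs: "ptime f \<Longrightarrow> ptime (\<lambda>x. thub_pairs (f x))"
  by (rule ptime_comp, assumption) (unfold thub_pairs_def, intro ptime_intros ptime_tcolours ptime_tpairs)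

lemma ptime_thubs: "ptime f \<Longrightarrow> ptime (\<lambda>x. thubs (f x))"
  by (rule ptime_comp, assumption) (unfold thubs_def, intro ptime_intros ptime_thub_pairs ptime_nodes_basic(1))

lemma ptime_tvnodes: "ptime f \<Longrightarrow> ptime (\<lambda>x. tvnodes (f x))"
  by (rule ptime_comp, assumption) (unfold tvnodes_def, intro ptime_intros ptime_tcolours ptime_nodes_basic(2))

lemma ptime_tgnodes: "ptime f \<Longrightarrow> ptime (\<lambda>x. tgnodes (f x))"
  by (rule ptime_comp, assumption) (unfold tgnodes_def, intro ptime_intros ptime_thub_pairs ptime_nodes_basic(3))

lemma ptime_tnodes: "ptime f \<Longrightarrow> ptime (\<lambda>x. tnodes (f x))"
  by (rule ptime_comp, assumption) (unfold tnodes_def, intro ptime_intros ptime_thubs ptime_tvnodes ptime_tgnodes)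

lemma ptime_torientations: "ptime f \<Longrightarrow> ptime (\<lambda>x. torientations (f x))"
  by (rule ptime_comp, assumption) (unfold torientations_def, intro ptime_intros)

lemma ptime_tentries: "ptime f \<Longrightarrow> ptime (\<lambda>x. tentries (f x))"
  by (rule ptime_comp, assumption)
    (unfold tentries_def tdiag_entries_def tpair_entries_def tvnode_entries_def tgnode_entries_def,
      intro ptime_intros ptime_tcolours ptime_tpairs ptime_thubs ptime_tvnodes ptime_tgnodes
      ptime_torientations ptime_nodes_basic(1,2))

lemma ptime_treduction: "ptime treduction"
  unfolding treduction_def[abs_def] by (intro ptime_intros ptime_tnodes ptime_tentries ptime_thubs)

section \<open>Agreement of tree functions and list functions on encoded inputs\<close>

definition enc_pair :: "nat \<times> nat \<Rightarrow> tree" where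
  "enc_pair p = Node (enc_nat (fst p)) (enc_nat (snd p))"

definition enc_entry :: "nat \<times> nat list \<times> rat \<Rightarrow> tree" where
  "enc_entry = (\<lambda>(v, P, r). Node (enc_nat v) (Node (enc_list enc_nat P) (enc_rat r)))"

text \<open>A prepended digit 0 doubles only positive numbers, since \<open>enc_nat 0\<close> has no
  digits and leading zeros are not allowed; \<open>pair_pos\<close> takes care of this.\<close>

lemma thub_enc: "thub (enc_pair p) = enc_nat (hub p)" "thub (Node (enc_nat i) (enc_nat j)) = enc_nat (hub (i, j))"
proof -
  have "hub p = 2 * (2 * pair (fst p) (snd p))" for p by (simp add: hub_def)
  then have "enc_nat (hub p) = Node Tip (Node Tip (enc_nat (pair (fst p) (snd p))))" for p
    by (simp only: enc_nat_double pair_pos nat_0_less_mult_iff zero_less_numeral simp_thms)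
  then show "thub (enc_pair p) = enc_nat (hub p)" "thub (Node (enc_nat i) (enc_nat j)) = enc_nat (hub (i, j))"
    by (simp_all add: thub_def enc_pair_def tpair_enc_nat)
qed

lemma tvnode_enc: "tvnode (enc_nat i) (enc_nat w) = enc_nat (vnode i w)"
proof -
  have "vnode i w = 2 * (2 * pair i w) + 1" by (simp add: vnode_def)
  then have "enc_nat (vnode i w) = Node one (Node Tip (enc_nat (pair i w)))"
    by (simp only: enc_nat_double enc_nat_Suc_double pair_pos)
  then show ?thesis by (simp add: tvnode_def tpair_enc_nat)
qed

lemma tgnode_enc: "tgnode (enc_pair p) = enc_nat (gnode p)"
proof -
  have "gnode p = 2 * (2 * pair (fst p) (snd p) + 1)" by (simp add: gnode_def)
  then have "enc_nat (gnode p) = Node Tip (enc_nat (2 * pair (fst p) (snd p) + 1))"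
    by (simp only: enc_nat_double)
  then have "enc_nat (gnode p) = Node Tip (Node one (enc_nat (pair (fst p) (snd p))))"
    by (simp only: enc_nat_Suc_double)
  then show ?thesis by (simp add: tgnode_def enc_pair_def tpair_enc_nat)
qed

lemma enc_suffix:
  assumes "s \<in> set (suffixes xs)"
  shows "left (enc_list e s) = e (hd s)" "right (enc_list e s) = enc_list e (tl s)"
  using set_suffixes(1)[OF assms] by (cases s; simp)+

lemma tpairs_enc: "tpairs (enc_list enc_nat xs) = enc_list enc_pair (pairs xs)"
proof -
  have "tmap (\<lambda>s. tmap (\<lambda>b. Node (left s) b) (right s)) (enc_list (enc_list enc_nat) (suffixes xs)) =
    enc_list (enc_list enc_pair) (map (\<lambda>s. map (\<lambda>b. (hd s, b)) (tl s)) (suffixes xs))"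
    by (intro tmap_enc_list) (auto simp: enc_suffix enc_pair_def intro!: tmap_enc_list)
  then show ?thesis by (simp add: tpairs_def pairs_def tsuffixes_enc_list tconcat_enc_list)
qed

context
  fixes vs :: "nat list" and es :: "(nat \<times> nat) list" and k :: nat and x :: tree and C :: "nat list"
  defines "x \<equiv> Node (Node (enc_list enc_nat vs) (enc_list enc_pair es)) (enc_nat k)"
    and "C \<equiv> colours vs k"
begin

lemma input_simps:
  "left (left x) = enc_list enc_nat vs" "right (left x) = enc_list enc_pair es" "right x = enc_nat k"
  by (simp_all add: x_def)

text \<open>Prepending the digit 1 to each vertex yields \<open>2 * v + 1\<close>. This gives as
  many distinct colours as vertices, all different from the extra colour 0, without any arithmetic;
  the reversal in \<open>colours\<close> is the one produced by \<open>ttake\<close>.\<close>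

lemma tcolours_enc: "tcolours x = enc_list enc_nat C"
proof -
  have "tmap (\<lambda>v. Node one v) (enc_list enc_nat vs) = enc_list enc_nat (map (\<lambda>v. 2 * v + 1) vs)"
    by (intro tmap_enc_list) (simp only: enc_nat_Suc_double)
  then have "Node Tip (tmap (\<lambda>v. Node one v) (enc_list enc_nat vs)) =
    enc_list enc_nat (0 # map (\<lambda>v. 2 * v + 1) vs)"
    by (simp add: enc_nat.simps[of 0])
  then show ?thesis by (simp only: tcolours_def input_simps ttake_enc C_def colours_def)
qed

lemma thub_pairs_enc: "thub_pairs x = enc_list enc_pair (hub_pairs C)"
proof -
  have "tmap (\<lambda>i. Node i i) (enc_list enc_nat C) = enc_list enc_pair (map (\<lambda>i. (i, i)) C)"
    by (intro tmap_enc_list) (simp add: enc_pair_def)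
  then show ?thesis by (simp add: thub_pairs_def tcolours_enc tpairs_enc tapp_enc_list hub_pairs_def)
qed

lemma thubs_enc: "thubs x = enc_list enc_nat (hubs C)"
  unfolding thubs_def thub_pairs_enc hubs_def by (intro tmap_enc_list thub_enc)

lemma tvnodes_enc: "tvnodes x = enc_list enc_nat (vnodes vs C)"
proof -
  have "tmap (\<lambda>i. tmap (\<lambda>w. tvnode i w) (enc_list enc_nat vs)) (enc_list enc_nat C) =
    enc_list (enc_list enc_nat) (map (\<lambda>i. map (vnode i) vs) C)"
    by (intro tmap_enc_list tvnode_enc)
  then show ?thesis by (simp add: tvnodes_def tcolours_enc input_simps tconcat_enc_list vnodes_def)
qed

lemma tgnodes_enc: "tgnodes x = enc_list enc_nat (gnodes C)"
proof -
  have "tmap tgnode (enc_list enc_pair (hub_pairs C)) = enc_list enc_nat (map gnode (hub_pairs C))"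
    by (intro tmap_enc_list tgnode_enc)
  then show ?thesis by (simp add: tgnodes_def thub_pairs_enc gnodes_def)
qed

lemma tnodes_enc: "tnodes x = enc_list enc_nat (nodes vs C)"
  by (simp add: tnodes_def nodes_def thubs_enc tvnodes_enc tgnodes_enc tapp_enc_list)

lemma torientations_enc: "torientations (enc_list enc_pair es) = enc_list enc_pair (orientations es)"
proof -
  have "tmap (\<lambda>e. Node (right e) (left e)) (enc_list enc_pair es) =
    enc_list enc_pair (map (\<lambda>e. (snd e, fst e)) es)"
    by (intro tmap_enc_list) (simp add: enc_pair_def)
  then show ?thesis by (simp add: torientations_def orientations_def tapp_enc_list)
qed

lemma tentries_enc: "tentries x = enc_list enc_entry (entries vs es C)"
proof -
  have "tmap (\<lambda>i. tmap (\<lambda>u. Node (thub (Node i i)) (Node (Node (tvnode i u) Tip) (enc_rat 2)))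
      (enc_list enc_nat vs)) (enc_list enc_nat C) =
    enc_list (enc_list enc_entry) (map (\<lambda>i. map (\<lambda>u. (hub (i, i), [vnode i u], 2)) vs) C)"
    by (intro tmap_enc_list) (simp add: enc_entry_def thub_enc tvnode_enc)
  then have diag: "tdiag_entries x = enc_list enc_entry (diag_entries vs C)"
    by (simp add: tdiag_entries_def tcolours_enc input_simps tconcat_enc_list diag_entries_def)
  have "tmap (\<lambda>p. tmap (\<lambda>e. Node (thub p)
     (Node (Node (tvnode (left p) (left e)) (Node (tvnode (right p) (right e)) Tip)) (enc_rat 1)))
     (enc_list enc_pair (orientations es))) (enc_list enc_pair (pairs C)) =
    enc_list (enc_list enc_entry) (map (\<lambda>p. map (\<lambda>e.
     (hub p, [vnode (fst p) (fst e), vnode (snd p) (snd e)], 1)) (orientations es)) (pairs C))"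
    by (intro tmap_enc_list) (simp add: enc_entry_def thub_enc, simp add: enc_pair_def tvnode_enc)
  then have pair: "tpair_entries x = enc_list enc_entry (pair_entries es C)"
    by (simp add: tpair_entries_def tcolours_enc tpairs_enc input_simps torientations_enc tconcat_enc_list
        pair_entries_def)
  have vnode: "tvnode_entries x = enc_list enc_entry (vnode_entries vs C)"
    unfolding tvnode_entries_def tvnodes_enc thubs_enc vnode_entries_def
    by (intro tmap_enc_list) (simp add: enc_entry_def)
  have "tgnode_entries x = enc_list enc_entry (gnode_entries C)"
    unfolding tgnode_entries_def tgnodes_enc tsuffixes_enc_list gnode_entries_def
    by (intro tmap_enc_list) (simp add: enc_entry_def enc_suffix)
  with diag pair vnode show ?thesis by (simp add: tentries_def entries_def tapp_enc_list)
qed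

lemma enc_rat_of_nat: "enc_rat (of_nat n) = Node (enc_nat n) (enc_nat 1)"
proof -
  have "quotient_of (of_int (int n)) = (int n, 1)" by (simp only: of_int_rat quotient_of_Fract) simp
  then show ?thesis by (simp add: enc_rat_def)
qed

lemma treduction_enc:
  "treduction x = Node (enc_BNSL (nodes vs C) (entries vs es C) (of_nat (length (nodes vs C))))
     (enc_nat (length (hubs C)))"
  by (simp add: treduction_def enc_BNSL_def tnodes_enc tentries_enc thubs_enc tlen_enc_list enc_rat_of_nat
      enc_entry_def)

end

section \<open>Correctness on encoded instances\<close>

lemma length_colours: "length (colours vs k) = min k (Suc (length vs))"
  by (simp add: colours_def)

lemma distinct_colours: "distinct vs \<Longrightarrow> distinct (colours vs k)"
  by (auto simp: colours_def distinct_map inj_on_def intro!: distinct_take)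

text \<open>A clique has at most \<open>card V\<close> vertices, so for larger \<open>k\<close>
  neither size is attained.\<close>

lemma has_clique_min:
  assumes "finite V"
  shows "has_clique V E (min k (Suc (card V))) \<longleftrightarrow> has_clique V E k"
proof -
  have "m \<le> card V" if "has_clique V E m" for m
    using that assms by (auto simp: has_clique_def intro: card_mono)
  from this[of k] this[of "Suc (card V)"] show ?thesis by (cases "k \<le> card V") (auto simp: min_def)
qed

lemma length_hubs_le: "length (hubs C) \<le> length C + length C * length C"
  using length_pairs_le[of C] by (simp add: hubs_def hub_pairs_def)

context clique_reduction
begin

lemma encodes_BNSL_nodes:
  "encodes_BNSL N f (length (nodes vs C)) (enc_BNSL (nodes vs C) (entries vs es C) (of_nat (length (nodes vs C))))"
  unfolding encodes_BNSL_def enc_BNSL_def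
  using distinct_nodes nonzero_representation_f
  by (intro exI[of _ "nodes vs C"] exI[of _ "entries vs es C"] exI[of _ "of_nat (length (nodes vs C))"]) simp

lemma length_nodes_pos: "0 < length (nodes vs C)"
  by (simp add: nodes_def gnodes_def)

lemma BNSL_instance:
  "(enc_BNSL (nodes vs C) (entries vs es C) (of_nat (length (nodes vs C))), length (hubs C)) \<in> instances BNSL_treewidth"
  using local_score_f encodes_BNSL_nodes treewidth_f length_nodes_pos
  by (auto simp: BNSL_treewidth_def intro!: exI[of _ N] exI[of _ f] exI[of _ "real (length (nodes vs C))"])

text \<open>A yes-instance may be witnessed by any decoding of the tree. Injectivity of the encoding
  fixes the nodes, the table and the threshold, and the table fixes the score function at all
  meaningful arguments, so every decoding is equivalent to the intended one.\<close>

lemma BNSL_yes_instance_iff: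
  "(enc_BNSL (nodes vs C) (entries vs es C) (of_nat (length (nodes vs C))), length (hubs C)) \<in> yes_instances BNSL_treewidth
    \<longleftrightarrow> has_clique (set vs) edges (length C)" (is "(?x, _) \<in> _ \<longleftrightarrow> _")
proof
  assume "has_clique (set vs) edges (length C)"
  then show "(?x, length (hubs C)) \<in> yes_instances BNSL_treewidth"
    using exact_BNSL_of_clique local_score_f encodes_BNSL_nodes treewidth_f length_nodes_pos
    by (auto simp: BNSL_treewidth_def intro!: exI[of _ N] exI[of _ f] exI[of _ "real (length (nodes vs C))"])
next
  assume "(?x, length (hubs C)) \<in> yes_instances BNSL_treewidth"
  then obtain N' f' s where yes: "local_score N' f'" "s > 0" "encodes_BNSL N' f' s ?x" "exact_BNSL N' f' s"
    by (auto simp: BNSL_treewidth_def)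
  from yes(3) obtain ns T q where T: "set ns = N'" "nonzero_representation N' f' T" "s = real_of_rat q"
    "?x = enc_BNSL ns T q"
    unfolding encodes_BNSL_def enc_BNSL_def by blast
  \<comment> \<open>Rationals are encoded injectively only when positive; for an arbitrary decoding
    this follows from its being a non-zero representation.\<close>
  have pos: "0 < r" if "(v, P, r) \<in> set T" for v P r
  proof -
    have "(v, set P, real_of_rat r) \<in> set (map (\<lambda>(v, P, q). (v, set P, real_of_rat q)) T)"
      using that by force
    then have "real_of_rat r > 0" using T(2) by (auto simp: nonzero_representation_def)
    then show ?thesis by simp
  qed
  have q: "0 < q" using yes(2) T(3) by simp
  have len: "(0 :: rat) < of_nat (length (nodes vs C))" using length_nodes_pos by simp
  have valid: "0 < r" if "(v, P, r) \<in> set (entries vs es C)" for v P r using entry_valid[OF that] by blast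
  have eqs: "nodes vs C = ns" "entries vs es C = T" "of_nat (length (nodes vs C)) = q"
    by (rule enc_BNSL_inj[OF T(4) len q valid pos]; assumption)+
  have N: "N' = N" using T(1) eqs(1) by simp
  have s: "s = real (length (nodes vs C))" using T(3) eqs(3) by (metis of_rat_of_nat_eq)
  have "f' v P = f v P" if "v \<in> N" "P \<subseteq> N - {v}" for v P
    by (rule nonzero_representation_unique[OF _ nonzero_representation_f _ local_score_f that])
      (use yes(1) T(2) N eqs(2) in simp_all)
  then have "exact_BNSL N f s" using yes(4) exact_BNSL_cong[of N f' f] N by blast
  then show "has_clique (set vs) edges (length C)" using clique_of_exact_BNSL s by simp
qed

end

text \<open>The pair is read back from the output tree, which gives a function on instances without
  choosing the vertex and edge lists behind the input.\<close>

definition reduction :: "tree \<times> nat \<Rightarrow> tree \<times> nat" where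
  "reduction a = (left (treduction (enc_instance a)), inv enc_nat (right (treduction (enc_instance a))))"

lemma reduction_correct:
  assumes "a \<in> instances Clique"
  shows "treduction (enc_instance a) = enc_instance (reduction a)"
    and "reduction a \<in> instances BNSL_treewidth"
    and "a \<in> yes_instances Clique \<longleftrightarrow> reduction a \<in> yes_instances BNSL_treewidth"
    and "snd (reduction a) \<le> (snd a + 2) ^ 2"
proof -
  obtain x k where a: "a = (x, k)" by force
  \<comment> \<open>Stated for every graph encoded by \<open>x\<close>, because yes-instances
    quantify over such graphs; the argument then does not depend on \<open>x\<close> determining its
    graph.\<close>
  have reduce: "treduction (enc_instance a) = enc_instance (reduction a) \<and>
    reduction a \<in> instances BNSL_treewidth \<and>
    (reduction a \<in> yes_instances BNSL_treewidth \<longleftrightarrow> has_clique V E k) \<and>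
    snd (reduction a) \<le> (k + 2) ^ 2"
    if graph: "simple_graph V E" "encodes_graph V E x" for V E
  proof -
    obtain vs es where vs: "distinct vs" "set vs = V"
      and es: "distinct (map (\<lambda>(u, v). {u, v}) es)" "set (map (\<lambda>(u, v). {u, v}) es) = E"
      and x: "x = Node (enc_list enc_nat vs) (enc_list (\<lambda>(u, v). Node (enc_nat u) (enc_nat v)) es)"
      using graph(2) unfolding encodes_graph_def by blast
    let ?C = "colours vs k"
    interpret clique_reduction vs es ?C
    proof
      fix u v assume "(u, v) \<in> set es"
      then have "{u, v} \<in> E" using es(2) by force
      then show "u \<in> set vs \<and> v \<in> set vs \<and> u \<noteq> v" using edge_vertices[OF graph(1)] vs(2) by blast
    qed (use vs(1) es(1) distinct_colours in auto)
    let ?n = "length (nodes vs ?C)"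
    let ?y = "enc_BNSL (nodes vs ?C) (entries vs es ?C) (of_nat ?n)"
    have "(\<lambda>(u, v). Node (enc_nat u) (enc_nat v)) = enc_pair" by (auto simp: enc_pair_def)
    then have "treduction (enc_instance a) = Node ?y (enc_nat (length (hubs ?C)))"
      by (simp add: a x treduction_enc)
    moreover from this have red: "reduction a = (?y, length (hubs ?C))"
      by (simp add: reduction_def inj_enc_nat)
    moreover have "has_clique V E (length ?C) \<longleftrightarrow> has_clique V E k"
      using has_clique_min[of V E k] distinct_card[OF vs(1)] vs(2)
      by (auto simp: length_colours)
    moreover have "edges = E" unfolding edges_def by (rule es(2))
    moreover have "length (hubs ?C) \<le> (k + 2) ^ 2"
    proof -
      have "length ?C \<le> k" by (simp add: length_colours)
      then have "length ?C + length ?C * length ?C \<le> k + k * k" by (intro add_mono mult_mono) auto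
      also have "\<dots> \<le> (k + 2) ^ 2" by (simp add: power2_eq_square)
      finally show ?thesis using length_hubs_le[of ?C] by linarith
    qed
    ultimately show ?thesis using BNSL_instance BNSL_yes_instance_iff vs(2) by simp
  qed
  obtain V E where graph: "simple_graph V E" "encodes_graph V E x"
    using assms by (auto simp: Clique_def a)
  from reduce[OF this] show "treduction (enc_instance a) = enc_instance (reduction a)"
    "reduction a \<in> instances BNSL_treewidth" "snd (reduction a) \<le> (snd a + 2) ^ 2" by (auto simp: a)
  have "a \<in> yes_instances Clique \<longleftrightarrow> (\<exists>V E. simple_graph V E \<and> encodes_graph V E x \<and> has_clique V E k)"
    by (simp add: Clique_def a)
  then show "a \<in> yes_instances Clique \<longleftrightarrow> reduction a \<in> yes_instances BNSL_treewidth"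
    using reduce graph by blast
qed

theorem theorem3:
  shows "W1_hard BNSL_treewidth"
  unfolding W1_hard_def
proof
  fix L assume "L \<in> W1"
  then have "fpt_reducible L Clique" by (simp add: W1_def)
  then show "fpt_reducible L BNSL_treewidth"
    by (rule fpt_reducible_trans_poly[OF _ ptime_treduction]) (use reduction_correct in blast)+
qed

end
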